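(* Let $T>0$, let $A_\pm,B_\pm\in\mathbb{R}$, and let $\omega:\mathbb{R}\times[-T,T]\rightarrow\mathbb{R}$ be a smooth solution, periodic in $x$ (i.e. $\omega(x+L,y)=\omega(x,y)$ for some $L>0$), of the elliptic sinh-Gordon equation $\omega_{z\overline z}+\frac18\sinh(2\omega)=0$. Then $\omega$ satisfies the Durham boundary conditions $$\omega_y=Ae^{\omega}+Be^{-\omega}\quad\text{along }\mathbb{R}\times\{\pm T\},\ \text{with }(A,B)=(A_\pm,B_\pm)\text{ on }\mathbb{R}\times\{\pm T\},$$ if and only if it admits a polynomial Killing field $\Phi$, not identically zero, which satisfies the Sklyanin condition for fields (with the same constants), i.e. at every point of $\mathbb{R}\times\{\pm T\}$ and for all $\lambda,\gamma\in\mathbb{C}^*$, $$K(\lambda,\gamma)\,\Phi(\lambda,\gamma)=\overline{\Phi(\overline\lambda,\overline\gamma)}^{\,t}\,K(\lambda,\gamma).$$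
   Context: Write $z=x+iy$ and $\Omega=\mathbb{R}\times[-T,T]\subset\mathbb{C}$; smooth means smooth up to the boundary. Let $\sigma_0=\begin{pmatrix}1&0\\0&-1\end{pmatrix}$, $\sigma_+=\begin{pmatrix}0&1\\0&0\end{pmatrix}$, $\sigma_-=\begin{pmatrix}0&0\\1&0\end{pmatrix}$. For $\lambda,\gamma\in\mathbb{C}^*$ the Lax pair of $\omega$ is the $1$-form $\alpha(\lambda,\gamma)=\alpha_z\,dz+\alpha_{\overline z}\,d\overline z$ with $$\alpha_z=\tfrac12\omega_z\sigma_0+\tfrac{i}{4\lambda}e^{\omega}\sigma_++\tfrac{i\gamma}{4}e^{-\omega}\sigma_-,\qquad \alpha_{\overline z}=-\tfrac12\omega_{\overline z}\sigma_0+\tfrac{i}{4\gamma}e^{-\omega}\sigma_++\tfrac{i\lambda}{4}e^{\omega}\sigma_-.$$ A Killing field of $\omega$ is a function $\Phi:\mathbb{C}^*\times\mathbb{C}^*\rightarrow C^\infty(\Omega,\mathfrak{sl}_2(\mathbb{C}))$ with $d\Phi(\lambda,\gamma)=[\Phi(\lambda,\gamma),\alpha(\lambda,\gamma)]$ for all $\lambda,\gamma\in\mathbb{C}^*$. It is polynomial if $\Phi(\lambda,\gamma)=\sum_{(m,n)\in F}\Phi_{m,n}\lambda^m\gamma^n$ for some finite $F\subset\mathbb{Z}\times\mathbb{Z}$ and smooth functions $\Phi_{m,n}:\Omega\rightarrow\mathfrak{sl}_2(\mathbb{C})$. Sklyanin's $K$-matrix is $$K(\lambda,\gamma)=\begin{pmatrix}4A\gamma-4B\lambda&\frac{\lambda}{\gamma}-\frac{\gamma}{\lambda}\\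 \frac{\lambda}{\gamma}-\frac{\gamma}{\lambda}&\frac{4A}{\gamma}-\frac{4B}{\lambda}\end{pmatrix},$$ where $(A,B)=(A_+,B_+)$ on $\mathbb{R}\times\{T\}$ and $(A,B)=(A_-,B_-)$ on $\mathbb{R}\times\{-T\}$. *)

theory Defs
  imports "HOL-Analysis.Analysis"
begin

definition strip :: "real \<Rightarrow> complex set" where
  "strip T = {z. - T \<le> Im z \<and> Im z \<le> T}"

text \<open>
  Partial derivatives are taken within the domain \<open>S\<close>, so they are one-sided on its boundary.
  On a strip with nonempty interior the derivative within the strip is unique, hence the
  choice made by \<open>frechet_derivative\<close> is harmless at points of differentiability.
\<close>

definition dx_within :: "complex set \<Rightarrow> (complex \<Rightarrow> 'a::real_normed_vector) \<Rightarrow> complex \<Rightarrow> 'a" where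
  "dx_within S f z = frechet_derivative f (at z within S) 1"

definition dy_within :: "complex set \<Rightarrow> (complex \<Rightarrow> 'a::real_normed_vector) \<Rightarrow> complex \<Rightarrow> 'a" where
  "dy_within S f z = frechet_derivative f (at z within S) \<i>"

definition dz_within :: "complex set \<Rightarrow> (complex \<Rightarrow> complex) \<Rightarrow> complex \<Rightarrow> complex" where
  "dz_within S f z = (dx_within S f z - \<i> * dy_within S f z) / 2"

definition dzbar_within :: "complex set \<Rightarrow> (complex \<Rightarrow> complex) \<Rightarrow> complex \<Rightarrow> complex" where
  "dzbar_within S f z = (dx_within S f z + \<i> * dy_within S f z) / 2"

primrec Ck_within :: "nat \<Rightarrow> complex set \<Rightarrow> (complex \<Rightarrow> 'a::real_normed_vector) \<Rightarrow> bool" where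
  "Ck_within 0 S f \<longleftrightarrow> continuous_on S f"
| "Ck_within (Suc k) S f \<longleftrightarrow>
     f differentiable_on S \<and> Ck_within k S (dx_within S f) \<and> Ck_within k S (dy_within S f)"

text \<open>
  Differentiability is over the reals; for a strip this is smoothness up to the boundary.
\<close>

definition smooth_within :: "complex set \<Rightarrow> (complex \<Rightarrow> 'a::real_normed_vector) \<Rightarrow> bool" where
  "smooth_within S f \<longleftrightarrow> (\<forall>k. Ck_within k S f)"

definition matrix_smult :: "complex \<Rightarrow> complex^2^2 \<Rightarrow> complex^2^2" (infixr \<open>\<cdot>\<^sub>M\<close> 75) where
  "c \<cdot>\<^sub>M M = map_matrix (\<lambda>x. c * x) M"

definition conj_transpose :: "complex^2^2 \<Rightarrow> complex^2^2" where
  "conj_transpose M = map_matrix cnj (transpose M)"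

definition commutator :: "complex^2^2 \<Rightarrow> complex^2^2 \<Rightarrow> complex^2^2" where
  "commutator M N = M ** N - N ** M"

definition sl2 :: "(complex^2^2) set" where
  "sl2 = {M. trace M = 0}"

definition sigma_0 :: "complex^2^2" where
  "sigma_0 = vector [vector [1, 0], vector [0, - 1]]"

definition sigma_plus :: "complex^2^2" where
  "sigma_plus = vector [vector [0, 1], vector [0, 0]]"

definition sigma_minus :: "complex^2^2" where
  "sigma_minus = vector [vector [0, 0], vector [1, 0]]"

definition sinh_gordon :: "real \<Rightarrow> (complex \<Rightarrow> real) \<Rightarrow> bool" where
  "sinh_gordon T \<omega> \<longleftrightarrow>
     (\<forall>z\<in>strip T. dzbar_within (strip T) (dz_within (strip T) (\<lambda>w. complex_of_real (\<omega> w))) z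
                    + complex_of_real (sinh (2 * \<omega> z)) / 8 = 0)"

definition x_periodic :: "real \<Rightarrow> (complex \<Rightarrow> real) \<Rightarrow> bool" where
  "x_periodic T \<omega> \<longleftrightarrow> (\<exists>L>0. \<forall>z\<in>strip T. \<omega> (z + complex_of_real L) = \<omega> z)"

definition lax_z :: "real \<Rightarrow> (complex \<Rightarrow> real) \<Rightarrow> complex \<Rightarrow> complex \<Rightarrow> complex \<Rightarrow> complex^2^2" where
  "lax_z T \<omega> lam \<gamma> z =
     (dz_within (strip T) (\<lambda>w. complex_of_real (\<omega> w)) z / 2) \<cdot>\<^sub>M sigma_0
     + (\<i> / (4 * lam) * complex_of_real (exp (\<omega> z))) \<cdot>\<^sub>M sigma_plus
     + (\<i> * \<gamma> / 4 * complex_of_real (exp (- \<omega> z))) \<cdot>\<^sub>M sigma_minus"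

definition lax_zbar :: "real \<Rightarrow> (complex \<Rightarrow> real) \<Rightarrow> complex \<Rightarrow> complex \<Rightarrow> complex \<Rightarrow> complex^2^2" where
  "lax_zbar T \<omega> lam \<gamma> z =
     (- dzbar_within (strip T) (\<lambda>w. complex_of_real (\<omega> w)) z / 2) \<cdot>\<^sub>M sigma_0
     + (\<i> / (4 * \<gamma>) * complex_of_real (exp (- \<omega> z))) \<cdot>\<^sub>M sigma_plus
     + (\<i> * lam / 4 * complex_of_real (exp (\<omega> z))) \<cdot>\<^sub>M sigma_minus"

text \<open>
  The value of the 1-form at \<open>z\<close> on a tangent vector \<open>v\<close>: there \<open>dz\<close> is \<open>v\<close> and
  its conjugate form is \<open>cnj v\<close>.
\<close>

definition lax_form ::
  "real \<Rightarrow> (complex \<Rightarrow> real) \<Rightarrow> complex \<Rightarrow> complex \<Rightarrow> complex \<Rightarrow> complex \<Rightarrow> complex^2^2" where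
  "lax_form T \<omega> lam \<gamma> z v = v \<cdot>\<^sub>M lax_z T \<omega> lam \<gamma> z + cnj v \<cdot>\<^sub>M lax_zbar T \<omega> lam \<gamma> z"

text \<open>
  A field is represented by a total function of \<open>lam\<close>, \<open>\<gamma>\<close> and \<open>z\<close>;
  only its values for nonzero \<open>lam\<close>, \<open>\<gamma>\<close> and \<open>z\<close> in the strip are relevant.
\<close>

type_synonym field_family = "complex \<Rightarrow> complex \<Rightarrow> complex \<Rightarrow> complex^2^2"

definition killing_field :: "real \<Rightarrow> (complex \<Rightarrow> real) \<Rightarrow> field_family \<Rightarrow> bool" where
  "killing_field T \<omega> \<Phi> \<longleftrightarrow>
     (\<forall>lam \<gamma>. lam \<noteq> 0 \<longrightarrow> \<gamma> \<noteq> 0 \<longrightarrow>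
        smooth_within (strip T) (\<Phi> lam \<gamma>) \<and>
        (\<forall>z\<in>strip T. \<Phi> lam \<gamma> z \<in> sl2 \<and>
           (\<Phi> lam \<gamma> has_derivative (\<lambda>v. commutator (\<Phi> lam \<gamma> z) (lax_form T \<omega> lam \<gamma> z v)))
             (at z within strip T)))"

definition polynomial_field :: "real \<Rightarrow> field_family \<Rightarrow> bool" where
  "polynomial_field T \<Phi> \<longleftrightarrow>
     (\<exists>(F :: (int \<times> int) set) (C :: int \<Rightarrow> int \<Rightarrow> complex \<Rightarrow> complex^2^2).
        finite F \<and>
        (\<forall>(m, n)\<in>F. smooth_within (strip T) (C m n) \<and> (\<forall>z\<in>strip T. C m n z \<in> sl2)) \<and>
        (\<forall>lam \<gamma>. lam \<noteq> 0 \<longrightarrow> \<gamma> \<noteq> 0 \<longrightarrow>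
           (\<forall>z\<in>strip T. \<Phi> lam \<gamma> z = (\<Sum>(m, n)\<in>F. (lam powi m * \<gamma> powi n) \<cdot>\<^sub>M C m n z))))"

definition nonzero_field :: "real \<Rightarrow> field_family \<Rightarrow> bool" where
  "nonzero_field T \<Phi> \<longleftrightarrow> (\<exists>lam \<gamma>. lam \<noteq> 0 \<and> \<gamma> \<noteq> 0 \<and> (\<exists>z\<in>strip T. \<Phi> lam \<gamma> z \<noteq> 0))"

definition sklyanin_K :: "real \<Rightarrow> real \<Rightarrow> complex \<Rightarrow> complex \<Rightarrow> complex^2^2" where
  "sklyanin_K A B lam \<gamma> = vector
     [vector [4 * complex_of_real A * \<gamma> - 4 * complex_of_real B * lam, lam / \<gamma> - \<gamma> / lam],
      vector [lam / \<gamma> - \<gamma> / lam, 4 * complex_of_real A / \<gamma> - 4 * complex_of_real B / lam]]"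

definition sklyanin_on_line :: "real \<Rightarrow> real \<Rightarrow> real \<Rightarrow> field_family \<Rightarrow> bool" where
  "sklyanin_on_line h A B \<Phi> \<longleftrightarrow>
     (\<forall>z lam \<gamma>. Im z = h \<longrightarrow> lam \<noteq> 0 \<longrightarrow> \<gamma> \<noteq> 0 \<longrightarrow>
        sklyanin_K A B lam \<gamma> ** \<Phi> lam \<gamma> z
        = conj_transpose (\<Phi> (cnj lam) (cnj \<gamma>) z) ** sklyanin_K A B lam \<gamma>)"

definition durham_on_line :: "real \<Rightarrow> real \<Rightarrow> real \<Rightarrow> real \<Rightarrow> (complex \<Rightarrow> real) \<Rightarrow> bool" where
  "durham_on_line T h A B \<omega> \<longleftrightarrow>
     (\<forall>z. Im z = h \<longrightarrow> dy_within (strip T) \<omega> z = A * exp (\<omega> z) + B * exp (- \<omega> z))"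

end

theory Submission
  imports Defs
begin

text \<open>
  From the boundary condition to a Killing field: the Killing equation has a formal solution at
  \<open>lam = 0\<close> whose coefficients are differential polynomials in \<open>\<omega>\<close>, hence periodic. Along the boundary
  it satisfies the Sklyanin condition as soon as \<open>\<omega>\<close> satisfies the Durham condition, because the formal
  solution of the Killing equation in the \<open>x\<close>-direction is unique. Consequently the imaginary parts of its
  diagonal coefficients solve the linearized boundary value problem. An energy estimate and the Poincare
  inequality on a fine grid show that this problem has a finite-dimensional solution space, so these
  functions are linearly dependent. Such a dependence allows one to cut off the formal solution and to glue
  it to its reflection at \<open>lam = \<infinity>\<close>.

  Conversely, differentiating the Sklyanin condition along the boundary gives
  \<open>K \<alpha> + \<alpha>\<^sup>* K = m J\<close> with \<open>J\<close> skew, where \<open>m\<close> is a multiple of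
  \<open>\<omega>\<^sub>y - A exp \<omega> - B exp (- \<omega>)\<close>. Where \<open>m\<close> does not vanish, \<open>\<Phi>\<close> is forced to vanish for all but
  finitely many \<open>lam\<close>, and then identically.
\<close>

subsection \<open>Calculus on the closed strip\<close>

text \<open>Only the quotient of the parameters matters: conjugation by a constant diagonal matrix
  carries \<open>(lam, \<gamma>)\<close> to \<open>(lam / \<gamma>, 1)\<close>, so the formal series
  need one variable.

  The formal field times a polynomial in \<open>1 / lam\<close>, once truncated, violates the
  Killing equation only through one function, the coefficient \<open>\<sigma>\<close> of order 0 in
  the upper left entry. The reflected half violates it through \<open>cnj \<sigma>\<close>. A glued
  field has a single coefficient of order 0 there, so the errors cancel when \<open>\<sigma>\<close>
  is real; hence only imaginary parts must be made dependent, over the reals. This fits the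
  boundary, where the Sklyanin condition couples each coefficient with its conjugate and yields the
  linearised boundary condition for their difference.

  Finite dimension comes from a count instead of spectral theory: a solution with mean zero on every
  cell of a fine enough grid vanishes, so the number of cells bounds the dimension.

  In the converse the field is constrained near one boundary point; the Killing equation carries the
  zero through the strip, and the finite sum over powers of \<open>lam\<close> lets a nonzero value
  persist at nearby, unexceptional \<open>lam\<close>.\<close>

locale wide_strip =
  fixes T :: real
  assumes T_pos: "0 < T"
begin

abbreviation "S \<equiv> strip T"
abbreviation Dx :: "(complex \<Rightarrow> 'a::real_normed_vector) \<Rightarrow> complex \<Rightarrow> 'a" where "Dx \<equiv> dx_within (strip T)"
abbreviation Dy :: "(complex \<Rightarrow> 'a::real_normed_vector) \<Rightarrow> complex \<Rightarrow> 'a" where "Dy \<equiv> dy_within (strip T)"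

text \<open>The closed strip leaves room for a short step in each coordinate direction at each of
  its points, the boundary included.\<close>

lemma has_derivative_strip_unique:
  fixes f :: "complex \<Rightarrow> 'a::real_normed_vector"
  assumes "z \<in> S" "(f has_derivative f') (at z within S)" "(f has_derivative f'') (at z within S)"
  shows "f' = f''"
proof (rule frechet_derivative_unique_within[OF assms(2,3)])
  fix i :: complex and e :: real
  assume i: "i \<in> Basis" and e: "e > 0"
  \<comment> \<open>The sign makes a vertical step go towards the real axis, and its length is at
    most \<open>T\<close>, so it cannot leave the strip on the far side.\<close>
  define d where "d = (if Im z \<le> 0 then min (e / 2) T else - min (e / 2) T)"
  have "0 < \<bar>d\<bar>" "\<bar>d\<bar> < e" using e T_pos by (auto simp: d_def)
  moreover have "z + d *\<^sub>R i \<in> S"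
    using i assms(1) T_pos e by (auto simp: Basis_complex_def strip_def d_def)
  ultimately show "\<exists>d. 0 < \<bar>d\<bar> \<and> \<bar>d\<bar> < e \<and> z + d *\<^sub>R i \<in> S" by blast
qed

lemma frechet_derivative_strip:
  fixes f :: "complex \<Rightarrow> 'a::real_normed_vector"
  assumes "z \<in> S" "(f has_derivative f') (at z within S)"
  shows "frechet_derivative f (at z within S) = f'"
  using has_derivative_strip_unique[OF assms(1) _ assms(2)] assms(2)
  by (meson differentiableI frechet_derivative_works)

lemma
  fixes f :: "complex \<Rightarrow> 'a::real_normed_vector"
  assumes "z \<in> S" "(f has_derivative f') (at z within S)"
  shows dx_within_eqI: "Dx f z = f' 1"
    and dy_within_eqI: "Dy f z = f' \<i>"
  by (simp_all add: dx_within_def dy_within_def frechet_derivative_strip[OF assms])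

lemma has_derivative_dx_dy:
  fixes f :: "complex \<Rightarrow> 'a::real_normed_vector"
  assumes "z \<in> S" "f differentiable (at z within S)"
  shows "(f has_derivative (\<lambda>v. Re v *\<^sub>R Dx f z + Im v *\<^sub>R Dy f z)) (at z within S)"
proof -
  obtain f' where f': "(f has_derivative f') (at z within S)"
    using assms(2) by (auto simp: differentiable_def)
  interpret f': bounded_linear f' by (rule has_derivative_bounded_linear[OF f'])
  have "f' v = Re v *\<^sub>R f' 1 + Im v *\<^sub>R f' \<i>" for v
  proof -
    have "v = Re v *\<^sub>R 1 + Im v *\<^sub>R \<i>" by (simp add: complex_eq_iff)
    then show ?thesis by (metis f'.add f'.scaleR)
  qed
  then show ?thesis
    using f' by (metis (no_types, lifting) ext assms(1) dx_within_eqI dy_within_eqI)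
qed

lemma
  fixes f g :: "complex \<Rightarrow> 'a::real_normed_vector"
  assumes "\<And>z. z \<in> S \<Longrightarrow> f z = g z" "z \<in> S"
  shows dx_within_cong: "Dx f z = Dx g z" (is ?G1)
    and dy_within_cong: "Dy f z = Dy g z" (is ?G2)
proof -
  \<comment> \<open>The two functions have the same derivatives within the strip, so the choice
    operator behind \<open>frechet_derivative\<close> picks the same map, whether or not a
    derivative exists.\<close>
  have "(f has_derivative f') (at z within S) \<longleftrightarrow> (g has_derivative f') (at z within S)" for f'
    using has_derivative_transform[of z S f g f'] has_derivative_transform[of z S g f f'] assms
    by auto
  then have "frechet_derivative f (at z within S) = frechet_derivative g (at z within S)"
    by (simp add: frechet_derivative_def)
  then show ?G1 ?G2
    by (simp_all add: dx_within_def dy_within_def)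
qed

section \<open>Functions of class \<open>C^k\<close> on the strip\<close>

lemma Ck_within_cong:
  fixes f g :: "complex \<Rightarrow> 'a::real_normed_vector"
  assumes "\<And>z. z \<in> S \<Longrightarrow> f z = g z" "Ck_within k S f"
  shows "Ck_within k S g"
  using assms
proof (induction k arbitrary: f g)
  case 0
  then show ?case using continuous_on_cong by (metis Ck_within.simps(1))
next
  case (Suc k)
  have "g differentiable_on S"
  proof -
    have "f differentiable_on S" using Suc.prems(2) by simp
    then show ?thesis
      unfolding differentiable_on_def differentiable_def
      using Suc.prems(1) has_derivative_transform[of _ S g f] by metis
  qed
  moreover have "Ck_within k S (Dx g)"
  proof (rule Suc.IH)
    show "Ck_within k S (Dx f)" using Suc.prems(2) by simp
    show "Dx f z = Dx g z" if "z \<in> S" for z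
      by (rule dx_within_cong[OF Suc.prems(1) that])
  qed
  moreover have "Ck_within k S (Dy g)"
  proof (rule Suc.IH)
    show "Ck_within k S (Dy f)" using Suc.prems(2) by simp
    show "Dy f z = Dy g z" if "z \<in> S" for z
      by (rule dy_within_cong[OF Suc.prems(1) that])
  qed
  ultimately show ?case by simp
qed

lemma Ck_within_SucD:
  fixes f :: "complex \<Rightarrow> 'a::real_normed_vector"
  assumes "Ck_within (Suc k) S f"
  shows "Ck_within k S f"
  using assms
proof (induction k arbitrary: f)
  case 0
  then show ?case by (simp add: differentiable_imp_continuous_on)
next
  case (Suc k)
  have *: "f differentiable_on S \<and> Ck_within (Suc k) S (Dx f) \<and> Ck_within (Suc k) S (Dy f)"
    using Suc.prems by (simp only: Ck_within.simps(2))
  show ?case unfolding Ck_within.simps(2)[of k] using * Suc.IH by blast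
qed

lemma has_derivative_C1:
  fixes f :: "complex \<Rightarrow> 'a::real_normed_vector"
  assumes "Ck_within (Suc k) S f" "z \<in> S"
  shows "(f has_derivative (\<lambda>v. Re v *\<^sub>R Dx f z + Im v *\<^sub>R Dy f z)) (at z within S)"
  by (rule has_derivative_dx_dy) (use assms in \<open>auto simp: differentiable_on_def\<close>)

text \<open>Lets the inductions on the order work with explicit candidates for the partial
  derivatives, in place of \<open>dx_within\<close> and \<open>dy_within\<close>, which are defined
  by choice.\<close>

lemma Ck_within_SucI:
  fixes f f1 f2 :: "complex \<Rightarrow> 'a::real_normed_vector"
  assumes "\<And>z. z \<in> S \<Longrightarrow> (f has_derivative (\<lambda>v. Re v *\<^sub>R f1 z + Im v *\<^sub>R f2 z)) (at z within S)"
    and "Ck_within k S f1" "Ck_within k S f2"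
  shows "Ck_within (Suc k) S f"
proof -
  have "f differentiable_on S"
    using assms(1) by (auto simp: differentiable_on_def differentiable_def)
  moreover have "Dx f z = f1 z" "Dy f z = f2 z" if "z \<in> S" for z
    using dx_within_eqI[OF that assms(1)[OF that]] dy_within_eqI[OF that assms(1)[OF that]] by simp_all
  ultimately show ?thesis
    using Ck_within_cong[OF _ assms(2), of "Dx f"] Ck_within_cong[OF _ assms(3), of "Dy f"]
    by simp
qed

lemma Ck_within_const: "Ck_within k S (\<lambda>z. c :: 'a::real_normed_vector)"
proof (induction k arbitrary: c)
  case (Suc k)
  show ?case by (rule Ck_within_SucI[where ?f1.0 = "\<lambda>_. 0" and ?f2.0 = "\<lambda>_. 0"]) (auto simp: Suc)
qed simp

lemma Ck_within_add:
  fixes f g :: "complex \<Rightarrow> 'a::real_normed_vector"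
  assumes "Ck_within k S f" "Ck_within k S g"
  shows "Ck_within k S (\<lambda>z. f z + g z)"
  using assms
proof (induction k arbitrary: f g)
  case 0
  then show ?case by (simp add: continuous_on_add)
next
  case (Suc k)
  show ?case
  proof (rule Ck_within_SucI)
    fix z assume z: "z \<in> S"
    show "((\<lambda>z. f z + g z) has_derivative (\<lambda>v. Re v *\<^sub>R (Dx f z + Dx g z)
        + Im v *\<^sub>R (Dy f z + Dy g z))) (at z within S)"
      using has_derivative_add[OF has_derivative_C1[OF Suc.prems(1) z] has_derivative_C1[OF Suc.prems(2) z]]
      by (simp add: algebra_simps)
  qed (use Suc in simp_all)
qed

lemma Ck_within_linear:
  fixes f :: "complex \<Rightarrow> 'a::real_normed_vector" and h :: "'a \<Rightarrow> 'b::real_normed_vector"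
  assumes h: "bounded_linear h" and "Ck_within k S f"
  shows "Ck_within k S (\<lambda>z. h (f z))"
  using assms(2)
proof (induction k arbitrary: f)
  case 0
  then show ?case by (simp add: bounded_linear.continuous_on[OF h])
next
  case (Suc k)
  interpret h: bounded_linear h by (rule h)
  show ?case
  proof (rule Ck_within_SucI)
    fix z assume z: "z \<in> S"
    show "((\<lambda>z. h (f z)) has_derivative (\<lambda>v. Re v *\<^sub>R h (Dx f z) + Im v *\<^sub>R h (Dy f z)))
        (at z within S)"
      using h.has_derivative[OF has_derivative_C1[OF Suc.prems z]] by (simp add: h.add h.scaleR)
  qed (use Suc in simp_all)
qed

text \<open>Product rule: the partial derivatives are sums of the same shape with one factor
  differentiated and the other used at the lower order; this is why both \<open>f\<close> and
  \<open>g\<close> vary in the induction.\<close>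

lemma Ck_within_bilinear:
  fixes f :: "complex \<Rightarrow> 'a::real_normed_vector" and g :: "complex \<Rightarrow> 'b::real_normed_vector"
    and h :: "'a \<Rightarrow> 'b \<Rightarrow> 'c::real_normed_vector"
  assumes h: "bounded_bilinear h" and "Ck_within k S f" "Ck_within k S g"
  shows "Ck_within k S (\<lambda>z. h (f z) (g z))"
  using assms(2,3)
proof (induction k arbitrary: f g)
  case 0
  then show ?case by (simp add: bounded_bilinear.continuous_on[OF h])
next
  case (Suc k)
  interpret h: bounded_bilinear h by (rule h)
  show ?case
  proof (rule Ck_within_SucI)
    fix z assume z: "z \<in> S"
    show "((\<lambda>z. h (f z) (g z)) has_derivative
        (\<lambda>v. Re v *\<^sub>R (h (Dx f z) (g z) + h (f z) (Dx g z))
           + Im v *\<^sub>R (h (Dy f z) (g z) + h (f z) (Dy g z)))) (at z within S)"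
      using h.FDERIV[OF has_derivative_C1[OF Suc.prems(1) z] has_derivative_C1[OF Suc.prems(2) z]]
      by (simp add: h.add_left h.add_right h.scaleR_left h.scaleR_right algebra_simps)
  next
    show "Ck_within k S (\<lambda>z. h (Dx f z) (g z) + h (f z) (Dx g z))"
      "Ck_within k S (\<lambda>z. h (Dy f z) (g z) + h (f z) (Dy g z))"
      using Suc.prems Ck_within_SucD[OF Suc.prems(1)] Ck_within_SucD[OF Suc.prems(2)]
      by (auto intro!: Ck_within_add Suc.IH)
  qed
qed

lemma Ck_within_exp:
  fixes f :: "complex \<Rightarrow> real"
  assumes "Ck_within k S f"
  shows "Ck_within k S (\<lambda>z. exp (f z))"
  using assms
proof (induction k)
  case 0
  then show ?case by (simp add: continuous_on_exp)
next
  case (Suc k)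
  show ?case
  proof (rule Ck_within_SucI)
    fix z assume z: "z \<in> S"
    have "(exp has_derivative (\<lambda>x. x * exp (f z))) (at (f z))"
      by (auto intro!: derivative_eq_intros)
    from has_derivative_compose[OF has_derivative_C1[OF Suc.prems z] this]
    show "((\<lambda>z. exp (f z)) has_derivative (\<lambda>v. Re v *\<^sub>R (exp (f z) * Dx f z)
        + Im v *\<^sub>R (exp (f z) * Dy f z))) (at z within S)"
      by (simp add: algebra_simps)
  next
    have "Ck_within k S (\<lambda>z. exp (f z))" using Suc.IH Ck_within_SucD[OF Suc.prems] by simp
    then show "Ck_within k S (\<lambda>z. exp (f z) * Dx f z)" "Ck_within k S (\<lambda>z. exp (f z) * Dy f z)"
      using Suc.prems by (auto intro!: Ck_within_bilinear[OF bounded_bilinear_mult])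
  qed
qed

named_theorems sm_intros

abbreviation sm :: "(complex \<Rightarrow> 'a::real_normed_vector) \<Rightarrow> bool" where
  "sm \<equiv> smooth_within S"

lemma sm_id [sm_intros]: "sm (\<lambda>z. z)"
  unfolding smooth_within_def
proof
  fix k show "Ck_within k S (\<lambda>z. z)"
  proof (cases k)
    case (Suc k)
    show ?thesis unfolding Suc
    proof (rule Ck_within_SucI)
      show "((\<lambda>z. z) has_derivative (\<lambda>v. Re v *\<^sub>R 1 + Im v *\<^sub>R \<i>)) (at z within S)" for z
        by (rule has_derivative_eq_rhs[OF has_derivative_ident]) (simp add: fun_eq_iff complex_eq_iff)
    qed (rule Ck_within_const)+
  qed simp
qed

lemma sm_const [sm_intros]: "sm (\<lambda>z. c)"
  by (simp add: smooth_within_def Ck_within_const)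

lemma sm_add [sm_intros]: "sm f \<Longrightarrow> sm g \<Longrightarrow> sm (\<lambda>z. f z + g z)"
  by (simp add: smooth_within_def Ck_within_add)

lemma sm_linear: "bounded_linear h \<Longrightarrow> sm f \<Longrightarrow> sm (\<lambda>z. h (f z))"
  by (simp add: smooth_within_def Ck_within_linear)

lemma sm_bilinear: "bounded_bilinear h \<Longrightarrow> sm f \<Longrightarrow> sm g \<Longrightarrow> sm (\<lambda>z. h (f z) (g z))"
  by (simp add: smooth_within_def Ck_within_bilinear)

lemma sm_exp [sm_intros]: "sm f \<Longrightarrow> sm (\<lambda>z. exp (f z :: real))"
  by (simp add: smooth_within_def Ck_within_exp)

lemma sm_minus [sm_intros]: "sm f \<Longrightarrow> sm (\<lambda>z. - f z)"
  by (rule sm_linear[OF bounded_linear_minus[OF bounded_linear_ident]])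

lemma sm_diff [sm_intros]: "sm f \<Longrightarrow> sm g \<Longrightarrow> sm (\<lambda>z. f z - g z)"
  using sm_add[OF _ sm_minus, of f g] by simp

lemma sm_mult [sm_intros]:
  fixes f g :: "complex \<Rightarrow> 'a::real_normed_algebra"
  shows "sm f \<Longrightarrow> sm g \<Longrightarrow> sm (\<lambda>z. f z * g z)"
  by (rule sm_bilinear[OF bounded_bilinear_mult])

lemma sm_divide [sm_intros]:
  fixes f :: "complex \<Rightarrow> 'a::real_normed_field"
  shows "sm f \<Longrightarrow> sm (\<lambda>z. f z / c)"
  by (simp add: divide_inverse sm_intros)

lemma sm_sum [sm_intros]: "(\<And>i. i \<in> I \<Longrightarrow> sm (f i)) \<Longrightarrow> sm (\<lambda>z. \<Sum>i\<in>I. f i z)"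
  by (induction I rule: infinite_finite_induct) (auto intro: sm_intros)

lemma sm_cnj [sm_intros]: "sm f \<Longrightarrow> sm (\<lambda>z. cnj (f z))"
  by (rule sm_linear[OF bounded_linear_cnj])

lemma sm_Im [sm_intros]: "sm f \<Longrightarrow> sm (\<lambda>z. Im (f z))"
  by (rule sm_linear[OF bounded_linear_Im])

lemma sm_of_real [sm_intros]:
  "sm f \<Longrightarrow> sm (\<lambda>z. of_real (f z) :: 'a::{real_normed_algebra_1})"
  by (rule sm_linear[OF bounded_linear_of_real])

lemma
  fixes f :: "complex \<Rightarrow> 'a::real_normed_vector"
  assumes "sm f"
  shows sm_dx [sm_intros]: "sm (Dx f)" and sm_dy [sm_intros]: "sm (Dy f)"
  using assms unfolding smooth_within_def by (meson Ck_within.simps(2))+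

lemma sm_continuous: "sm f \<Longrightarrow> continuous_on S f"
  unfolding smooth_within_def by (meson Ck_within.simps(1))

lemma sm_has_derivative:
  fixes f :: "complex \<Rightarrow> 'a::real_normed_vector"
  assumes "sm f" "z \<in> S"
  shows "(f has_derivative (\<lambda>v. Re v *\<^sub>R Dx f z + Im v *\<^sub>R Dy f z)) (at z within S)"
  by (rule has_derivative_C1[of 0]) (use assms in \<open>simp_all add: smooth_within_def del: Ck_within.simps\<close>)

lemma
  fixes f :: "complex \<Rightarrow> 'a::real_normed_vector" and h :: "'a \<Rightarrow> 'b::real_normed_vector"
  assumes h: "bounded_linear h" and "sm f" "z \<in> S"
  shows dx_within_linear: "Dx (\<lambda>z. h (f z)) z = h (Dx f z)"
    and dy_within_linear: "Dy (\<lambda>z. h (f z)) z = h (Dy f z)"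
  using dx_within_eqI[OF assms(3) bounded_linear.has_derivative[OF h sm_has_derivative[OF assms(2,3)]]]
    dy_within_eqI[OF assms(3) bounded_linear.has_derivative[OF h sm_has_derivative[OF assms(2,3)]]]
  by simp_all

subsection \<open>Restriction to horizontal and vertical lines\<close>

lemma Complex_in_strip: "Complex x y \<in> S \<longleftrightarrow> y \<in> {-T..T}"
  by (auto simp: strip_def)

lemma vderiv_x:
  fixes f :: "complex \<Rightarrow> 'a::real_normed_vector"
  assumes "sm f" "y \<in> {-T..T}"
  shows "((\<lambda>x. f (Complex x y)) has_vector_derivative Dx f (Complex x y)) (at x within X)"
proof -
  have z: "Complex x y \<in> S" using assms Complex_in_strip by simp
  have "((\<lambda>x. Complex x y) has_derivative (\<lambda>t. of_real t)) (at x within X)"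
  proof -
    have "(\<lambda>x. Complex x y) = (\<lambda>x. of_real x + \<i> * of_real y)" by (auto simp: complex_eq_iff)
    then show ?thesis by (auto intro!: derivative_eq_intros)
  qed
  moreover have "(f has_derivative (\<lambda>v. Re v *\<^sub>R Dx f (Complex x y) + Im v *\<^sub>R Dy f (Complex x y)))
      (at (Complex x y) within (\<lambda>x. Complex x y) ` X)"
    using sm_has_derivative[OF assms(1) z]
    by (rule has_derivative_subset) (use assms in \<open>auto simp: Complex_in_strip\<close>)
  ultimately show ?thesis
    unfolding has_vector_derivative_def by (rule has_derivative_in_compose[THEN has_derivative_eq_rhs]) auto
qed

lemma vderiv_y:
  fixes f :: "complex \<Rightarrow> 'a::real_normed_vector"
  assumes "sm f" "y \<in> {-T..T}"
  shows "((\<lambda>y. f (Complex x y)) has_vector_derivative Dy f (Complex x y)) (at y within {-T..T})"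
proof -
  have z: "Complex x y \<in> S" using assms Complex_in_strip by simp
  have "((\<lambda>y. Complex x y) has_derivative (\<lambda>t. \<i> * of_real t)) (at y within {-T..T})"
  proof -
    have "(\<lambda>y. Complex x y) = (\<lambda>y. \<i> * of_real y + complex_of_real x)" by (auto simp: complex_eq_iff)
    then show ?thesis by (auto intro!: derivative_eq_intros)
  qed
  moreover have "(f has_derivative (\<lambda>v. Re v *\<^sub>R Dx f (Complex x y) + Im v *\<^sub>R Dy f (Complex x y)))
      (at (Complex x y) within (\<lambda>y. Complex x y) ` {-T..T})"
    using sm_has_derivative[OF assms(1) z]
    by (rule has_derivative_subset) (auto simp: Complex_in_strip)
  ultimately show ?thesis
    unfolding has_vector_derivative_def by (rule has_derivative_in_compose[THEN has_derivative_eq_rhs]) auto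
qed

text \<open>Schwarz's argument: the second difference over the corners of a rectangle is evaluated
  by the mean value theorem in both orders. A rectangle with a corner at \<open>z\<close> fits into
  the strip also at a boundary point, where no neighbourhood does.\<close>

lemma mixed_difference_quotients:
  fixes f :: "complex \<Rightarrow> real"
  assumes f: "sm f" and ab: "a < b" and cd: "c < d" "{c..d} \<subseteq> {-T..T}"
  obtains x y x' y' where "x \<in> {a..b}" "x' \<in> {a..b}" "y \<in> {c..d}" "y' \<in> {c..d}"
    "Dy (Dx f) (Complex x y) = Dx (Dy f) (Complex x' y')"
proof -
  have cT: "y \<in> {-T..T}" if "c \<le> y" "y \<le> d" for y using that cd by auto
  let ?D = "f (Complex b d) - f (Complex b c) - (f (Complex a d) - f (Complex a c))"
  have "\<exists>x\<in>{a<..<b}. (f (Complex b d) - f (Complex b c)) - (f (Complex a d) - f (Complex a c))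
      = (b - a) * (Dx f (Complex x d) - Dx f (Complex x c))"
    by (rule mvt_simple[OF ab, where f = "\<lambda>x. f (Complex x d) - f (Complex x c)"
          and f' = "\<lambda>x t. t * (Dx f (Complex x d) - Dx f (Complex x c))"])
      (use has_derivative_diff[OF vderiv_x[OF f, unfolded has_vector_derivative_def]
            vderiv_x[OF f, unfolded has_vector_derivative_def]] cT cd(1)
       in \<open>auto simp: algebra_simps\<close>)
  then obtain x where x: "x \<in> {a<..<b}" "?D = (b - a) * (Dx f (Complex x d) - Dx f (Complex x c))"
    by auto
  have "\<exists>y\<in>{c<..<d}. Dx f (Complex x d) - Dx f (Complex x c)
      = (d - c) * Dy (Dx f) (Complex x y)"
    by (rule mvt_simple[OF cd(1), where f = "\<lambda>y. Dx f (Complex x y)"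
          and f' = "\<lambda>y t. t * Dy (Dx f) (Complex x y)"])
      (use has_derivative_subset[OF vderiv_y[OF sm_dx[OF f], unfolded has_vector_derivative_def] cd(2)] cT
       in auto)
  then obtain y where y: "y \<in> {c<..<d}" "?D = (b - a) * ((d - c) * Dy (Dx f) (Complex x y))"
    using x by auto
  have "\<exists>y\<in>{c<..<d}. (f (Complex b d) - f (Complex a d)) - (f (Complex b c) - f (Complex a c))
      = (d - c) * (Dy f (Complex b y) - Dy f (Complex a y))"
    by (rule mvt_simple[OF cd(1), where f = "\<lambda>y. f (Complex b y) - f (Complex a y)"
          and f' = "\<lambda>y t. t * (Dy f (Complex b y) - Dy f (Complex a y))"])
      (use has_derivative_diff[OF has_derivative_subset[OF vderiv_y[OF f, unfolded has_vector_derivative_def] cd(2)]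
            has_derivative_subset[OF vderiv_y[OF f, unfolded has_vector_derivative_def] cd(2)]] cT
       in \<open>auto simp: algebra_simps\<close>)
  then obtain y' where y': "y' \<in> {c<..<d}" "?D = (d - c) * (Dy f (Complex b y') - Dy f (Complex a y'))"
    by (auto simp: algebra_simps)
  have "\<exists>x\<in>{a<..<b}. Dy f (Complex b y') - Dy f (Complex a y')
      = (b - a) * Dx (Dy f) (Complex x y')"
    by (rule mvt_simple[OF ab, where f = "\<lambda>x. Dy f (Complex x y')"
          and f' = "\<lambda>x t. t * Dx (Dy f) (Complex x y')"])
      (use vderiv_x[OF sm_dy[OF f], unfolded has_vector_derivative_def] cT y' in auto)
  then obtain x' where x': "x' \<in> {a<..<b}" "?D = (d - c) * ((b - a) * Dx (Dy f) (Complex x' y'))"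
    using y' by auto
  have "Dy (Dx f) (Complex x y) = Dx (Dy f) (Complex x' y')"
    using y(2) x'(2) ab cd(1) by (simp add: mult.left_commute)
  then show thesis using that[of x x' y y'] x(1) x'(1) y(1) y'(1) by auto
qed

lemma mixed_partials_real:
  fixes f :: "complex \<Rightarrow> real"
  assumes f: "sm f" and z: "z \<in> S"
  shows "Dx (Dy f) z = Dy (Dx f) z"
proof (rule ccontr)
  let ?p = "Dx (Dy f)" and ?q = "Dy (Dx f)"
  assume "?p z \<noteq> ?q z"
  then have e: "0 < \<bar>?p z - ?q z\<bar> / 2" (is "0 < ?e") by simp
  have "continuous_on S ?p" "continuous_on S ?q" using f by (auto intro!: sm_continuous sm_intros)
  then obtain r1 r2 where r: "0 < r1" "\<And>w. w \<in> S \<Longrightarrow> dist w z < r1 \<Longrightarrow> dist (?p w) (?p z) < ?e"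
    "0 < r2" "\<And>w. w \<in> S \<Longrightarrow> dist w z < r2 \<Longrightarrow> dist (?q w) (?q z) < ?e"
    using z e unfolding continuous_on_iff by metis
  define h where "h = min T (min (r1 / 4) (r2 / 4))"
  have h: "0 < h" "h \<le> T" "2 * h < r1" "2 * h < r2" using r T_pos by (auto simp: h_def)
  \<comment> \<open>The square extends from \<open>z\<close> upwards in the lower half of the strip
    and downwards in the upper half; its side is at most \<open>T\<close>.\<close>
  define c where "c = (if Im z \<le> 0 then Im z else Im z - h)"
  have ch: "{c..c + h} \<subseteq> {-T..T}" using z h by (auto simp: strip_def c_def split: if_splits)
  obtain x y x' y' where xy: "x \<in> {Re z..Re z + h}" "x' \<in> {Re z..Re z + h}" "y \<in> {c..c+h}" "y' \<in> {c..c+h}"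
    "?q (Complex x y) = ?p (Complex x' y')"
    by (rule mixed_difference_quotients[OF f, of "Re z" "Re z + h" c "c + h"]) (use h ch that in \<open>simp_all\<close>)
  have close: "Complex u v \<in> S \<and> dist (Complex u v) z \<le> 2 * h" if "u \<in> {Re z..Re z + h}" "v \<in> {c..c + h}" for u v
  proof -
    have "dist (Complex u v) z \<le> \<bar>u - Re z\<bar> + \<bar>v - Im z\<bar>"
      using cmod_le[of "Complex u v - z"] by (simp add: dist_norm)
    also have "\<dots> \<le> 2 * h" using that by (auto simp: c_def split: if_splits)
    finally show ?thesis using that ch by (auto simp: Complex_in_strip)
  qed
  have "dist (?q (Complex x y)) (?q z) < ?e" "dist (?p (Complex x' y')) (?p z) < ?e"
    using close[OF xy(1,3)] close[OF xy(2,4)] h r(2,4) by force+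
  then show False using xy(5) by (simp add: dist_real_def) argo
qed

lemma mixed_partials:
  fixes f :: "complex \<Rightarrow> complex"
  assumes f: "sm f" and z: "z \<in> S"
  shows "Dx (Dy f) z = Dy (Dx f) z"
proof -
  have "h (Dx (Dy f) z) = h (Dy (Dx f) z)"
    if h: "bounded_linear (h :: complex \<Rightarrow> real)" for h
  proof -
    have "h (Dx (Dy f) z) = Dx (\<lambda>z. h (Dy f z)) z"
      using dx_within_linear[OF h sm_dy[OF f] z] by simp
    also have "\<dots> = Dx (Dy (\<lambda>z. h (f z))) z"
      using z dy_within_linear[OF h f] by (intro dx_within_cong) simp_all
    also have "\<dots> = Dy (Dx (\<lambda>z. h (f z))) z"
      using mixed_partials_real[OF sm_linear[OF h f] z] .
    also have "\<dots> = Dy (\<lambda>z. h (Dx f z)) z"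
      using z dx_within_linear[OF h f] by (intro dy_within_cong) simp_all
    also have "\<dots> = h (Dy (Dx f) z)"
      using dy_within_linear[OF h sm_dx[OF f] z] by simp
    finally show ?thesis .
  qed
  from this[OF bounded_linear_Re] this[OF bounded_linear_Im] show ?thesis by (simp add: complex_eq_iff)
qed

end

subsection \<open>Wirtinger derivatives\<close>

context wide_strip
begin

abbreviation "Dz \<equiv> dz_within S"
abbreviation "Dzb \<equiv> dzbar_within S"

definition has_wirtinger :: "(complex \<Rightarrow> complex) \<Rightarrow> complex \<Rightarrow> complex \<Rightarrow> complex \<Rightarrow> bool" where
  "has_wirtinger f p q z \<longleftrightarrow> (f has_derivative (\<lambda>v. p * v + q * cnj v)) (at z within S)"

lemma
  assumes "z \<in> S" "has_wirtinger f p q z"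
  shows dz_within_eqI: "Dz f z = p" and dzbar_within_eqI: "Dzb f z = q"
proof -
  note * = assms(2)[unfolded has_wirtinger_def]
  have x: "Dx f z = p + q" using dx_within_eqI[OF assms(1) *] by simp
  have y: "Dy f z = p * \<i> - q * \<i>" using dy_within_eqI[OF assms(1) *] by simp
  show "Dz f z = p" "Dzb f z = q"
    unfolding dz_within_def dzbar_within_def x y by (simp_all add: complex_eq_iff)
qed

lemma sm_has_wirtinger:
  assumes "sm f" "z \<in> S"
  shows "has_wirtinger f (Dz f z) (Dzb f z) z"
  unfolding has_wirtinger_def
proof (rule has_derivative_eq_rhs[OF sm_has_derivative[OF assms]], rule ext)
  fix v
  show "Re v *\<^sub>R Dx f z + Im v *\<^sub>R Dy f z = Dz f z * v + Dzb f z * cnj v"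
    unfolding dz_within_def dzbar_within_def by (simp add: complex_eq_iff field_simps)
qed

lemma
  assumes "z \<in> S"
  shows dx_eq_dz_dzbar: "Dx f z = Dz f z + Dzb f z"
    and dy_eq_dz_dzbar: "Dy f z = \<i> * (Dz f z - Dzb f z)"
  by (simp_all add: dz_within_def dzbar_within_def complex_eq_iff field_simps)

lemma
  assumes "sm f"
  shows sm_dz [sm_intros]: "sm (Dz f)" and sm_dzbar [sm_intros]: "sm (Dzb f)"
proof -
  have "sm (\<lambda>z. (Dx f z - \<i> * Dy f z) / 2)" "sm (\<lambda>z. (Dx f z + \<i> * Dy f z) / 2)"
    by (intro sm_intros assms)+
  then show "sm (Dz f)" "sm (Dzb f)" by (auto simp: dz_within_def[abs_def] dzbar_within_def[abs_def])
qed

lemma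
  assumes "\<And>z. z \<in> S \<Longrightarrow> f z = g z" "z \<in> S"
  shows dz_within_cong: "Dz f z = Dz g z" and dzbar_within_cong: "Dzb f z = Dzb g z"
  using dx_within_cong[OF assms] dy_within_cong[OF assms] by (simp_all add: dz_within_def dzbar_within_def)

lemma
  assumes "z \<in> S"
  shows dz_const: "Dz (\<lambda>z. c) z = 0" and dzbar_const: "Dzb (\<lambda>z. c) z = 0"
proof -
  have "has_wirtinger (\<lambda>z. c) 0 0 z" by (simp add: has_wirtinger_def)
  then show "Dz (\<lambda>z. c) z = 0" "Dzb (\<lambda>z. c) z = 0"
    using dz_within_eqI dzbar_within_eqI assms by blast+
qed

lemma
  assumes "z \<in> S" "sm f" "sm g"
  shows dz_add: "Dz (\<lambda>z. f z + g z) z = Dz f z + Dz g z" (is ?G1)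
    and dzbar_add: "Dzb (\<lambda>z. f z + g z) z = Dzb f z + Dzb g z" (is ?G2)
proof -
  have "has_wirtinger (\<lambda>z. f z + g z) (Dz f z + Dz g z) (Dzb f z + Dzb g z) z"
    unfolding has_wirtinger_def
    by (rule has_derivative_eq_rhs[OF has_derivative_add[OF sm_has_wirtinger[OF assms(2,1), unfolded has_wirtinger_def]
        sm_has_wirtinger[OF assms(3,1), unfolded has_wirtinger_def]]]) (simp add: algebra_simps)
  from dz_within_eqI[OF assms(1) this] dzbar_within_eqI[OF assms(1) this]
  show ?G1 ?G2 .
qed

lemma
  assumes "z \<in> S" "sm f" "sm g"
  shows dz_mult: "Dz (\<lambda>z. f z * g z) z = Dz f z * g z + f z * Dz g z" (is ?G1)
    and dzbar_mult: "Dzb (\<lambda>z. f z * g z) z = Dzb f z * g z + f z * Dzb g z" (is ?G2)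
proof -
  have "has_wirtinger (\<lambda>z. f z * g z) (Dz f z * g z + f z * Dz g z) (Dzb f z * g z + f z * Dzb g z) z"
    unfolding has_wirtinger_def
    by (rule has_derivative_eq_rhs[OF has_derivative_mult[OF sm_has_wirtinger[OF assms(2,1), unfolded has_wirtinger_def]
        sm_has_wirtinger[OF assms(3,1), unfolded has_wirtinger_def]]]) (simp add: algebra_simps)
  from dz_within_eqI[OF assms(1) this] dzbar_within_eqI[OF assms(1) this]
  show ?G1
    ?G2 .
qed

lemma
  assumes "z \<in> S" "sm f"
  shows dz_cmult: "Dz (\<lambda>z. c * f z) z = c * Dz f z" and dzbar_cmult: "Dzb (\<lambda>z. c * f z) z = c * Dzb f z"
  using dz_mult[OF assms(1) sm_const assms(2)] dzbar_mult[OF assms(1) sm_const assms(2)] dz_const dzbar_const assms(1)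
  by simp_all

lemma
  assumes "z \<in> S" "sm f"
  shows dz_minus: "Dz (\<lambda>z. - f z) z = - Dz f z" and dzbar_minus: "Dzb (\<lambda>z. - f z) z = - Dzb f z"
  using dz_cmult[OF assms, of "-1"] dzbar_cmult[OF assms, of "-1"] by simp_all

lemma
  assumes "z \<in> S" "sm f"
  shows dz_divide: "Dz (\<lambda>z. f z / c) z = Dz f z / c" and dzbar_divide: "Dzb (\<lambda>z. f z / c) z = Dzb f z / c"
  using dz_cmult[OF assms, of "inverse c"] dzbar_cmult[OF assms, of "inverse c"]
  by (simp_all add: divide_inverse mult.commute)

lemma
  assumes "z \<in> S" "sm f" "sm g"
  shows dz_diff: "Dz (\<lambda>z. f z - g z) z = Dz f z - Dz g z"
    and dzbar_diff: "Dzb (\<lambda>z. f z - g z) z = Dzb f z - Dzb g z"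
  using dz_add[OF assms(1,2) sm_minus[OF assms(3)]] dzbar_add[OF assms(1,2) sm_minus[OF assms(3)]]
    dz_minus dzbar_minus assms by simp_all

lemma
  assumes "z \<in> S" "\<And>i. i \<in> I \<Longrightarrow> sm (f i)"
  shows dz_sum: "Dz (\<lambda>z. \<Sum>i\<in>I. f i z) z = (\<Sum>i\<in>I. Dz (f i) z)"
    and dzbar_sum: "Dzb (\<lambda>z. \<Sum>i\<in>I. f i z) z = (\<Sum>i\<in>I. Dzb (f i) z)"
  using assms(2)
  by (induction I rule: infinite_finite_induct)
    (use assms(1) in \<open>simp_all add: dz_const dzbar_const dz_add dzbar_add sm_sum\<close>)

lemma
  assumes "z \<in> S" "sm f"
  shows dz_cnj: "Dz (\<lambda>z. cnj (f z)) z = cnj (Dzb f z)" (is ?G1) and dzbar_cnj: "Dzb (\<lambda>z. cnj (f z)) z = cnj (Dz f z)" (is ?G2)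
proof -
  have "has_wirtinger (\<lambda>z. cnj (f z)) (cnj (Dzb f z)) (cnj (Dz f z)) z"
    unfolding has_wirtinger_def
    by (rule has_derivative_eq_rhs[OF bounded_linear.has_derivative[OF bounded_linear_cnj
          sm_has_wirtinger[OF assms(2,1), unfolded has_wirtinger_def]]]) (simp add: algebra_simps)
  from dz_within_eqI[OF assms(1) this] dzbar_within_eqI[OF assms(1) this]
  show ?G1 ?G2 .
qed

lemma
  fixes u :: "complex \<Rightarrow> real"
  assumes "z \<in> S" "sm u"
  shows dz_exp: "Dz (\<lambda>z. complex_of_real (exp (u z))) z = complex_of_real (exp (u z)) * Dz (\<lambda>z. complex_of_real (u z)) z" (is ?G1)
    and dzbar_exp: "Dzb (\<lambda>z. complex_of_real (exp (u z))) z = complex_of_real (exp (u z)) * Dzb (\<lambda>z. complex_of_real (u z)) z" (is ?G2)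
proof -
  have "(exp has_derivative (\<lambda>x. x * exp (of_real (u z) :: complex))) (at (of_real (u z)))"
    by (auto intro!: derivative_eq_intros)
  from has_derivative_compose[OF sm_has_wirtinger[OF sm_of_real[OF assms(2)] assms(1), unfolded has_wirtinger_def] this]
  have "has_wirtinger (\<lambda>z. complex_of_real (exp (u z))) (complex_of_real (exp (u z)) * Dz (\<lambda>z. complex_of_real (u z)) z)
      (complex_of_real (exp (u z)) * Dzb (\<lambda>z. complex_of_real (u z)) z) z"
    unfolding has_wirtinger_def exp_of_real[symmetric] by (rule has_derivative_eq_rhs) (simp add: algebra_simps)
  from dz_within_eqI[OF assms(1) this] dzbar_within_eqI[OF assms(1) this] show
    ?G1
    ?G2 .
qed

lemma dx_within_lincomb:
  fixes f g :: "complex \<Rightarrow> complex"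
  assumes "z \<in> S" "sm f" "sm g"
  shows "Dx (\<lambda>z. f z + c * g z) z = Dx f z + c * Dx g z"
    and "Dy (\<lambda>z. f z + c * g z) z = Dy f z + c * Dy g z"
  using assms dz_add[OF assms(1,2) sm_mult[OF sm_const[of c] assms(3)]]
    dzbar_add[OF assms(1,2) sm_mult[OF sm_const[of c] assms(3)]]
  by (simp_all add: dx_eq_dz_dzbar dy_eq_dz_dzbar dz_cmult dzbar_cmult algebra_simps)

lemma dz_dzbar_commute:
  assumes "z \<in> S" "sm f"
  shows "Dzb (Dz f) z = Dz (Dzb f) z"
proof -
  have d: "sm (Dx f)" "sm (Dy f)" using assms by (auto intro: sm_intros)
  have 1: "Dz f = (\<lambda>z. (Dx f z + (-\<i>) * Dy f z) / 2)"
    and 2: "Dzb f = (\<lambda>z. (Dx f z + \<i> * Dy f z) / 2)"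
    by (auto simp: dz_within_def dzbar_within_def)
  have 3: "sm (\<lambda>z. Dx f z + c * Dy f z)" for c by (intro sm_intros d)
  show ?thesis
    unfolding 1 2 dz_divide[OF assms(1) 3] dzbar_divide[OF assms(1) 3]
    unfolding dz_within_def dzbar_within_def dx_within_lincomb[OF assms(1) d] mixed_partials[OF assms(2,1)]
    by (simp add: algebra_simps)
qed

section \<open>Periodicity of derivatives\<close>

lemma has_derivative_translate:
  fixes f :: "complex \<Rightarrow> 'a::real_normed_vector"
  assumes "\<And>z. z \<in> S \<Longrightarrow> f (z + of_real L) = f z" "z \<in> S" "(f has_derivative D) (at (z + of_real L) within S)"
  shows "(f has_derivative D) (at z within S)"
proof -
  have "((\<lambda>z. z + of_real L) has_derivative (\<lambda>v. v)) (at z within S)" by (auto intro!: derivative_eq_intros)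
  moreover have "(f has_derivative D) (at (z + of_real L) within (\<lambda>z. z + of_real L) ` S)"
    by (rule has_derivative_subset[OF assms(3)]) (auto simp: strip_def)
  ultimately have "((\<lambda>z. f (z + of_real L)) has_derivative D) (at z within S)"
    by (rule has_derivative_in_compose)
  then show ?thesis by (rule has_derivative_transform[OF assms(2), rotated]) (simp add: assms(1))
qed

lemma
  fixes f :: "complex \<Rightarrow> complex"
  assumes "sm f" "\<And>z. z \<in> S \<Longrightarrow> f (z + of_real L) = f z" "z \<in> S"
  shows dz_periodic: "Dz f (z + of_real L) = Dz f z"
proof -
  have "z + of_real L \<in> S" using assms(3) by (simp add: strip_def)
  from has_derivative_translate[OF assms(2,3) sm_has_wirtinger[OF assms(1) this, unfolded has_wirtinger_def]]
  have "has_wirtinger f (Dz f (z + of_real L)) (Dzb f (z + of_real L)) z" by (simp add: has_wirtinger_def)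
  then show ?thesis using dz_within_eqI assms(3) by metis
qed

lemmas wirtinger_simps = dz_const dzbar_const dz_cmult dzbar_cmult dz_mult dzbar_mult dz_add dzbar_add
  dz_diff dzbar_diff dz_minus dzbar_minus dz_divide dzbar_divide

subsection \<open>Power series with smooth coefficients\<close>

text \<open>Everything is coefficientwise: the series are formal in \<open>lam\<close>, which is
  \<open>fps_X\<close>, and no convergence is asked for.\<close>

definition smf :: "(complex \<Rightarrow> complex fps) \<Rightarrow> bool" where
  "smf F \<longleftrightarrow> (\<forall>n. sm (\<lambda>z. fps_nth (F z) n))"

definition DZ :: "(complex \<Rightarrow> complex fps) \<Rightarrow> complex \<Rightarrow> complex fps" where
  "DZ F z = Abs_fps (\<lambda>n. Dz (\<lambda>z. fps_nth (F z) n) z)"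

definition DZB :: "(complex \<Rightarrow> complex fps) \<Rightarrow> complex \<Rightarrow> complex fps" where
  "DZB F z = Abs_fps (\<lambda>n. Dzb (\<lambda>z. fps_nth (F z) n) z)"

lemma DZ_nth [simp]: "fps_nth (DZ F z) n = Dz (\<lambda>z. fps_nth (F z) n) z"
  and DZB_nth [simp]: "fps_nth (DZB F z) n = Dzb (\<lambda>z. fps_nth (F z) n) z"
  by (simp_all add: DZ_def DZB_def)

lemma smf_nth: "smf F \<Longrightarrow> sm (\<lambda>z. fps_nth (F z) n)"
  by (simp add: smf_def)

lemma smf_const [sm_intros]: "smf (\<lambda>z. c)"
  by (simp add: smf_def sm_const)

lemma smf_fps_const [sm_intros]: "sm f \<Longrightarrow> smf (\<lambda>z. fps_const (f z))"
  unfolding smf_def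
proof
  fix n assume "sm f"
  then show "sm (\<lambda>z. fps_nth (fps_const (f z)) n)" by (cases "n = 0") (simp_all add: sm_const)
qed

lemma smf_add [sm_intros]: "smf F \<Longrightarrow> smf G \<Longrightarrow> smf (\<lambda>z. F z + G z)"
  and smf_diff [sm_intros]: "smf F \<Longrightarrow> smf G \<Longrightarrow> smf (\<lambda>z. F z - G z)"
  by (simp_all add: smf_def sm_intros)

lemma smf_minus [sm_intros]: "smf F \<Longrightarrow> smf (\<lambda>z. - F z)"
  by (simp add: smf_def sm_intros)

lemma smf_mult [sm_intros]: "smf F \<Longrightarrow> smf G \<Longrightarrow> smf (\<lambda>z. F z * G z)"
  by (simp add: smf_def fps_mult_nth sm_intros)

lemma smf_DZ [sm_intros]: "smf F \<Longrightarrow> smf (DZ F)"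
  and smf_DZB [sm_intros]: "smf F \<Longrightarrow> smf (DZB F)"
  by (simp_all add: smf_def sm_intros)

lemma
  assumes "z \<in> S"
  shows DZ_const: "DZ (\<lambda>z. c) z = 0" and DZB_const: "DZB (\<lambda>z. c) z = 0"
  by (rule fps_ext; simp add: assms wirtinger_simps)+

lemma
  assumes "z \<in> S"
  shows DZ_fps_const: "DZ (\<lambda>z. fps_const (f z)) z = fps_const (Dz f z)"
    and DZB_fps_const: "DZB (\<lambda>z. fps_const (f z)) z = fps_const (Dzb f z)"
  by (rule fps_ext, rename_tac n, case_tac "n = 0"; simp add: assms wirtinger_simps)+

lemma
  assumes "z \<in> S" "smf F" "smf G"
  shows DZ_add: "DZ (\<lambda>z. F z + G z) z = DZ F z + DZ G z" and DZB_add: "DZB (\<lambda>z. F z + G z) z = DZB F z + DZB G z"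
    and DZ_diff: "DZ (\<lambda>z. F z - G z) z = DZ F z - DZ G z" and DZB_diff: "DZB (\<lambda>z. F z - G z) z = DZB F z - DZB G z"
  using assms by (auto intro!: fps_ext simp: wirtinger_simps smf_def)

lemma
  assumes "z \<in> S" "smf F"
  shows DZ_minus: "DZ (\<lambda>z. - F z) z = - DZ F z" and DZB_minus: "DZB (\<lambda>z. - F z) z = - DZB F z"
  using assms by (auto intro!: fps_ext simp: wirtinger_simps smf_def)

lemma
  assumes "z \<in> S" "smf F" "smf G"
  shows DZ_mult: "DZ (\<lambda>z. F z * G z) z = DZ F z * G z + F z * DZ G z"
    and DZB_mult: "DZB (\<lambda>z. F z * G z) z = DZB F z * G z + F z * DZB G z"
  using assms
  by (auto intro!: fps_ext simp: wirtinger_simps smf_def fps_mult_nth dz_sum dzbar_sum sm_intros sum.distrib)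

lemma DZ_DZB_commute:
  assumes "z \<in> S" "smf F"
  shows "DZB (DZ F) z = DZ (DZB F) z"
  by (rule fps_ext) (simp add: dz_dzbar_commute[OF assms(1) smf_nth[OF assms(2)]])

lemmas DZ_simps = DZ_const DZB_const DZ_fps_const DZB_fps_const DZ_add DZB_add DZ_diff DZB_diff
  DZ_minus DZB_minus DZ_mult DZB_mult

end

subsection \<open>The formal Killing field\<close>

locale sinh_gordon_solution = wide_strip +
  fixes \<omega> :: "complex \<Rightarrow> real"
  assumes sm_omega: "smooth_within (strip T) \<omega>" and sinh_gordon: "sinh_gordon T \<omega>"
begin

definition w :: "complex \<Rightarrow> complex" where "w z = complex_of_real (\<omega> z)"
definition E :: "complex \<Rightarrow> complex" where "E z = complex_of_real (exp (\<omega> z))"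
definition E' :: "complex \<Rightarrow> complex" where "E' z = complex_of_real (exp (- \<omega> z))"
text \<open>\<open>sinh (2 \<omega>)\<close>, and below it \<open>cosh (2 \<omega>)\<close>, as
  polynomials in \<open>E\<close> and \<open>E'\<close>: later identities become polynomial ones
  modulo \<open>E z * E' z = 1\<close>.\<close>

definition Sh :: "complex \<Rightarrow> complex" where "Sh z = ((E z)^2 - (E' z)^2) / 2"
definition Ch :: "complex \<Rightarrow> complex" where "Ch z = ((E z)^2 + (E' z)^2) / 2"

abbreviation "cE z \<equiv> fps_const (E z)"
abbreviation "cE' z \<equiv> fps_const (E' z)"
abbreviation "cW z \<equiv> fps_const (Dz w z)"
abbreviation "i4 \<equiv> fps_const (\<i> / 4)"
abbreviation "i2 \<equiv> fps_const (\<i> / 2)"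

lemma sm_w [sm_intros]: "sm w" unfolding w_def[abs_def] by (intro sm_intros sm_omega)
lemma sm_E [sm_intros]: "sm E" unfolding E_def[abs_def] by (intro sm_intros sm_omega)
lemma sm_E' [sm_intros]: "sm E'" unfolding E'_def[abs_def] by (intro sm_intros sm_omega)
lemma sm_Sh [sm_intros]: "sm Sh" unfolding Sh_def[abs_def] power2_eq_square by (intro sm_intros)
lemma sm_Ch [sm_intros]: "sm Ch" unfolding Ch_def[abs_def] power2_eq_square by (intro sm_intros)

lemma E_inverse [simp]: "E z * E' z = 1" "E' z * E z = 1"
  by (simp_all add: E_def E'_def flip: of_real_mult exp_add)

lemma E_nonzero [simp]: "E z \<noteq> 0" "E' z \<noteq> 0"
  by (simp_all add: E_def E'_def)

lemma cnj_E [simp]: "cnj (E z) = E z" "cnj (E' z) = E' z" "cnj (Sh z) = Sh z" "cnj (Ch z) = Ch z"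
  by (simp_all add: E_def E'_def Sh_def Ch_def)

lemma Sh_eq: "Sh z = complex_of_real (sinh (2 * \<omega> z))"
  by (simp add: Sh_def E_def E'_def sinh_def power2_eq_square scaleR_conv_of_real flip: exp_add of_real_mult of_real_diff)

lemma Ch_eq: "Ch z = complex_of_real (cosh (2 * \<omega> z))"
  by (simp add: Ch_def E_def E'_def cosh_def power2_eq_square scaleR_conv_of_real flip: exp_add of_real_mult of_real_add)

lemma
  assumes "z \<in> S"
  shows Dz_E: "Dz E z = E z * Dz w z" and Dzb_E: "Dzb E z = E z * Dzb w z"
    and Dz_E': "Dz E' z = - E' z * Dz w z" and Dzb_E': "Dzb E' z = - E' z * Dzb w z"
  using dz_exp[OF assms sm_omega] dzbar_exp[OF assms sm_omega] dz_exp[OF assms sm_minus[OF sm_omega]]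
    dzbar_exp[OF assms sm_minus[OF sm_omega]] dz_minus[OF assms sm_w] dzbar_minus[OF assms sm_w]
  by (simp_all add: E_def[abs_def] E'_def[abs_def] w_def[abs_def])

lemma
  assumes "z \<in> S"
  shows Dz_Sh: "Dz Sh z = 2 * Ch z * Dz w z"
    and Dz_Ch: "Dz Ch z = 2 * Sh z * Dz w z"
  unfolding Sh_def[abs_def] Ch_def[abs_def] power2_eq_square
  by (simp_all add: wirtinger_simps assms sm_intros Dz_E Dzb_E Dz_E' Dzb_E' field_simps)

lemma cnj_Dz_w: "z \<in> S \<Longrightarrow> cnj (Dz w z) = Dzb w z"
  using dzbar_cnj[OF _ sm_w] by (simp add: w_def[abs_def])

lemma Dzb_Dz_w: "z \<in> S \<Longrightarrow> Dzb (Dz w) z = - Sh z / 8"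
  using sinh_gordon unfolding sinh_gordon_def Sh_eq w_def[abs_def] by (simp add: add_eq_0_iff)

text \<open>
  Writing the upper left, upper right and lower left entries of a formal field with \<open>\<gamma> = 1\<close> as
  \<open>lam s\<close>, \<open>exp \<omega> (p + lam q) / 2\<close> and \<open>lam exp (- \<omega>) (p - lam q) / 2\<close>, the determinant is normalized
  to \<open>- lam\<close>. This fixes \<open>p\<close> without any integration; \<open>s\<close> and \<open>q\<close> are read off
  the \<open>dz\<close>-part of the Killing equation.
\<close>

function pcoeff scoeff qcoeff :: "nat \<Rightarrow> complex \<Rightarrow> complex" where
  "pcoeff n = (if n = 0 then (\<lambda>z. 2) else (\<lambda>z.
      - (\<Sum>i\<in>{1..<n}. pcoeff i z * pcoeff (n - i) z) / 4
      - (\<Sum>i=0..n - 1. scoeff i z * scoeff (n - 1 - i) z)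
      + (if n = 1 then 0 else (\<Sum>i=0..n - 2. qcoeff i z * qcoeff (n - 2 - i) z) / 4)))"
| "scoeff n = (\<lambda>z. - \<i> * ((if n = 0 then 0 else Dz (qcoeff (n - 1)) z) + 2 * Dz w z * pcoeff n z))"
| "qcoeff n = (\<lambda>z. - 4 * \<i> * Dz (scoeff n) z)"
  by pat_completeness auto
text \<open>Within each order the coefficients are computed as \<open>p\<close>, \<open>s\<close>,
  \<open>q\<close>; the recursion for \<open>p\<close> looks only at lower orders.\<close>

termination
  by (relation "Wellfounded.measure (\<lambda>x. case x of Inl n \<Rightarrow> 3 * n | Inr (Inl n) \<Rightarrow> 3 * n + 1 | Inr (Inr n) \<Rightarrow> 3 * n + 2)") auto

declare pcoeff.simps [simp del] scoeff.simps [simp del] qcoeff.simps [simp del]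

lemma sm_coeffs: "sm (pcoeff n) \<and> sm (scoeff n) \<and> sm (qcoeff n)"
proof (induction n rule: less_induct)
  case (less n)
  have p: "sm (pcoeff n)"
  proof (cases "n = 0")
    case True
    then show ?thesis by (simp add: pcoeff.simps sm_const)
  next
    case False
    have "sm (\<lambda>z. if n = 1 then 0 else (\<Sum>i=0..n - 2. qcoeff i z * qcoeff (n - 2 - i) z) / 4)"
      using False by (cases "n = 1") (auto intro!: sm_intros simp: less)
    then show ?thesis
      unfolding pcoeff.simps[of n] if_not_P[OF False] using False
      by (intro sm_intros) (auto simp: less)
  qed
  have "sm (\<lambda>z. if n = 0 then 0 else Dz (qcoeff (n - 1)) z)"
    by (cases "n = 0") (auto intro!: sm_intros simp: less)
  then have s: "sm (scoeff n)"
    unfolding scoeff.simps[of n] by (intro sm_intros p)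
  then have "sm (qcoeff n)" unfolding qcoeff.simps[of n] by (intro sm_intros)
  with p s show ?case by blast
qed

definition P :: "complex \<Rightarrow> complex fps" where "P z = Abs_fps (\<lambda>n. pcoeff n z)"
definition R :: "complex \<Rightarrow> complex fps" where "R z = Abs_fps (\<lambda>n. scoeff n z)"
definition Q :: "complex \<Rightarrow> complex fps" where "Q z = Abs_fps (\<lambda>n. qcoeff n z)"

lemma P_nth: "fps_nth (P z) n = pcoeff n z" and R_nth: "fps_nth (R z) n = scoeff n z"
  and Q_nth: "fps_nth (Q z) n = qcoeff n z"
  by (simp_all add: P_def R_def Q_def)

lemma smf_PRQ [sm_intros]: "smf P" "smf R" "smf Q"
  using sm_coeffs by (simp_all add: smf_def P_nth R_nth Q_nth)

lemma P_0: "fps_nth (P z) 0 = 2" by (simp add: P_nth pcoeff.simps)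

lemma DZ_R: "DZ R z = i4 * Q z"
  by (rule fps_ext) (simp add: R_nth Q_nth qcoeff.simps)

text \<open>The recursion for \<open>s\<close> in generating form; \<open>fps_X\<close> accounts for
  the shift from \<open>n - 1\<close> to \<open>n\<close>.\<close>

lemma DZ_Q: "fps_X * DZ Q z = fps_const \<i> * R z - fps_const (2 * Dz w z) * P z"
proof (rule fps_ext)
  fix n
  show "fps_nth (fps_X * DZ Q z) n = fps_nth (fps_const \<i> * R z - fps_const (2 * Dz w z) * P z) n"
    by (cases n) (simp_all add: R_nth P_nth Q_nth scoeff.simps[of "Suc _"] scoeff.simps[of 0] algebra_simps)
qed

text \<open>Order \<open>n\<close> contains \<open>4 * pcoeff n\<close>, because \<open>p\<close>
  starts with 2; solved for that term it is the recursion defining \<open>p\<close>.\<close>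

lemma det_PRQ: "4 * (fps_X * (R z * R z)) + P z * P z - fps_X * (fps_X * (Q z * Q z)) = 4"
proof (rule fps_ext)
  fix n
  show "fps_nth (4 * (fps_X * (R z * R z)) + P z * P z - fps_X * (fps_X * (Q z * Q z))) n = fps_nth 4 n"
  proof (cases "n = 0")
    case True
    then show ?thesis by (simp add: P_0 fps_numeral_nth_0)
  next
    case False
    have "fps_nth (P z * P z) n = 4 * pcoeff n z + (\<Sum>i\<in>{1..<n}. pcoeff i z * pcoeff (n - i) z)"
    proof -
      have "{0..n} = insert 0 (insert n {1..<n})" using False by auto
      then show ?thesis using False by (simp add: fps_mult_nth P_nth pcoeff.simps[of 0])
    qed
    moreover have "4 * pcoeff n z = - (\<Sum>i\<in>{1..<n}. pcoeff i z * pcoeff (n - i) z)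
      - 4 * (\<Sum>i=0..n - 1. scoeff i z * scoeff (n - 1 - i) z)
      + (if n = 1 then 0 else (\<Sum>i=0..n - 2. qcoeff i z * qcoeff (n - 2 - i) z))"
      using False by (subst pcoeff.simps) (simp add: field_simps)
    moreover have "fps_nth (4 * (fps_X * (R z * R z))) n = 4 * (\<Sum>i=0..n - 1. scoeff i z * scoeff (n - 1 - i) z)"
      using False by (simp add: fps_mult_nth[of "R z"] R_nth numeral_fps_const)
    moreover have "fps_nth (fps_X * (fps_X * (Q z * Q z))) n
        = (if n = 1 then 0 else (\<Sum>i=0..n - 2. qcoeff i z * qcoeff (n - 2 - i) z))"
      using False by (auto simp: fps_mult_nth[of "Q z"] Q_nth numeral_2_eq_2)
    ultimately show ?thesis using False by (simp add: numeral_fps_const)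
  qed
qed

lemma
  assumes z: "z \<in> S"
  shows DZ_det: "8 * (fps_X * (R z * DZ R z)) + 2 * (P z * DZ P z) - 2 * (fps_X * (fps_X * (Q z * DZ Q z))) = 0" (is ?G1)
    and DZB_det: "8 * (fps_X * (R z * DZB R z)) + 2 * (P z * DZB P z) - 2 * (fps_X * (fps_X * (Q z * DZB Q z))) = 0" (is ?G2)
proof -
  have *: "(\<lambda>z. 4 * (fps_X * (R z * R z)) + P z * P z - fps_X * (fps_X * (Q z * Q z))) = (\<lambda>z. 4)"
    using det_PRQ by simp
  have "DZ (\<lambda>z. 4 * (fps_X * (R z * R z)) + P z * P z - fps_X * (fps_X * (Q z * Q z))) z = 0"
    "DZB (\<lambda>z. 4 * (fps_X * (R z * R z)) + P z * P z - fps_X * (fps_X * (Q z * Q z))) z = 0"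
    unfolding * by (simp_all add: z DZ_simps)
  then show ?G1
    ?G2
    by (simp_all add: z DZ_simps sm_intros algebra_simps)
qed

lemma P_nonzero: "P z \<noteq> 0"
  using P_0[of z] by auto

text \<open>This \<open>dz\<close>-equation is not built into the recursion. It follows from the
  differentiated determinant relation, in which \<open>2 * P z\<close> factors out and can be
  cancelled.\<close>

lemma DZ_P:
  assumes z: "z \<in> S"
  shows "DZ P z = - fps_const (2 * Dz w z) * (fps_X * Q z)"
proof -
  have i: "fps_const \<i> * fps_const \<i> = (-1 :: complex fps)"
    by (simp flip: fps_const_neg fps_const_1_eq_1)
  have i4: "fps_const \<i> = 4 * i4" by (simp add: numeral_fps_const)
  have "2 * P z * (DZ P z + fps_const (2 * Dz w z) * (fps_X * Q z)) = 0"
    using DZ_det[OF z] DZ_R[of z] DZ_Q[of z] i4 by algebra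
  then have "DZ P z + fps_const (2 * Dz w z) * (fps_X * Q z) = 0" using P_nonzero[of z] by simp
  then show ?thesis unfolding minus_mult_left[symmetric] by (simp only: eq_neg_iff_add_eq_0)
qed

text \<open>
  The defects of the three \<open>d zbar\<close>-equations vanish order by order: the determinant relation kills the
  defect of \<open>P\<close>, then the \<open>dz\<close>-equations, differentiated, kill those of \<open>R\<close> and \<open>Q\<close>.
\<close>

definition defect_R where
  "defect_R z = DZB R z - i4 * (fps_const (Sh z) * P z + fps_X * (fps_const (Ch z) * Q z))"

definition defect_P where
  "defect_P z = DZB P z + fps_const \<i> * (fps_X * (fps_const (Sh z) * R z))"

definition defect_Q where
  "defect_Q z = DZB Q z - fps_const \<i> * (fps_const (Ch z) * R z)"

lemma fps_const_ii: "fps_const \<i> * fps_const \<i> = (-1 :: complex fps)"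
  by (simp flip: fps_const_neg fps_const_1_eq_1)

lemma fps_const_i4: "fps_const \<i> = (4 :: complex fps) * i4"
  by (simp add: numeral_fps_const)

lemma defect_det:
  assumes "z \<in> S"
  shows "8 * (fps_X * (R z * defect_R z)) + 2 * (P z * defect_P z) - 2 * (fps_X * (fps_X * (Q z * defect_Q z))) = 0"
  using DZB_det[OF assms] fps_const_i4 unfolding defect_R_def defect_P_def defect_Q_def by algebra

text \<open>The \<open>d zbar\<close>-derivative of the \<open>dz\<close>-equation for
  \<open>Q\<close>. The sinh-Gordon equation enters here, through \<open>Dzb (Dz w)\<close>.\<close>

lemma DZ_defect_Q:
  assumes z: "z \<in> S"
  shows "fps_X * DZ defect_Q z = fps_const \<i> * defect_R z - 2 * cW z * defect_P z"
proof -
  have "fps_X * DZ (DZB Q) z = DZB (\<lambda>z. fps_X * DZ Q z) z"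
    by (simp add: z DZ_simps sm_intros DZ_DZB_commute)
  also have "\<dots> = fps_const \<i> * DZB R z - (fps_const (2 * Dzb (Dz w) z) * P z + fps_const (2 * Dz w z) * DZB P z)"
    unfolding DZ_Q by (simp add: z DZ_simps wirtinger_simps sm_intros)
  finally have 1: "fps_X * DZ (DZB Q) z = fps_const \<i> * DZB R z
      + fps_const (1/4) * fps_const (Sh z) * P z - 2 * cW z * DZB P z"
    by (simp add: Dzb_Dz_w[OF z] numeral_fps_const algebra_simps flip: fps_const_neg)
  have 2: "DZ defect_Q z = DZ (DZB Q) z
      - fps_const \<i> * (2 * fps_const (Sh z) * cW z * R z + fps_const (Ch z) * DZ R z)"
    unfolding defect_Q_def[abs_def]
    by (simp add: z DZ_simps sm_intros Dz_Ch numeral_fps_const algebra_simps)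
  have 3: "(1 :: complex fps) = 4 * fps_const (1 / 4)" by (simp add: numeral_fps_const)
  show ?thesis
    unfolding 2 defect_R_def defect_P_def DZ_R
    using 1 3 fps_const_i4 fps_const_ii by algebra
qed

lemma DZ_defect_R:
  assumes z: "z \<in> S"
  shows "DZ defect_R z = i4 * defect_Q z"
proof -
  have "DZ (DZB R) z = DZB (DZ R) z" by (simp add: z DZ_DZB_commute sm_intros)
  also have "\<dots> = i4 * DZB Q z"
    unfolding DZ_R[abs_def] by (simp add: z DZ_simps sm_intros)
  finally have 1: "DZ (DZB R) z = i4 * DZB Q z" .
  have 2: "DZ defect_R z = DZ (DZB R) z - i4 *
      (2 * fps_const (Ch z) * cW z * P z + fps_const (Sh z) * DZ P z
       + fps_X * (2 * fps_const (Sh z) * cW z * Q z + fps_const (Ch z) * DZ Q z))"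
    unfolding defect_R_def[abs_def]
    by (simp add: z DZ_simps sm_intros Dz_Ch Dz_Sh numeral_fps_const algebra_simps)
  have 3: "DZ P z = - 2 * cW z * (fps_X * Q z)"
    by (simp add: DZ_P[OF z] numeral_fps_const flip: fps_const_neg)
  have 4: "fps_X * DZ Q z = fps_const \<i> * R z - 2 * cW z * P z"
    by (simp add: DZ_Q numeral_fps_const)
  show ?thesis
    unfolding 2 defect_Q_def 1 3 using 4 by algebra
qed

lemma fps_mult_nth_lowest:
  assumes "\<And>m. m < n \<Longrightarrow> fps_nth G m = 0"
  shows "fps_nth (F * G) n = fps_nth F 0 * fps_nth (G :: 'b::comm_ring_1 fps) n"
proof -
  have "fps_nth (F * G) n = (\<Sum>i=0..n. fps_nth F i * fps_nth G (n - i))" by (rule fps_mult_nth)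
  also have "\<dots> = fps_nth F 0 * fps_nth G n + (\<Sum>i\<in>{0<..n}. fps_nth F i * fps_nth G (n - i))"
    by (simp add: sum.head)
  also have "(\<Sum>i\<in>{0<..n}. fps_nth F i * fps_nth G (n - i)) = 0"
    by (rule sum.neutral) (auto simp: assms)
  finally show ?thesis by simp
qed

lemma dz_zero:
  assumes "\<And>z. z \<in> S \<Longrightarrow> f z = 0" "z \<in> S"
  shows "Dz f z = 0"
  using dz_within_cong[of f "\<lambda>_. 0", OF assms] assms(2) by (simp add: dz_const)

lemma defects_vanish:
  "z \<in> S \<Longrightarrow> fps_nth (defect_P z) n = 0 \<and> fps_nth (defect_R z) n = 0 \<and> fps_nth (defect_Q z) n = 0"
\<comment> \<open>All points of the strip are treated together, because the defects of
  \<open>R\<close> and \<open>Q\<close> are reached by differentiating defects that are already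
  known to vanish.\<close>
proof (induction n arbitrary: z rule: less_induct)
  case (less n)
  have P: "fps_nth (defect_P z) n = 0" if z: "z \<in> S" for z
  proof -
    \<comment> \<open>The factors \<open>fps_X\<close> leave only lower, already treated orders of
      the defects of \<open>R\<close> and \<open>Q\<close>; at order \<open>n\<close> just
      \<open>2 * (P z * defect_P z)\<close> contributes.\<close>
    have "fps_nth (8 * (fps_X * (R z * defect_R z)) + 2 * (P z * defect_P z)
        - 2 * (fps_X * (fps_X * (Q z * defect_Q z)))) n = 0"
      unfolding defect_det[OF z] by simp
    moreover have "fps_nth (fps_X * (R z * defect_R z)) n = 0"
      by (simp; subst fps_mult_nth_lowest; simp add: less z)
    moreover have "fps_nth (fps_X * (fps_X * (Q z * defect_Q z))) n = 0"
      by (simp; subst fps_mult_nth_lowest; simp add: less z)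
    moreover have "fps_nth (P z * defect_P z) n = 2 * fps_nth (defect_P z) n"
      by (subst fps_mult_nth_lowest) (simp_all add: less z P_0)
    ultimately show ?thesis by (simp add: numeral_fps_const)
  qed
  have R: "fps_nth (defect_R z) n = 0" if z: "z \<in> S" for z
  proof -
    \<comment> \<open>Because of \<open>fps_X\<close>, order \<open>n\<close> involves
      \<open>defect_Q\<close> at order \<open>n - 1\<close> only.\<close>
    have "fps_nth (fps_X * DZ defect_Q z) n = 0"
      by (simp; intro impI dz_zero) (simp_all add: less z)
    then show ?thesis unfolding DZ_defect_Q[OF z] by (simp add: P[OF z] numeral_fps_const mult.assoc)
  qed
  have "fps_nth (defect_Q z) n = 0" if z: "z \<in> S" for z
  proof -
    have "fps_nth (DZ defect_R z) n = 0" using dz_zero[OF R] z by simp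
    then show ?thesis unfolding DZ_defect_R[OF z] by simp
  qed
  then show ?case using P R less.prems by blast
qed

lemma
  assumes "z \<in> S"
  shows DZB_R: "DZB R z = i4 * (fps_const (Sh z) * P z + fps_X * (fps_const (Ch z) * Q z))" (is ?G1)
    and DZB_P: "DZB P z = - fps_const \<i> * (fps_X * (fps_const (Sh z) * R z))" (is ?G2)
    and DZB_Q: "DZB Q z = fps_const \<i> * (fps_const (Ch z) * R z)" (is ?G3)
proof -
  have "defect_R z = 0" "defect_P z = 0" "defect_Q z = 0"
    by (rule fps_ext; simp add: defects_vanish[OF assms])+
  then show ?G1
    ?G2
    ?G3
    unfolding defect_R_def defect_P_def defect_Q_def by algebra+
qed

text \<open>The off-diagonal entries of the formal field are \<open>exp \<omega>\<close> times
  \<open>Bet\<close> and \<open>lam * exp (- \<omega>)\<close> times \<open>Kap\<close>; both series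
  start with 1.\<close>

definition Bet :: "complex \<Rightarrow> complex fps" where "Bet z = fps_const (1 / 2) * (P z + fps_X * Q z)"
definition Kap :: "complex \<Rightarrow> complex fps" where "Kap z = fps_const (1 / 2) * (P z - fps_X * Q z)"

lemma smf_Bet_Kap [sm_intros]: "smf Bet" "smf Kap"
  unfolding Bet_def[abs_def] Kap_def[abs_def] by (intro sm_intros)+

lemma Bet_Kap_0: "fps_nth (Bet z) 0 = 1" "fps_nth (Kap z) 0 = 1"
  by (simp_all add: Bet_def Kap_def P_0)

lemma fps_const_half: "(2 :: complex fps) * fps_const (1 / 2) = 1"
  by (simp add: numeral_fps_const)

lemma fps_const_i2: "i2 = (2 :: complex fps) * i4"
  by (simp add: numeral_fps_const)

lemma det_Bet_Kap: "fps_X * (R z * R z) + Bet z * Kap z = 1"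
proof -
  define h :: "complex fps" where "h = fps_const (1 / 2)"
  have h: "h * h * 4 = 1" by (simp add: h_def numeral_fps_const)
  have "fps_X * (R z * R z) + Bet z * Kap z = (h * h * 4) * (fps_X * (R z * R z)) + Bet z * Kap z"
    by (simp add: h)
  also have "\<dots> = h * h * (4 * (fps_X * (R z * R z)) + P z * P z - fps_X * (fps_X * (Q z * Q z)))"
    unfolding Bet_def Kap_def h_def[symmetric] by (simp add: algebra_simps)
  also have "\<dots> = 1" by (simp only: det_PRQ h)
  finally show ?thesis .
qed

lemma X_DZ_R: "fps_X * DZ R z = i4 * (Bet z - Kap z)"
  using fps_const_half unfolding Bet_def Kap_def DZ_R by algebra

lemma
  assumes z: "z \<in> S"
  shows DZ_Bet: "DZ Bet z = i2 * R z - 2 * cW z * Bet z" (is ?G1)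
    and DZ_Kap: "DZ Kap z = 2 * cW z * Kap z - i2 * R z" (is ?G2)
proof -
  have 1: "DZ Bet z = fps_const (1 / 2) * (DZ P z + fps_X * DZ Q z)"
    "DZ Kap z = fps_const (1 / 2) * (DZ P z - fps_X * DZ Q z)"
    unfolding Bet_def[abs_def] Kap_def[abs_def] by (simp_all add: z DZ_simps sm_intros)
  have 3: "DZ P z = - 2 * cW z * (fps_X * Q z)"
    by (simp add: DZ_P[OF z] numeral_fps_const flip: fps_const_neg)
  have 4: "fps_X * DZ Q z = fps_const \<i> * R z - 2 * cW z * P z"
    by (simp add: DZ_Q numeral_fps_const)
  show ?G1
    ?G2
    unfolding 1 3 4 Bet_def Kap_def using fps_const_i2 fps_const_i4 fps_const_half by algebra+
qed

lemma fps_const_E2: "cE z * cE z = fps_const (Ch z) + fps_const (Sh z)"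
    "cE' z * cE' z = fps_const (Ch z) - fps_const (Sh z)"
  by (simp_all add: Ch_def Sh_def power2_eq_square field_simps)

lemma
  assumes z: "z \<in> S"
  shows DZB_R': "DZB R z = i4 * (cE z * cE z * Bet z - cE' z * cE' z * Kap z)" (is ?G1)
    and DZB_Bet: "DZB Bet z = i2 * (fps_X * (cE' z * cE' z * R z))" (is ?G2)
    and DZB_Kap: "DZB Kap z = - i2 * (fps_X * (cE z * cE z * R z))" (is ?G3)
proof -
  have 1: "DZB Bet z = fps_const (1 / 2) * (DZB P z + fps_X * DZB Q z)"
    "DZB Kap z = fps_const (1 / 2) * (DZB P z - fps_X * DZB Q z)"
    unfolding Bet_def[abs_def] Kap_def[abs_def] by (simp_all add: z DZ_simps sm_intros)
  show ?G1
    ?G2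
    ?G3
    unfolding 1 DZB_R[OF z] DZB_P[OF z] DZB_Q[OF z] fps_const_E2 Bet_def Kap_def
    using fps_const_i2 fps_const_i4 fps_const_half by algebra+
qed

text \<open>The linearised sinh-Gordon equation: the coefficients of \<open>R\<close> are Jacobi
  fields of the solution.\<close>

lemma DZ_DZB_R:
  assumes z: "z \<in> S"
  shows "DZ (DZB R) z = - fps_const (1 / 4) * (fps_const (Ch z) * R z)"
proof -
  have "DZ (DZB R) z = DZB (DZ R) z" by (simp add: z DZ_DZB_commute sm_intros)
  also have "\<dots> = i4 * DZB Q z"
    unfolding DZ_R[abs_def] by (simp add: z DZ_simps sm_intros)
  also have "\<dots> = (i4 * fps_const \<i>) * (fps_const (Ch z) * R z)"
    by (simp only: DZB_Q[OF z] mult.assoc)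
  finally show ?thesis by (simp flip: fps_const_neg)
qed

lemma coeffs_periodic:
  assumes L: "\<And>z. z \<in> S \<Longrightarrow> \<omega> (z + of_real L) = \<omega> z"
  shows "\<forall>z\<in>S. pcoeff n (z + of_real L) = pcoeff n z \<and> scoeff n (z + of_real L) = scoeff n z
    \<and> qcoeff n (z + of_real L) = qcoeff n z"
proof (induction n rule: less_induct)
  case (less n)
  have w: "Dz w (z + of_real L) = Dz w z" if "z \<in> S" for z
    using that L by (intro dz_periodic sm_w) (simp_all add: w_def)
  have p: "pcoeff n (z + of_real L) = pcoeff n z" if "z \<in> S" for z
    unfolding pcoeff.simps[of n] using less that by (auto intro!: sum.cong arg_cong2[where f = "(-)"] arg_cong2[where f = "(+)"])
  have s: "scoeff n (z + of_real L) = scoeff n z" if "z \<in> S" for z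
    unfolding scoeff.simps[of n] using p that w less dz_periodic[of "qcoeff (n - 1)" L] sm_coeffs
    by (cases "n = 0") auto
  have "qcoeff n (z + of_real L) = qcoeff n z" if "z \<in> S" for z
    unfolding qcoeff.simps[of n] using that s dz_periodic[of "scoeff n" L] sm_coeffs by auto
  with p s show ?case by blast
qed

end

subsection \<open>The Sklyanin condition of the formal Killing field\<close>

text \<open>Formally \<open>cnj (F (cnj lam))\<close>: this matches the conjugated parameters in the
  Sklyanin condition.\<close>

definition fps_cnj :: "complex fps \<Rightarrow> complex fps" where
  "fps_cnj F = Abs_fps (\<lambda>n. cnj (fps_nth F n))"

lemma fps_cnj_nth [simp]: "fps_nth (fps_cnj F) n = cnj (fps_nth F n)"
  by (simp add: fps_cnj_def)

lemma fps_cnj_add: "fps_cnj (F + G) = fps_cnj F + fps_cnj G"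
  and fps_cnj_diff: "fps_cnj (F - G) = fps_cnj F - fps_cnj G"
  and fps_cnj_minus: "fps_cnj (- F) = - fps_cnj F"
  and fps_cnj_mult: "fps_cnj (F * G) = fps_cnj F * fps_cnj G"
  and fps_cnj_const: "fps_cnj (fps_const c) = fps_const (cnj c)"
  and fps_cnj_X: "fps_cnj fps_X = fps_X"
  and fps_cnj_1: "fps_cnj 1 = 1"
  by (rule fps_ext; simp add: fps_mult_nth fps_X_def)+

lemma fps_cnj_numeral: "fps_cnj (numeral m) = numeral m"
  by (simp add: numeral_fps_const fps_cnj_const)

lemmas fps_cnj_simps = fps_cnj_add fps_cnj_diff fps_cnj_minus fps_cnj_mult fps_cnj_const fps_cnj_X fps_cnj_1
  fps_cnj_numeral

lemma fps_mult_nth_below: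
  assumes "\<And>m. m < n \<Longrightarrow> fps_nth G m = 0" "k < n"
  shows "fps_nth (F * G) k = (0 :: 'b::comm_ring_1)"
  using assms by (auto simp: fps_mult_nth intro!: sum.neutral)

lemma fps_factor_nth_below:
  assumes "\<And>m. m < n \<Longrightarrow> fps_nth (F * G) m = 0" "fps_nth F 0 \<noteq> 0" "k < n"
  shows "fps_nth G k = (0 :: 'b::idom)"
  using assms(3)
proof (induction k rule: less_induct)
  case (less k)
  have "fps_nth (F * G) k = fps_nth F 0 * fps_nth G k"
  proof -
    have "fps_nth (F * G) k = (\<Sum>i=0..k. fps_nth F i * fps_nth G (k - i))" by (rule fps_mult_nth)
    also have "\<dots> = fps_nth F 0 * fps_nth G k + (\<Sum>i\<in>{0<..k}. fps_nth F i * fps_nth G (k - i))"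
      by (simp add: sum.head)
    also have "(\<Sum>i\<in>{0<..k}. fps_nth F i * fps_nth G (k - i)) = 0"
      using less by (intro sum.neutral) auto
    finally show ?thesis by simp
  qed
  then show ?case using assms(1)[OF less.prems] assms(2) by simp
qed

section \<open>Derivatives of series along a horizontal line\<close>

context wide_strip
begin

lemma smf_fps_cnj [sm_intros]: "smf F \<Longrightarrow> smf (\<lambda>z. fps_cnj (F z))"
  by (simp add: smf_def sm_intros)

lemma
  assumes "z \<in> S" "smf F"
  shows DZ_fps_cnj: "DZ (\<lambda>z. fps_cnj (F z)) z = fps_cnj (DZB F z)"
    and DZB_fps_cnj: "DZB (\<lambda>z. fps_cnj (F z)) z = fps_cnj (DZ F z)"
  using assms by (auto intro!: fps_ext simp: dz_cnj dzbar_cnj smf_def)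

definition DX :: "(complex \<Rightarrow> complex fps) \<Rightarrow> complex \<Rightarrow> complex fps" where
  "DX F z = DZ F z + DZB F z"

lemma DX_nth: "z \<in> S \<Longrightarrow> fps_nth (DX F z) n = Dx (\<lambda>z. fps_nth (F z) n) z"
  by (simp add: DX_def dx_eq_dz_dzbar)

lemma DX_const: "z \<in> S \<Longrightarrow> DX (\<lambda>z. c) z = 0"
  by (simp add: DX_def DZ_simps)

lemma DX_add: "z \<in> S \<Longrightarrow> smf F \<Longrightarrow> smf G \<Longrightarrow> DX (\<lambda>z. F z + G z) z = DX F z + DX G z"
  and DX_diff: "z \<in> S \<Longrightarrow> smf F \<Longrightarrow> smf G \<Longrightarrow> DX (\<lambda>z. F z - G z) z = DX F z - DX G z"
  and DX_mult: "z \<in> S \<Longrightarrow> smf F \<Longrightarrow> smf G \<Longrightarrow> DX (\<lambda>z. F z * G z) z = DX F z * G z + F z * DX G z"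
  and DX_minus: "z \<in> S \<Longrightarrow> smf F \<Longrightarrow> DX (\<lambda>z. - F z) z = - DX F z"
  by (simp_all add: DX_def DZ_simps algebra_simps)

lemma DX_fps_cnj: "z \<in> S \<Longrightarrow> smf F \<Longrightarrow> DX (\<lambda>z. fps_cnj (F z)) z = fps_cnj (DX F z)"
  by (simp add: DX_def DZ_fps_cnj DZB_fps_cnj fps_cnj_add add.commute)

lemma dx_within_zero_on_line:
  fixes f :: "complex \<Rightarrow> 'a::real_normed_vector"
  assumes "sm f" "h \<in> {-T..T}" "\<And>z. Im z = h \<Longrightarrow> f z = 0" "Im z = h"
  shows "Dx f z = 0"
proof -
  have "((\<lambda>x. f (Complex x h)) has_vector_derivative Dx f (Complex (Re z) h)) (at (Re z))"
    by (rule vderiv_x[OF assms(1,2)])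
  moreover have "(\<lambda>x. f (Complex x h)) = (\<lambda>x. 0)" using assms(3) by auto
  ultimately have "((\<lambda>x. 0) has_vector_derivative Dx f (Complex (Re z) h)) (at (Re z))" by simp
  then have "Dx f (Complex (Re z) h) = 0"
    using has_vector_derivative_const vector_derivative_unique_at by blast
  then show ?thesis using assms(4) by (metis complex.collapse)
qed

end

locale durham_line = sinh_gordon_solution +
  fixes h A B :: real
  assumes h: "h \<in> {-T..T}" and durham: "durham_on_line T h A B \<omega>"
begin

lemma line_in_S: "Im z = h \<Longrightarrow> z \<in> S"
  using h by (auto simp: strip_def)

lemma durham_wirtinger:
  assumes z: "Im z = h"
  shows "Dz w z - Dzb w z = - \<i> * (of_real A * E z + of_real B * E' z)"
proof -
  have "Dy w z = of_real (Dy \<omega> z)"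
    unfolding w_def[abs_def] by (rule dy_within_linear[OF bounded_linear_of_real sm_omega line_in_S[OF z]])
  also have "\<dots> = of_real A * E z + of_real B * E' z"
    using durham z by (simp add: durham_on_line_def E_def E'_def)
  finally have "\<i> * (Dz w z - Dzb w z) = of_real A * E z + of_real B * E' z"
    using dy_eq_dz_dzbar[OF line_in_S[OF z]] by simp
  then show ?thesis by (metis complex_i_mult_minus minus_mult_left minus_minus)
qed

text \<open>The dictionary at \<open>\<gamma> = 1\<close>: the Lax form on the x-direction has
  diagonal entry \<open>g / 2\<close> and off-diagonal entries \<open>U / lam\<close> and
  \<open>V\<close>; \<open>K\<close> has the entries \<open>c\<close> and \<open>d / lam\<close> on
  the diagonal and \<open>- k / lam\<close> off it; the off-diagonal entries of the formal field are
  \<open>eB\<close> and \<open>lam * eK\<close>.\<close>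

definition eB :: "complex \<Rightarrow> complex fps" where "eB z = cE z * Bet z"
definition eK :: "complex \<Rightarrow> complex fps" where "eK z = cE' z * Kap z"
definition U :: "complex \<Rightarrow> complex fps" where "U z = i4 * (cE z + fps_X * cE' z)"
definition V :: "complex \<Rightarrow> complex fps" where "V z = i4 * (cE' z + fps_X * cE z)"
definition g :: "complex \<Rightarrow> complex fps" where "g z = fps_const (Dz w z - Dzb w z)"
definition c :: "complex fps" where "c = 4 * (fps_const (of_real A) - fps_const (of_real B) * fps_X)"
definition d :: "complex fps" where "d = 4 * (fps_const (of_real A) * fps_X - fps_const (of_real B))"
definition k :: "complex fps" where "k = 1 - fps_X * fps_X"

lemma smf_eBK [sm_intros]: "smf eB" "smf eK"
  unfolding eB_def[abs_def] eK_def[abs_def] by (intro sm_intros)+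

lemma fps_const_E_inverse: "cE z * cE' z = 1" by simp

lemma det_eBK: "fps_X * (R z * R z) + eB z * eK z = 1"
  using det_Bet_Kap[of z] fps_const_E_inverse[of z] unfolding eB_def eK_def by algebra

lemma
  assumes z: "z \<in> S"
  shows DX_eB: "DX eB z = - g z * eB z + 2 * U z * R z" (is ?G1)
    and DX_eK: "DX eK z = g z * eK z - 2 * V z * R z" (is ?G2)
    and X_DX_R: "fps_X * DX R z = V z * eB z - U z * eK z" (is ?G3)
    and X_DY_R: "fps_X * (DZ R z - DZB R z) = i4 * ((cE' z - fps_X * cE z) * eB z
      - (cE z - fps_X * cE' z) * eK z)" (is ?G4)
proof -
  have 1: "DX eB z = cE z * (cW z + fps_const (Dzb w z)) * Bet z + cE z * (DZ Bet z + DZB Bet z)"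
    "DX eK z = - cE' z * (cW z + fps_const (Dzb w z)) * Kap z + cE' z * (DZ Kap z + DZB Kap z)"
    unfolding eB_def[abs_def] eK_def[abs_def] DX_def
    by (simp_all add: z DZ_simps sm_intros Dz_E Dz_E' Dzb_E Dzb_E' algebra_simps
        flip: fps_const_neg fps_const_add fps_const_mult)
  have g: "g z = cW z - fps_const (Dzb w z)" by (simp add: g_def)
  show ?G1 ?G2
    unfolding 1 DZ_Bet[OF z] DZB_Bet[OF z] DZ_Kap[OF z] DZB_Kap[OF z] g eB_def eK_def U_def V_def fps_const_i2
    using fps_const_E_inverse[of z] by algebra+
  show ?G3
    ?G4
    unfolding DX_def eB_def eK_def U_def V_def DZB_R'[OF z] using X_DZ_R[of z] fps_const_E_inverse[of z] by algebra+
qed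

lemma
  assumes "z \<in> S"
  shows fps_cnj_U: "fps_cnj (U z) = - U z" and fps_cnj_V: "fps_cnj (V z) = - V z" and fps_cnj_g: "fps_cnj (g z) = - g z"
    and fps_cnj_i4: "fps_cnj (i4) = - i4"
  using cnj_Dz_w[OF assms] cnj_Dz_w[OF assms, symmetric]
  by (simp_all add: U_def V_def g_def fps_cnj_simps flip: fps_const_neg)

text \<open>The Durham condition enters here: it says that the multiplier \<open>m\<close> in
  \<open>K \<alpha> + \<alpha>\<^sup>* K = m J\<close> vanishes along the line.\<close>

lemma k_g: "Im z = h \<Longrightarrow> k * g z = d * V z - c * U z"
proof -
  assume z: "Im z = h"
  have "g z = - 4 * i4 * (fps_const (of_real A) * cE z + fps_const (of_real B) * cE' z)"
    unfolding g_def durham_wirtinger[OF z] by (simp add: numeral_fps_const algebra_simps flip: fps_const_neg)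
  then show "k * g z = d * V z - c * U z" unfolding k_def d_def V_def c_def U_def by algebra
qed

abbreviation "R' z \<equiv> fps_cnj (R z)"
abbreviation "eB' z \<equiv> fps_cnj (eB z)"
abbreviation "eK' z \<equiv> fps_cnj (eK z)"

text \<open>
  Up to the factor \<open>- lam\<close> of \<open>K\<close> and further powers of \<open>lam\<close>, these are the entries (1,1), (2,2), (1,2), (2,1)
  of \<open>K \<Phi> - \<Phi>\<^sup>* K\<close> for \<open>\<gamma> = 1\<close>. They satisfy a linear system along the line, and a quadratic relation
  since \<open>K \<Phi>\<close> and \<open>\<Phi>\<^sup>* K\<close> have the same determinant; together these determine them order by order.
\<close>

definition M1 where "M1 z = - c * fps_X * (R z - R' z) + k * (eK z - eK' z)"
definition M2 where "M2 z = k * (eB z - eB' z) + d * fps_X * (R z - R' z)"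
definition M3 where "M3 z = - c * eB z - k * (R z + R' z) + d * eK' z"
definition M4 where "M4 z = k * (R z + R' z) - d * eK z + c * eB' z"

lemma smf_M [sm_intros]: "smf M1" "smf M2" "smf M3" "smf M4"
  unfolding M1_def[abs_def] M2_def[abs_def] M3_def[abs_def] M4_def[abs_def] by (intro sm_intros)+

lemma
  assumes z: "Im z = h"
  shows DX_M2: "DX M2 z = - U z * (M3 z - M4 z)" (is ?G1)
    and X_DX_M34: "fps_X * DX (\<lambda>z. M3 z - M4 z) z = 2 * U z * M1 z - 2 * V z * M2 z - fps_X * g z * (M3 z + M4 z)" (is ?G2)
proof -
  note zS = line_in_S[OF z]
  have R': "fps_X * DX R' z = - V z * eB' z + U z * eK' z"
    using arg_cong[OF X_DX_R[OF zS], of fps_cnj]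
    by (simp add: fps_cnj_simps fps_cnj_U[OF zS] fps_cnj_V[OF zS] DX_fps_cnj zS sm_intros)
  have B': "DX eB' z = g z * eB' z - 2 * U z * R' z"
    by (simp add: DX_fps_cnj zS sm_intros DX_eB fps_cnj_simps fps_cnj_U[OF zS] fps_cnj_g[OF zS])
  have K': "DX eK' z = - g z * eK' z + 2 * V z * R' z"
    by (simp add: DX_fps_cnj zS sm_intros DX_eK fps_cnj_simps fps_cnj_V[OF zS] fps_cnj_g[OF zS])
  have 1: "DX M2 z = k * (DX eB z - DX eB' z) + d * fps_X * (DX R z - DX R' z)"
    "DX (\<lambda>z. M3 z - M4 z) z = - c * (DX eB z + DX eB' z) - 2 * (k * (DX R z + DX R' z)) + d * (DX eK z + DX eK' z)"
    unfolding M1_def[abs_def] M2_def[abs_def] M3_def[abs_def] M4_def[abs_def]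
    by (simp_all add: DX_const DX_add DX_diff DX_mult DX_minus zS sm_intros algebra_simps)
  show ?G1
    ?G2
    unfolding 1 unfolding DX_eB[OF zS] DX_eK[OF zS] B' K' M1_def M2_def M3_def M4_def
    using X_DX_R[OF zS] R' k_g[OF z] by algebra+
qed

text \<open>\<open>\<Phi>\<close> and its conjugate transpose are traceless, so \<open>adj K\<close>
  times \<open>K \<Phi> - \<Phi>\<^sup>* K\<close> has trace zero; this is that relation up to
  powers of \<open>lam\<close>.\<close>

lemma M34_linear: "k * (M3 z + M4 z) = - c * M2 z - d * M1 z"
  unfolding M1_def M2_def M3_def M4_def by algebra

lemma M_quadratic:
  "M1 z * (k * eB z + d * fps_X * R z) + (k * eK' z - c * fps_X * R' z) * M2 z
    = fps_X * (M3 z * (k * R z - d * eK z) + (k * R' z - d * eK' z) * M4 z)"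
proof -
  have "fps_X * (R' z * R' z) + eB' z * eK' z = 1"
    using arg_cong[OF det_eBK[of z], of fps_cnj] by (simp add: fps_cnj_simps)
  then show ?thesis using det_eBK[of z] unfolding M1_def M2_def M3_def M4_def by algebra
qed

lemma k_0: "fps_nth k 0 = 1" by (simp add: k_def)

text \<open>At order \<open>n\<close> the linear system gives \<open>E * M1 = E' * M2\<close> and
  the quadratic relation gives \<open>E * M1 = - E' * M2\<close>. \<open>M3\<close> and
  \<open>M4\<close> stay one order behind: they are recovered from the derivative of
  \<open>M2\<close> along the line and from the trace relation.\<close>

lemma M12_vanish: "Im z = h \<Longrightarrow> fps_nth (M1 z) n = 0 \<and> fps_nth (M2 z) n = 0"
proof (induction n arbitrary: z rule: less_induct)
  case (less n)
  let ?\<rho> = "\<lambda>z. M3 z - M4 z"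
  have zero: "fps_nth (DX F z) m = 0" if "\<And>z. Im z = h \<Longrightarrow> fps_nth (F z) m = 0" "smf F" "Im z = h" for F m z
    using dx_within_zero_on_line[OF smf_nth[OF that(2)] h that(1) that(3)] DX_nth[OF line_in_S[OF that(3)]] by simp
  have \<rho>: "fps_nth (?\<rho> z) m = 0" if z: "Im z = h" and m: "m < n" for z m
  proof (rule fps_factor_nth_below[OF _ _ m])
    show "fps_nth (- U z * ?\<rho> z) m = 0" if "m < n" for m
      unfolding DX_M2[OF z, symmetric] by (rule zero) (use less that z sm_intros in auto)
    show "fps_nth (- U z) 0 \<noteq> 0" by (simp add: U_def)
  qed
  have \<nu>: "fps_nth (M3 z + M4 z) m = 0" if z: "Im z = h" and m: "m < n" for z m
  proof (rule fps_factor_nth_below[OF _ _ m])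
    show "fps_nth (k * (M3 z + M4 z)) m = 0" if "m < n" for m
      unfolding M34_linear using less z that fps_mult_nth_below[of n "M2 z" m "-c"] fps_mult_nth_below[of n "M1 z" m d]
      by simp
    show "fps_nth k 0 \<noteq> 0" by (simp add: k_0)
  qed
  have 34: "fps_nth (M3 z) m = 0" "fps_nth (M4 z) m = 0" if "Im z = h" "m < n" for z m
    using \<rho>[OF that] \<nu>[OF that] by simp_all
  note z = less.prems
  have "fps_nth (fps_X * DX ?\<rho> z) n = 0"
  proof (cases n)
    case (Suc m)
    have "fps_nth (DX ?\<rho> z) m = 0"
      by (rule zero[OF _ _ z]) (use \<rho> Suc in \<open>auto intro!: sm_intros\<close>)
    then show ?thesis by (simp add: Suc)
  qed simp
  then have "fps_nth (2 * U z * M1 z - 2 * V z * M2 z - fps_X * (g z * (M3 z + M4 z))) n = 0"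
    unfolding X_DX_M34[OF z] by (simp add: mult.assoc)
  moreover have "fps_nth (fps_X * (g z * (M3 z + M4 z))) n = 0"
    using fps_mult_nth_below[of n "M3 z + M4 z" "n - 1" "g z", OF \<nu>[OF z]] by (cases n) auto
  moreover have "fps_nth (2 * U z * M1 z) n = 2 * (\<i> / 4) * E z * fps_nth (M1 z) n"
    using fps_mult_nth_lowest[of n "M1 z" "2 * U z"] less z by (simp add: U_def numeral_fps_const)
  moreover have "fps_nth (2 * V z * M2 z) n = 2 * (\<i> / 4) * E' z * fps_nth (M2 z) n"
    using fps_mult_nth_lowest[of n "M2 z" "2 * V z"] less z by (simp add: V_def numeral_fps_const)
  ultimately have 1: "E z * fps_nth (M1 z) n = E' z * fps_nth (M2 z) n" by simp
  have "fps_nth (fps_X * (M3 z * (k * R z - d * eK z) + (k * R' z - d * eK' z) * M4 z)) n = 0"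
    using fps_mult_nth_below[of n "M3 z" "n - 1" "k * R z - d * eK z", OF 34(1)[OF z]]
      fps_mult_nth_below[of n "M4 z" "n - 1" "k * R' z - d * eK' z", OF 34(2)[OF z]]
    by (cases n) (auto simp: mult.commute)
  moreover have "fps_nth (M1 z * (k * eB z + d * fps_X * R z)) n = E z * fps_nth (M1 z) n"
    using fps_mult_nth_lowest[of n "M1 z" "k * eB z + d * fps_X * R z"] less z
    by (simp add: mult.commute[of "M1 z"] k_0 eB_def Bet_Kap_0)
  moreover have "fps_nth ((k * eK' z - c * fps_X * R' z) * M2 z) n = E' z * fps_nth (M2 z) n"
    using fps_mult_nth_lowest[of n "M2 z" "k * eK' z - c * fps_X * R' z"] less z
    by (simp add: k_0 eK_def Bet_Kap_0)
  ultimately have "E z * fps_nth (M1 z) n + E' z * fps_nth (M2 z) n = 0"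
    using arg_cong[OF M_quadratic[of z], of "\<lambda>F. fps_nth F n"] by simp
  with 1 have "2 * E z * fps_nth (M1 z) n = 0" "2 * E' z * fps_nth (M2 z) n = 0" by algebra+
  then show ?case by simp
qed

lemma
  assumes z: "Im z = h"
  shows sklyanin_formal_11: "k * (eK z - eK' z) = c * fps_X * (R z - R' z)" (is ?G1)
    and sklyanin_formal_22: "k * (eB z - eB' z) = - d * fps_X * (R z - R' z)" (is ?G2)
    and sklyanin_formal_12: "k * (R z + R' z) = d * eK' z - c * eB z" (is ?G3)
proof -
  have M: "M1 z = 0" "M2 z = 0" by (rule fps_ext; simp add: M12_vanish[OF z])+
  \<comment> \<open>Differentiating \<open>M2 = 0\<close> along the line yields
    \<open>M3 = M4\<close>, while the trace relation yields \<open>M3 = - M4\<close>.\<close>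
  have "DX M2 z = 0"
    using dx_within_zero_on_line[OF smf_nth[OF smf_M(2)] h _ z] M12_vanish
    by (intro fps_ext) (simp add: DX_nth[OF line_in_S[OF z]])
  then have "U z * (M3 z - M4 z) = 0" unfolding DX_M2[OF z] by simp
  moreover have "U z \<noteq> 0" using arg_cong[of "U z" 0 "\<lambda>F. fps_nth F 0"] by (auto simp: U_def)
  ultimately have "M3 z = M4 z" by simp
  moreover have "k * (M3 z + M4 z) = 0" unfolding M34_linear M by simp
  moreover have "k \<noteq> 0" using k_0 by auto
  ultimately have "M3 z = 0" by simp
  with M show ?G1 ?G2
    ?G3
    unfolding M1_def M2_def M3_def by algebra+
qed

text \<open>Since \<open>DZ - DZB\<close> is \<open>- \<i>\<close> times the y-derivative, this is
  the linearised Durham condition for the imaginary parts of the coefficients of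
  \<open>R\<close>.\<close>

lemma boundary_condition_formal:
  assumes z: "Im z = h"
  shows "fps_const \<i> * (DZ R z - DZB R z + fps_cnj (DZ R z - DZB R z))
    = fps_const (of_real A * E z - of_real B * E' z) * (R z - R' z)" (is "?l = ?r")
proof -
  note zS = line_in_S[OF z]
  let ?Y = "DZ R z - DZB R z" and ?j = "i4" and ?e = "cE z" and ?f = "cE' z"
  have Y': "fps_X * fps_cnj ?Y = - ?j * ((?f - fps_X * ?e) * eB' z - (?e - fps_X * ?f) * eK' z)"
    using arg_cong[OF X_DY_R[OF zS], of fps_cnj] by (simp add: fps_cnj_simps fps_cnj_i4[OF zS] flip: fps_const_neg)
  define a b e f j D where "a = fps_const (complex_of_real A)" and "b = fps_const (complex_of_real B)"
    and "e = ?e" and "f = ?f" and "j = ?j" and "D = R z - R' z"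
  note abb = this
  have "k * fps_X * (?Y + fps_cnj ?Y) = k * (fps_X * ?Y + fps_X * fps_cnj ?Y)" by (simp add: algebra_simps)
  also have "\<dots> = j * ((f - fps_X * e) * (k * (eB z - eB' z)) - (e - fps_X * f) * (k * (eK z - eK' z)))"
    unfolding X_DY_R[OF zS] Y' abb by algebra
  also have "\<dots> = j * ((f - fps_X * e) * (- d * fps_X * D) - (e - fps_X * f) * (c * fps_X * D))"
    unfolding sklyanin_formal_11[OF z] sklyanin_formal_22[OF z] abb ..
  \<comment> \<open>Inserting \<open>c\<close> and \<open>d\<close> makes the factor
    \<open>k\<close> reappear, so it can be cancelled on both sides.\<close>
  also have "\<dots> = - 4 * j * k * fps_X * (a * e - b * f) * D"
    unfolding c_def d_def k_def abb(1,2)[symmetric] by algebra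
  finally have "k * fps_X * (?Y + fps_cnj ?Y)
      = - 4 * ?j * k * fps_X * (fps_const (of_real A) * ?e - fps_const (of_real B) * ?f) * (R z - R' z)"
    unfolding abb .
  then have "(k * fps_X) * (?Y + fps_cnj ?Y)
      = (k * fps_X) * (- fps_const \<i> * (fps_const (of_real A) * ?e - fps_const (of_real B) * ?f) * (R z - R' z))"
    using fps_const_i4 by algebra
  moreover have "k * fps_X \<noteq> 0" using k_0 by auto
  ultimately have "?Y + fps_cnj ?Y = - fps_const \<i> * (fps_const (of_real A) * ?e - fps_const (of_real B) * ?f) * (R z - R' z)"
    by simp
  then have "?l = (fps_const (of_real A) * ?e - fps_const (of_real B) * ?f) * (R z - R' z)"
    using fps_const_ii by algebra
  then show ?thesis by simp
qed

end

subsection \<open>Poincare inequality\<close>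

text \<open>Expansion of the nonnegative integral of \<open>(f x - t)\<^sup>2\<close>, with
  \<open>t\<close> the mean value of \<open>f\<close>.\<close>

lemma Cauchy_Schwarz_integral:
  fixes f :: "real \<Rightarrow> real"
  assumes f: "continuous_on {a..b} f" and ab: "a \<le> b"
  shows "(integral {a..b} f)\<^sup>2 \<le> (b - a) * integral {a..b} (\<lambda>x. (f x)\<^sup>2)"
proof (cases "a = b")
  case False
  with ab have "a < b" by simp
  define t where "t = integral {a..b} f / (b - a)"
  have i: "f integrable_on {a..b}" "(\<lambda>x. (f x)\<^sup>2) integrable_on {a..b}"
    by (intro integrable_continuous_real continuous_intros f)+
  have "((\<lambda>x. (f x - t)\<^sup>2) has_integral (integral {a..b} (\<lambda>x. (f x)\<^sup>2) - 2 * t * integral {a..b} f + t\<^sup>2 * (b - a))) {a..b}"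
  proof -
    have "((\<lambda>x. (f x)\<^sup>2 - 2 * t * f x + t\<^sup>2) has_integral
        (integral {a..b} (\<lambda>x. (f x)\<^sup>2) - 2 * t * integral {a..b} f + t\<^sup>2 * (b - a))) {a..b}"
      using i has_integral_const_real[of "t\<^sup>2" a b] ab
      by (intro has_integral_add has_integral_diff has_integral_mult_right integrable_integral)
        (simp_all add: mult.commute)
    then show ?thesis by (rule has_integral_eq[rotated]) (simp add: power2_diff)
  qed
  then have "0 \<le> integral {a..b} (\<lambda>x. (f x)\<^sup>2) - 2 * t * integral {a..b} f + t\<^sup>2 * (b - a)"
    by (rule has_integral_nonneg) simp
  moreover have t: "t * (b - a) = integral {a..b} f" using \<open>a < b\<close> by (simp add: t_def)
  ultimately have "t * integral {a..b} f \<le> integral {a..b} (\<lambda>x. (f x)\<^sup>2)"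
    by (simp add: power2_eq_square mult.assoc)
  from mult_left_mono[OF this, of "b - a"] show ?thesis
    using \<open>a < b\<close> by (simp add: power2_eq_square mult.assoc[symmetric] mult.commute[of _ t] t)
qed simp

text \<open>A function with mean zero vanishes somewhere; from that point on, the fundamental
  theorem and Cauchy-Schwarz bound it pointwise. The constant is not sharp, but it tends to 0 with
  the length of the interval.\<close>

lemma Poincare_interval:
  fixes f :: "real \<Rightarrow> real"
  assumes ab: "a < b" and f: "\<And>x. x \<in> {a..b} \<Longrightarrow> (f has_vector_derivative f' x) (at x within {a..b})"
    and f': "continuous_on {a..b} f'" and mean: "integral {a..b} f = 0"
  shows "integral {a..b} (\<lambda>x. (f x)\<^sup>2) \<le> (b - a)\<^sup>2 * integral {a..b} (\<lambda>x. (f' x)\<^sup>2)"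
proof -
  let ?D = "integral {a..b} (\<lambda>x. (f' x)\<^sup>2)"
  have cf: "continuous_on {a..b} f"
    using f by (meson continuous_on_eq_continuous_within has_vector_derivative_continuous)
  obtain c where c: "c \<in> {a..b}" "f c = 0"
  proof -
    have "\<exists>x\<in>{a<..<b}. integral {a..b} f - integral {a..a} f = f x * (b - a)"
      by (rule mvt_simple[OF ab, where f = "\<lambda>x. integral {a..x} f" and f' = "\<lambda>x t. f x * t"])
        (use integral_has_vector_derivative[OF cf] in \<open>simp add: has_vector_derivative_def mult.commute\<close>)
    then obtain x where "x \<in> {a<..<b}" "f x * (b - a) = 0" using mean by auto
    then show thesis using that[of x] ab by auto
  qed
  have bound: "(f x)\<^sup>2 \<le> (b - a) * ?D" if x: "x \<in> {a..b}" for x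
  proof -
    have *: "(f v - f u)\<^sup>2 \<le> (b - a) * ?D" if uv: "a \<le> u" "u \<le> v" "v \<le> b" for u v
    proof -
      have sub: "{u..v} \<subseteq> {a..b}" using uv by auto
      have cu: "continuous_on {u..v} f'" using continuous_on_subset[OF f' sub] .
      have "(f' has_integral (f v - f u)) {u..v}"
        by (rule fundamental_theorem_of_calculus[OF uv(2)])
          (use f sub has_vector_derivative_within_subset in blast)
      then have "f v - f u = integral {u..v} f'" by (simp add: integral_unique)
      then have "(f v - f u)\<^sup>2 \<le> (v - u) * integral {u..v} (\<lambda>x. (f' x)\<^sup>2)"
        using Cauchy_Schwarz_integral[OF cu uv(2)] by simp
      also have "\<dots> \<le> (b - a) * ?D"
        using uv sub cu f'
        by (intro mult_mono integral_subset_le integral_nonneg integrable_continuous_real continuous_intros) auto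
      finally show ?thesis .
    qed
    show ?thesis
      using *[of c x] *[of x c] c x by (cases "c \<le> x") (auto simp: power2_commute)
  qed
  have "integral {a..b} (\<lambda>x. (f x)\<^sup>2) \<le> integral {a..b} (\<lambda>x. (b - a) * ?D)"
    by (intro integral_le integrable_continuous_real continuous_intros cf bound)
  also have "\<dots> = (b - a)\<^sup>2 * ?D" using ab by (simp add: power2_eq_square)
  finally show ?thesis .
qed

abbreviation cell :: "real \<Rightarrow> real \<Rightarrow> nat \<Rightarrow> real set" where
  "cell a \<delta> j \<equiv> {a + real j * \<delta>..a + real (Suc j) * \<delta>}"

lemma integral_partition:
  fixes f :: "real \<Rightarrow> real"
  assumes "continuous_on {a..a + real m * \<delta>} f" "0 \<le> \<delta>"
  shows "integral {a..a + real m * \<delta>} f = (\<Sum>j<m. integral (cell a \<delta> j) f)"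
  using assms(1)
proof (induction m)
  case (Suc m)
  have le: "a \<le> a + real m * \<delta>" "a + real m * \<delta> \<le> a + real (Suc m) * \<delta>" using assms(2) by (simp_all add: algebra_simps)
  have "integral {a..a + real m * \<delta>} f + integral {a + real m * \<delta>..a + real (Suc m) * \<delta>} f = integral {a..a + real (Suc m) * \<delta>} f"
    by (rule Henstock_Kurzweil_Integration.integral_combine[OF le integrable_continuous_real[OF Suc.prems]])
  moreover have "continuous_on {a..a + real m * \<delta>} f"
    using Suc.prems by (rule continuous_on_subset) (use le in auto)
  ultimately show ?case using Suc.IH by simp
qed simp

lemma Poincare_partition:
  fixes f :: "real \<Rightarrow> real"
  assumes ab: "0 < \<delta>" and f: "\<And>x. x \<in> {a..a + real m * \<delta>} \<Longrightarrow> (f has_vector_derivative f' x) (at x within {a..a + real m * \<delta>})"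
    and f': "continuous_on {a..a + real m * \<delta>} f'"
    and mean: "\<And>j. j < m \<Longrightarrow> integral (cell a \<delta> j) f = 0"
  shows "integral {a..a + real m * \<delta>} (\<lambda>x. (f x)\<^sup>2) \<le> \<delta>\<^sup>2 * integral {a..a + real m * \<delta>} (\<lambda>x. (f' x)\<^sup>2)"
proof -
  let ?I = "\<lambda>j. (cell a \<delta> j)" and ?W = "{a..a + real m * \<delta>}"
  have cf: "continuous_on ?W f"
    using f by (meson continuous_on_eq_continuous_within has_vector_derivative_continuous)
  have "integral ?W (\<lambda>x. (f x)\<^sup>2) = (\<Sum>j<m. integral (?I j) (\<lambda>x. (f x)\<^sup>2))"
    using ab by (intro integral_partition continuous_intros cf) simp
  also have "\<dots> \<le> (\<Sum>j<m. \<delta>\<^sup>2 * integral (?I j) (\<lambda>x. (f' x)\<^sup>2))"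
  proof (rule sum_mono)
    fix j assume j: "j \<in> {..<m}"
    then have "real (Suc j) * \<delta> \<le> real m * \<delta>" using ab by (intro mult_right_mono) auto
    moreover have "0 \<le> real j * \<delta>" using ab by simp
    ultimately have sub: "(?I j) \<subseteq> ?W" by (intro subsetI) (simp; linarith)
    have "integral (?I j) (\<lambda>x. (f x)\<^sup>2)
        \<le> (a + real (Suc j) * \<delta> - (a + real j * \<delta>))\<^sup>2 * integral (?I j) (\<lambda>x. (f' x)\<^sup>2)"
    proof (rule Poincare_interval)
      show "a + real j * \<delta> < a + real (Suc j) * \<delta>" using ab by (simp add: algebra_simps)
      show "(f has_vector_derivative f' x) (at x within (?I j))"
        if "x \<in> (?I j)" for x
        using has_vector_derivative_within_subset[OF f sub] that sub by blast
    qed (use j mean continuous_on_subset[OF f' sub] in auto)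
    then show "integral (?I j) (\<lambda>x. (f x)\<^sup>2)
        \<le> \<delta>\<^sup>2 * integral (?I j) (\<lambda>x. (f' x)\<^sup>2)"
      by (simp add: algebra_simps)
  qed
  also have "\<dots> = \<delta>\<^sup>2 * integral ?W (\<lambda>x. (f' x)\<^sup>2)"
    unfolding sum_distrib_left[symmetric] using ab
    by (subst integral_partition[of a m \<delta> "\<lambda>x. (f' x)\<^sup>2"]) (auto intro!: continuous_intros f')
  finally show ?thesis .
qed

text \<open>Gaussian elimination: a pivot in the new equation removes one unknown from all the
  others.\<close>

lemma underdetermined_system:
  fixes v :: "'j \<Rightarrow> 'i \<Rightarrow> real"
  assumes "finite J" "finite I" "card J < card I"
  shows "\<exists>r. (\<exists>i\<in>I. r i \<noteq> 0) \<and> (\<forall>j\<in>J. (\<Sum>i\<in>I. r i * v j i) = 0)"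
  using assms
proof (induction J arbitrary: I v rule: finite_induct)
  case empty
  then have "I \<noteq> {}" by auto
  then show ?case by (intro exI[of _ "\<lambda>_. 1"]) auto
next
  case (insert j J)
  show ?case
  proof (cases "\<forall>i\<in>I. v j i = 0")
    case True
    have "card J < card I" using insert by simp
    from insert.IH[OF insert.prems(1) this, of v]
    obtain r where "\<exists>i\<in>I. r i \<noteq> 0" "\<And>l. l \<in> J \<Longrightarrow> (\<Sum>i\<in>I. r i * v l i) = 0" by blast
    moreover have "(\<Sum>i\<in>I. r i * v j i) = 0" using True by (simp add: sum.neutral)
    ultimately show ?thesis by blast
  next
    case False
    then obtain p where p: "p \<in> I" "v j p \<noteq> 0" by blast
    have "card J < card (I - {p})" using insert p by simp
    \<comment> \<open>The equations \<open>l\<close> after the unknown \<open>p\<close> has been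
      eliminated by means of equation \<open>j\<close>.\<close>
    from insert.IH[OF finite_Diff[OF insert.prems(1)] this, of "\<lambda>l i. v l i - v l p * v j i / v j p"]
    obtain r where r: "\<exists>i\<in>I - {p}. r i \<noteq> 0" "\<And>l. l \<in> J \<Longrightarrow> (\<Sum>i\<in>I - {p}. r i * (v l i - v l p * v j i / v j p)) = 0"
      by blast
    \<comment> \<open>The value of the unknown \<open>p\<close> that satisfies equation
      \<open>j\<close>.\<close>
    define t where "t = - (\<Sum>i\<in>I - {p}. r i * v j i) / v j p"
    have split: "(\<Sum>i\<in>I. (r(p := t)) i * v l i) = t * v l p + (\<Sum>i\<in>I - {p}. r i * v l i)" for l
      using p insert.prems(1) by (subst sum.remove[of I p]) (auto intro!: sum.cong)
    have "(\<Sum>i\<in>I. (r(p := t)) i * v l i) = 0" if "l \<in> insert j J" for l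
    proof (cases "l = j")
      case True
      then show ?thesis unfolding split using p by (simp add: t_def)
    next
      case False
      then have "0 = (\<Sum>i\<in>I - {p}. r i * v l i - v l p / v j p * (r i * v j i))"
        using r(2)[of l] that by (simp add: algebra_simps)
      also have "\<dots> = (\<Sum>i\<in>I - {p}. r i * v l i) + t * v l p"
        unfolding sum_subtractf sum_distrib_left[symmetric] t_def by (simp add: field_simps)
      finally show ?thesis unfolding split by simp
    qed
    then show ?thesis using r(1) by (intro exI[of _ "r(p := t)"]) auto
  qed
qed

section \<open>Integration over rectangles of full height\<close>

context wide_strip
begin

definition J :: "real \<Rightarrow> real \<Rightarrow> (complex \<Rightarrow> real) \<Rightarrow> real" where
  "J a b F = integral (cbox (a, -T) (b, T)) (\<lambda>p. F (Complex (fst p) (snd p)))"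

lemma continuous_on_rectangle:
  fixes F :: "complex \<Rightarrow> real"
  assumes "continuous_on S F"
  shows "continuous_on (cbox (a, -T) (b, T)) (\<lambda>p. F (Complex (fst p) (snd p)))"
  by (rule continuous_on_compose2[OF assms]) (auto intro!: continuous_intros simp: Complex_in_strip cbox_Pair_eq cbox_interval)

lemma continuous_on_horizontal:
  fixes F :: "complex \<Rightarrow> real"
  assumes "continuous_on S F" "y \<in> {-T..T}"
  shows "continuous_on X (\<lambda>x. F (Complex x y))"
  by (rule continuous_on_compose2[OF assms(1)]) (use assms(2) in \<open>auto intro!: continuous_intros simp: Complex_in_strip\<close>)

lemma
  fixes F :: "complex \<Rightarrow> real"
  assumes "continuous_on S F"
  shows J_iterated_xy: "J a b F = integral {a..b} (\<lambda>x. integral {-T..T} (\<lambda>y. F (Complex x y)))" (is ?G1)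
    and J_iterated_yx: "J a b F = integral {-T..T} (\<lambda>y. integral {a..b} (\<lambda>x. F (Complex x y)))" (is ?G2)
proof -
  show 1: ?G1
    unfolding J_def using integral_prod_continuous[OF continuous_on_rectangle[OF assms], of a b]
    by (simp add: cbox_interval)
  have "continuous_on (cbox (a, -T) (b, T)) (\<lambda>(x, y). F (Complex x y))"
    using continuous_on_rectangle[OF assms] by (simp add: case_prod_unfold)
  from integral_swap_continuous[OF this] 1
  show ?G2
    by (simp add: cbox_interval)
qed

lemma continuous_on_inner_y:
  fixes F :: "complex \<Rightarrow> real"
  assumes "continuous_on S F"
  shows "continuous_on X (\<lambda>x. integral {-T..T} (\<lambda>y. F (Complex x y)))"
proof -
  have "continuous_on (X \<times> cbox (-T) T) (\<lambda>(x, y). F (Complex x y))"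
    unfolding case_prod_unfold
    by (rule continuous_on_compose2[OF assms]) (auto intro!: continuous_intros simp: Complex_in_strip)
  from integral_continuous_on_param[OF this] show ?thesis by (simp add: cbox_interval)
qed

lemma continuous_on_inner_x:
  fixes F :: "complex \<Rightarrow> real"
  assumes "continuous_on S F"
  shows "continuous_on {-T..T} (\<lambda>y. integral {a..b} (\<lambda>x. F (Complex x y)))"
proof -
  have "continuous_on ({-T..T} \<times> cbox a b) (\<lambda>(y, x). F (Complex x y))"
    unfolding case_prod_unfold
    by (rule continuous_on_compose2[OF assms]) (auto intro!: continuous_intros simp: Complex_in_strip)
  from integral_continuous_on_param[OF this] show ?thesis by (simp add: cbox_interval)
qed

lemma J_add:
  assumes "continuous_on S F" "continuous_on S G"
  shows "J a b (\<lambda>z. F z + G z) = J a b F + J a b G"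
  unfolding J_def by (intro integral_add integrable_continuous continuous_on_rectangle assms)

lemma J_cmult: "J a b (\<lambda>z. r * F z) = r * J a b F"
  unfolding J_def by simp

lemma J_mono:
  assumes "continuous_on S F" "continuous_on S G" "\<And>z. z \<in> S \<Longrightarrow> Re z \<in> {a..b} \<Longrightarrow> F z \<le> G z"
  shows "J a b F \<le> J a b G"
  unfolding J_def
  by (intro integral_le integrable_continuous continuous_on_rectangle assms)
    (auto simp: cbox_Pair_eq cbox_interval Complex_in_strip)

lemma J_cong:
  assumes "\<And>z. z \<in> S \<Longrightarrow> F z = G z"
  shows "J a b F = J a b G"
  unfolding J_def by (rule integral_cong) (auto simp: cbox_Pair_eq cbox_interval Complex_in_strip assms)

lemma J_nonneg:
  assumes "continuous_on S F" "\<And>z. z \<in> S \<Longrightarrow> 0 \<le> F z"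
  shows "0 \<le> J a b F"
  unfolding J_def
  by (intro integral_nonneg integrable_continuous continuous_on_rectangle assms)
    (auto simp: cbox_Pair_eq cbox_interval Complex_in_strip)

lemma J_partition:
  assumes "continuous_on S F" "0 \<le> \<delta>"
  shows "J a (a + real m * \<delta>) F = (\<Sum>i<m. J (a + real i * \<delta>) (a + real (Suc i) * \<delta>) F)"
  unfolding J_iterated_xy[OF assms(1)]
  by (rule integral_partition[OF continuous_on_inner_y[OF assms(1)] assms(2)])

text \<open>\<open>u\<close> is split into its mean \<open>\<mu>\<close> over x and the rest. The
  rest is controlled by \<open>Dx u\<close> on each horizontal slice, and \<open>\<mu>\<close> by
  the partition in y; as the rest has mean zero, no mixed term appears. Only averages over cells
  enter, hence finitely many linear conditions on \<open>u\<close>.\<close>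

lemma Poincare_box:
  fixes u :: "complex \<Rightarrow> real"
  assumes u: "sm u" and ab: "a < b" and \<delta>: "0 < \<delta>" "real m * \<delta> = 2 * T"
    and mean: "\<And>j. j < m \<Longrightarrow>
      integral (cell (-T) \<delta> j) (\<lambda>y. integral {a..b} (\<lambda>x. u (Complex x y))) = 0"
  shows "J a b (\<lambda>z. (u z)\<^sup>2) \<le> (b - a)\<^sup>2 * J a b (\<lambda>z. (Dx u z)\<^sup>2) + \<delta>\<^sup>2 * J a b (\<lambda>z. (Dy u z)\<^sup>2)"
proof -
  let ?U2 = "\<lambda>z. (u z)\<^sup>2" and ?X2 = "\<lambda>z. (Dx u z)\<^sup>2" and ?Y2 = "\<lambda>z. (Dy u z)\<^sup>2"
  have m: "- T + real m * \<delta> = T" using \<delta> by simp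
  have c: "continuous_on S u" "continuous_on S (Dx u)" "continuous_on S (Dy u)"
    using u by (auto intro!: sm_continuous sm_intros)
  define \<mu> where "\<mu> y = integral {a..b} (\<lambda>x. u (Complex x y)) / (b - a)" for y
  define \<mu>' where "\<mu>' y = integral {a..b} (\<lambda>x. Dy u (Complex x y)) / (b - a)" for y
  have \<mu>_deriv: "(\<mu> has_vector_derivative \<mu>' y) (at y within {-T..T})" if y: "y \<in> {-T..T}" for y
  proof -
    have "((\<lambda>y. integral (cbox a b) (\<lambda>x. u (Complex x y))) has_vector_derivative
        integral (cbox a b) (\<lambda>x. Dy u (Complex x y))) (at y within {-T..T})"
    proof (rule leibniz_rule_vector_derivative)
      show "((\<lambda>y. u (Complex x y)) has_vector_derivative Dy u (Complex x y)) (at y within {-T..T})"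
        if "y \<in> {-T..T}" for y x
        using vderiv_y[OF u that] .
      show "(\<lambda>x. u (Complex x y)) integrable_on cbox a b" if "y \<in> {-T..T}" for y
        by (intro integrable_continuous continuous_on_horizontal c that)
      show "continuous_on ({-T..T} \<times> cbox a b) (\<lambda>(y, x). Dy u (Complex x y))"
        unfolding case_prod_unfold
        by (rule continuous_on_compose2[OF c(3)]) (auto intro!: continuous_intros simp: Complex_in_strip)
    qed (use y in auto)
    from has_vector_derivative_mult_left[OF this, of "1 / (b - a)"] show ?thesis
      unfolding \<mu>_def[abs_def] \<mu>'_def by (simp add: cbox_interval)
  qed
  have c\<mu>: "continuous_on {-T..T} \<mu>" "continuous_on {-T..T} \<mu>'"
    unfolding \<mu>_def[abs_def] \<mu>'_def[abs_def] using ab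
    by (auto intro!: continuous_intros continuous_on_inner_x c)
  have slice: "integral {a..b} (\<lambda>x. (u (Complex x y))\<^sup>2)
      \<le> (b - a)\<^sup>2 * integral {a..b} (\<lambda>x. (Dx u (Complex x y))\<^sup>2) + (b - a) * (\<mu> y)\<^sup>2" if y: "y \<in> {-T..T}" for y
  proof -
    note cy = continuous_on_horizontal[OF c(1) y, of "{a..b}"]
    have I: "integral {a..b} (\<lambda>x. u (Complex x y)) = (b - a) * \<mu> y" using ab by (simp add: \<mu>_def)
    have "integral {a..b} (\<lambda>x. (u (Complex x y) - \<mu> y)\<^sup>2) \<le> (b - a)\<^sup>2 * integral {a..b} (\<lambda>x. (Dx u (Complex x y))\<^sup>2)"
    proof (rule Poincare_interval[OF ab])
      show "((\<lambda>x. u (Complex x y) - \<mu> y) has_vector_derivative Dx u (Complex x y)) (at x within {a..b})" for x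
        using has_vector_derivative_diff[OF vderiv_x[OF u y] has_vector_derivative_const] by simp
      show "continuous_on {a..b} (\<lambda>x. Dx u (Complex x y))" by (rule continuous_on_horizontal[OF c(2) y])
      show "integral {a..b} (\<lambda>x. u (Complex x y) - \<mu> y) = 0"
        using ab I by (subst integral_diff) (auto intro!: integrable_continuous_real cy)
    qed
    moreover have "((\<lambda>x. (u (Complex x y) - \<mu> y)\<^sup>2) has_integral
        (integral {a..b} (\<lambda>x. (u (Complex x y))\<^sup>2) - 2 * \<mu> y * ((b - a) * \<mu> y) + (\<mu> y)\<^sup>2 * (b - a))) {a..b}"
    proof -
      have "((\<lambda>x. (u (Complex x y))\<^sup>2 - 2 * \<mu> y * u (Complex x y) + (\<mu> y)\<^sup>2) has_integral
        (integral {a..b} (\<lambda>x. (u (Complex x y))\<^sup>2) - 2 * \<mu> y * ((b - a) * \<mu> y) + (\<mu> y)\<^sup>2 * (b - a))) {a..b}"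
        using has_integral_const_real[of "(\<mu> y)\<^sup>2" a b] ab
        unfolding I[symmetric]
        by (intro has_integral_add has_integral_diff has_integral_mult_right integrable_integral
            integrable_continuous_real continuous_intros cy) (simp_all add: mult.commute)
      then show ?thesis by (rule has_integral_eq[rotated]) (simp add: power2_diff)
    qed
    ultimately show ?thesis by (simp add: integral_unique power2_eq_square algebra_simps)
  qed
  have mean2: "integral {-T..T} (\<lambda>y. (\<mu> y)\<^sup>2) \<le> \<delta>\<^sup>2 * integral {-T..T} (\<lambda>y. (\<mu>' y)\<^sup>2)"
  proof (rule Poincare_partition[of \<delta> "-T" m \<mu> \<mu>', unfolded m])
    fix j assume j: "j < m"
    have "integral (cell (-T) \<delta> j) \<mu>
        = integral (cell (-T) \<delta> j) (\<lambda>y. integral {a..b} (\<lambda>x. u (Complex x y))) / (b - a)"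
      unfolding \<mu>_def[abs_def] by simp
    then show "integral (cell (-T) \<delta> j) \<mu> = 0" using mean[OF j] by simp
  qed (use \<delta> \<mu>_deriv c\<mu> in auto)
  have \<mu>': "(b - a) * (\<mu>' y)\<^sup>2 \<le> integral {a..b} (\<lambda>x. (Dy u (Complex x y))\<^sup>2)" if y: "y \<in> {-T..T}" for y
  proof -
    have "(b - a) * (\<mu>' y)\<^sup>2 = (integral {a..b} (\<lambda>x. Dy u (Complex x y)))\<^sup>2 / (b - a)"
      using ab by (simp add: \<mu>'_def power2_eq_square)
    then show ?thesis
      using Cauchy_Schwarz_integral[OF continuous_on_horizontal[OF c(3) y], of a b] ab
      by (simp add: pos_divide_le_eq mult.commute)
  qed
  have sq: "continuous_on S ?U2" "continuous_on S ?X2" "continuous_on S ?Y2"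
    using c by (auto intro!: continuous_intros)
  note inner = sq[THEN continuous_on_inner_x, of a b]
  have "J a b ?U2 \<le> integral {-T..T} (\<lambda>y. (b - a)\<^sup>2 * integral {a..b} (\<lambda>x. (Dx u (Complex x y))\<^sup>2) + (b - a) * (\<mu> y)\<^sup>2)"
    unfolding J_iterated_yx[OF sq(1)]
    by (intro integral_le integrable_continuous_real continuous_intros inner c\<mu> slice)
  also have "\<dots> = (b - a)\<^sup>2 * J a b ?X2 + (b - a) * integral {-T..T} (\<lambda>y. (\<mu> y)\<^sup>2)"
    unfolding J_iterated_yx[OF sq(2)]
    by (subst integral_add) (auto intro!: integrable_continuous_real continuous_intros inner c\<mu>)
  also have "(b - a) * integral {-T..T} (\<lambda>y. (\<mu> y)\<^sup>2) \<le> (b - a) * (\<delta>\<^sup>2 * integral {-T..T} (\<lambda>y. (\<mu>' y)\<^sup>2))"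
    using mean2 ab by (intro mult_left_mono) auto
  also have "\<dots> = \<delta>\<^sup>2 * integral {-T..T} (\<lambda>y. (b - a) * (\<mu>' y)\<^sup>2)" by simp
  also have "integral {-T..T} (\<lambda>y. (b - a) * (\<mu>' y)\<^sup>2) \<le> J a b ?Y2"
    unfolding J_iterated_yx[OF sq(3)]
    by (intro integral_le integrable_continuous_real continuous_intros inner c\<mu> \<mu>')
  finally show ?thesis by (simp add: mult_left_mono)
qed

subsection \<open>Finite dimension of the space of Jacobi fields\<close>

lemma
  fixes f :: "complex \<Rightarrow> real"
  assumes "sm f" "\<And>z. z \<in> S \<Longrightarrow> f (z + of_real L) = f z" "z \<in> S"
  shows dx_periodic: "Dx f (z + of_real L) = Dx f z"
proof -
  have "z + of_real L \<in> S" using assms(3) by (simp add: strip_def)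
  from dx_within_eqI[OF assms(3) has_derivative_translate[OF assms(2,3) sm_has_derivative[OF assms(1) this]]]
  show ?thesis by simp
qed

text \<open>Green's formula for \<open>u\<close> times its Laplacian. The vertical sides cancel by
  periodicity; the horizontal ones leave a boundary integral of \<open>u\<^sup>2\<close>, which is
  traded for an area integral whose gradient part is at most half the Dirichlet energy.\<close>

lemma energy_estimate:
  fixes u c b :: "complex \<Rightarrow> real"
  assumes u: "sm u" and L: "0 < L" and periodic: "\<And>z. z \<in> S \<Longrightarrow> u (z + of_real L) = u z"
    and pde: "\<And>z. z \<in> S \<Longrightarrow> Dx (Dx u) z + Dy (Dy u) z = - c z * u z"
    and bc: "\<And>z. Im z = T \<or> Im z = - T \<Longrightarrow> Dy u z = b z * u z"
    and cM: "\<And>z. z \<in> S \<Longrightarrow> Re z \<in> {0..L} \<Longrightarrow> c z \<le> M"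
    and bM: "\<And>z. z \<in> S \<Longrightarrow> Re z \<in> {0..L} \<Longrightarrow> \<bar>b z\<bar> \<le> M"
    and M: "0 \<le> M"
  shows "J 0 L (\<lambda>z. (Dx u z)\<^sup>2 + (Dy u z)\<^sup>2) \<le> 2 * (M + M / T + 2 * M\<^sup>2) * J 0 L (\<lambda>z. (u z)\<^sup>2)"
proof -
  let ?x = "Dx u" and ?y = "Dy u"
  let ?X = "\<lambda>z. u z * Dx ?x z + ?x z * ?x z" and ?Y = "\<lambda>z. u z * Dy ?y z + ?y z * ?y z"
    and ?B = "\<lambda>z. (u z)\<^sup>2 / T + 2 * (Im z / T) * (u z * ?y z)" and ?U = "\<lambda>z. (u z)\<^sup>2"
    and ?G = "\<lambda>z. (?x z)\<^sup>2 + (?y z)\<^sup>2"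
  have sm: "sm ?x" "sm ?y" using u by (auto intro: sm_intros)
  have c: "continuous_on S u" "continuous_on S ?x" "continuous_on S ?y" "continuous_on S (Dx ?x)"
    "continuous_on S (Dy ?y)"
    using u by (auto intro!: sm_continuous sm_intros)
  have x_part: "J 0 L ?X = 0"
  proof -
    have "integral {0..L} (\<lambda>x. u (Complex x y) * Dx ?x (Complex x y) + ?x (Complex x y) * ?x (Complex x y)) = 0"
      if y: "y \<in> {-T..T}" for y
    proof -
      have "((\<lambda>x. u (Complex x y) * Dx ?x (Complex x y) + ?x (Complex x y) * ?x (Complex x y)) has_integral
          (u (Complex L y) * ?x (Complex L y) - u (Complex 0 y) * ?x (Complex 0 y))) {0..L}"
        by (rule fundamental_theorem_of_calculus)
          (use L has_vector_derivative_mult[OF vderiv_x[OF u y] vderiv_x[OF sm(1) y]] in auto)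
      moreover have "Complex L y = Complex 0 y + of_real L" "Complex 0 y \<in> S"
        using y by (simp_all add: complex_eq_iff Complex_in_strip)
      ultimately show ?thesis using periodic dx_periodic[OF u periodic] by (simp add: integral_unique)
    qed
    then have "integral {-T..T} (\<lambda>y. integral {0..L} (\<lambda>x. u (Complex x y) * Dx ?x (Complex x y)
        + ?x (Complex x y) * ?x (Complex x y))) = integral {-T..T} (\<lambda>y. 0)"
      by (rule integral_cong)
    then show ?thesis by (subst J_iterated_yx) (auto intro!: continuous_intros c)
  qed
  have ibp_y: "J 0 L (\<lambda>z. F z * Dy G z + Dy F z * G z)
      = integral {0..L} (\<lambda>x. F (Complex x T) * G (Complex x T) - F (Complex x (-T)) * G (Complex x (-T)))"
    if "sm F" "sm G" for F G :: "complex \<Rightarrow> real"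
  proof -
    have "integral {-T..T} (\<lambda>y. F (Complex x y) * Dy G (Complex x y) + Dy F (Complex x y) * G (Complex x y))
        = F (Complex x T) * G (Complex x T) - F (Complex x (-T)) * G (Complex x (-T))" for x
      by (rule integral_unique, rule fundamental_theorem_of_calculus)
        (use T_pos has_vector_derivative_mult[OF vderiv_y[OF that(1)] vderiv_y[OF that(2)]] in auto)
    then show ?thesis
      by (subst J_iterated_xy) (auto intro!: continuous_intros sm_continuous that sm_intros)
  qed
  define W where "W x = (u (Complex x T))\<^sup>2 + (u (Complex x (-T)))\<^sup>2" for x
  have cu: "continuous_on {0..L} (\<lambda>x. u (Complex x T))" "continuous_on {0..L} (\<lambda>x. u (Complex x (-T)))"
    "continuous_on {0..L} (\<lambda>x. ?y (Complex x T))" "continuous_on {0..L} (\<lambda>x. ?y (Complex x (-T)))"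
    using T_pos by (auto intro!: continuous_on_horizontal c)
  have y_part: "J 0 L ?Y \<le> M * integral {0..L} W"
  proof -
    have "u (Complex x T) * ?y (Complex x T) - u (Complex x (-T)) * ?y (Complex x (-T)) \<le> M * W x" if x: "x \<in> {0..L}" for x
    proof -
      have "u z * ?y z = b z * (u z)\<^sup>2" "\<bar>b z\<bar> * (u z)\<^sup>2 \<le> M * (u z)\<^sup>2" if "z = Complex x T \<or> z = Complex x (-T)" for z
        using that x T_pos bc[of z] bM[of z]
        by (auto simp: power2_eq_square Complex_in_strip intro!: mult_right_mono)
      from this[of "Complex x T"] this[of "Complex x (-T)"] show ?thesis
        unfolding W_def distrib_left
        using mult_right_mono[OF abs_ge_self[of "b (Complex x T)"], of "(u (Complex x T))\<^sup>2"]
          mult_right_mono[OF abs_ge_minus_self[of "b (Complex x (-T))"], of "(u (Complex x (-T)))\<^sup>2"]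
        by simp
    qed
    then have "integral {0..L} (\<lambda>x. u (Complex x T) * ?y (Complex x T) - u (Complex x (-T)) * ?y (Complex x (-T)))
        \<le> integral {0..L} (\<lambda>x. M * W x)"
      unfolding W_def[abs_def] by (intro integral_le integrable_continuous_real continuous_intros cu)
    then show ?thesis unfolding ibp_y[OF u sm(2)] by simp
  qed
  \<comment> \<open>The function \<open>Im z / T\<close> is 1 on the top line and -1 on the bottom
    line, so the boundary integral is the area integral of the y-derivative of
    \<open>(Im z / T) * (u z)\<^sup>2\<close>.\<close>
  have boundary: "integral {0..L} W = J 0 L ?B"
  proof -
    have Im: "(Im has_derivative Im) (at z within S)" for z
      by (rule bounded_linear.has_derivative[OF bounded_linear_Im has_derivative_ident, simplified])
    have smIm: "sm Im" by (rule sm_linear[OF bounded_linear_Im, where f = "\<lambda>z. z"]) (rule sm_id)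
    have "sm (\<lambda>z. Im z / T * u z)" by (intro sm_intros smIm u)
    have dy: "Dy (\<lambda>z. Im z / T * u z) z = u z / T + Im z / T * ?y z" if z: "z \<in> S" for z
    proof -
      have "((\<lambda>z. Im z / T) has_derivative (\<lambda>v. Im v / T)) (at z within S)"
        using T_pos by (auto intro!: derivative_eq_intros Im)
      from dy_within_eqI[OF z has_derivative_mult[OF this sm_has_derivative[OF u z]]]
      show ?thesis by simp
    qed
    have "integral {0..L} W = integral {0..L} (\<lambda>x. u (Complex x T) * (Im (Complex x T) / T * u (Complex x T))
        - u (Complex x (-T)) * (Im (Complex x (-T)) / T * u (Complex x (-T))))"
      using T_pos by (simp add: W_def[abs_def] power2_eq_square)
    also have "\<dots> = J 0 L (\<lambda>z. u z * Dy (\<lambda>z. Im z / T * u z) z + ?y z * (Im z / T * u z))"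
      by (rule ibp_y[symmetric]) fact+
    also have "\<dots> = J 0 L ?B"
    proof (rule J_cong)
      fix z assume z: "z \<in> S"
      show "u z * Dy (\<lambda>z. Im z / T * u z) z + ?y z * (Im z / T * u z) = (u z)\<^sup>2 / T + 2 * (Im z / T) * (u z * ?y z)"
        unfolding dy[OF z] by (simp add: power2_eq_square algebra_simps)
    qed
    finally show ?thesis .
  qed
  let ?D = "J 0 L ?G" and ?N = "J 0 L ?U"
  have cont: "continuous_on S ?G" "continuous_on S ?U"
    "continuous_on S ?X" "continuous_on S ?Y"
    "continuous_on S ?B"
    using T_pos by (auto intro!: continuous_intros c)
  have "?D \<le> J 0 L (\<lambda>z. (u z * Dx ?x z + ?x z * ?x z) + (u z * Dy ?y z + ?y z * ?y z) + M * (u z)\<^sup>2)"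
  proof (rule J_mono)
    fix z assume z: "z \<in> S" "Re z \<in> {0..L}"
    have "u z * Dx ?x z + u z * Dy ?y z = - c z * (u z)\<^sup>2"
      using pde[OF z(1)] by (simp add: power2_eq_square algebra_simps flip: distrib_left)
    moreover have "c z * (u z)\<^sup>2 \<le> M * (u z)\<^sup>2" using cM[OF z] by (intro mult_right_mono) auto
    ultimately show "(?x z)\<^sup>2 + (?y z)\<^sup>2 \<le> (u z * Dx ?x z + ?x z * ?x z) + (u z * Dy ?y z + ?y z * ?y z) + M * (u z)\<^sup>2"
      by (simp add: power2_eq_square)
  qed (intro continuous_intros c cont)+
  also have "\<dots> = J 0 L ?Y + M * ?N"
    using cont by (simp add: J_add J_cmult x_part continuous_on_add continuous_on_mult_left)
  also have "\<dots> \<le> M * J 0 L ?B + M * ?N"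
    using y_part unfolding boundary by simp
  also have "M * J 0 L ?B
      = J 0 L (\<lambda>z. M * ((u z)\<^sup>2 / T + 2 * (Im z / T) * (u z * ?y z)))"
    using cont by (simp add: J_cmult)
  also have "\<dots> \<le> J 0 L (\<lambda>z. (M / T + 2 * M\<^sup>2) * (u z)\<^sup>2 + (1 / 2) * ((?x z)\<^sup>2 + (?y z)\<^sup>2))"
  proof (rule J_mono)
    fix z assume z: "z \<in> S"
    have T1: "\<bar>Im z / T\<bar> \<le> 1" using z T_pos by (auto simp: strip_def)
    have "(Im z / T) * (M * u z * ?y z) \<le> \<bar>Im z / T\<bar> * \<bar>M * u z * ?y z\<bar>"
      unfolding abs_mult[symmetric] by (rule abs_ge_self)
    also have "\<dots> \<le> 1 * \<bar>M * u z * ?y z\<bar>" by (rule mult_right_mono[OF T1]) simp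
    finally have "(Im z / T) * (M * u z * ?y z) \<le> 1 * \<bar>M * u z * ?y z\<bar>" .
    \<comment> \<open>Young's inequality, weighted so that the square of \<open>Dy u\<close> gets
      the coefficient 1/2 and can be absorbed on the left.\<close>
    moreover have "2 * \<bar>M * u z * ?y z\<bar> \<le> 2 * (M * u z)\<^sup>2 + (?y z)\<^sup>2 / 2"
      using zero_le_power2[of "2 * \<bar>M * u z\<bar> - \<bar>?y z\<bar>"] by (simp add: power2_diff abs_mult power_mult_distrib)
    moreover have "0 \<le> (?x z)\<^sup>2" by simp
    moreover have "M * ((u z)\<^sup>2 / T + 2 * (Im z / T) * (u z * ?y z)) = M / T * (u z)\<^sup>2 + 2 * ((Im z / T) * (M * u z * ?y z))"
      by (simp add: algebra_simps)
    moreover have "(M / T + 2 * M\<^sup>2) * (u z)\<^sup>2 + (1 / 2) * ((?x z)\<^sup>2 + (?y z)\<^sup>2)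
        = M / T * (u z)\<^sup>2 + 2 * (M * u z)\<^sup>2 + (?x z)\<^sup>2 / 2 + (?y z)\<^sup>2 / 2"
      by (simp add: algebra_simps power_mult_distrib)
    ultimately show "M * ((u z)\<^sup>2 / T + 2 * (Im z / T) * (u z * ?y z)) \<le> (M / T + 2 * M\<^sup>2) * (u z)\<^sup>2 + (1 / 2) * ((?x z)\<^sup>2 + (?y z)\<^sup>2)"
      by linarith
  qed (use T_pos in \<open>auto intro!: continuous_intros c\<close>)
  also have "\<dots> = (M / T + 2 * M\<^sup>2) * ?N + (1 / 2) * ?D"
    by (simp only: J_add J_cmult cont continuous_on_mult_left)
  finally have "?D \<le> (M / T + 2 * M\<^sup>2) * ?N + (1 / 2) * ?D + M * ?N" by simp
  moreover have "D \<le> 2 * (X + Y)" if "D \<le> X + (1 / 2) * D + Y" for D X Y :: real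
    using that by simp
  ultimately have "?D \<le> 2 * ((M / T + 2 * M\<^sup>2) * ?N + M * ?N)" by blast
  also have "\<dots> = 2 * (M + M / T + 2 * M\<^sup>2) * ?N" by (simp add: algebra_simps)
  finally show ?thesis .
qed

lemma
  fixes f :: "'i \<Rightarrow> complex \<Rightarrow> real"
  assumes "z \<in> S" "\<And>i. i \<in> I \<Longrightarrow> sm (f i)"
  shows dx_within_lincomb_sum: "Dx (\<lambda>z. \<Sum>i\<in>I. r i * f i z) z = (\<Sum>i\<in>I. r i * Dx (f i) z)" (is ?G1)
    and dy_within_lincomb_sum: "Dy (\<lambda>z. \<Sum>i\<in>I. r i * f i z) z = (\<Sum>i\<in>I. r i * Dy (f i) z)" (is ?G2)
proof -
  have "((\<lambda>z. \<Sum>i\<in>I. r i * f i z) has_derivative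
      (\<lambda>v. \<Sum>i\<in>I. r i * (Re v *\<^sub>R Dx (f i) z + Im v *\<^sub>R Dy (f i) z))) (at z within S)"
    by (intro has_derivative_sum has_derivative_mult_right sm_has_derivative assms)
  from dx_within_eqI[OF assms(1) this] dy_within_eqI[OF assms(1) this]
  show ?G1
    ?G2 by simp_all
qed

lemma zero_if_zero_on_period:
  fixes u :: "complex \<Rightarrow> real"
  assumes L: "0 < L" and periodic: "\<And>z. z \<in> S \<Longrightarrow> u (z + of_real L) = u z"
    and zero: "\<And>z. z \<in> S \<Longrightarrow> Re z \<in> {0..L} \<Longrightarrow> u z = 0" and z: "z \<in> S"
  shows "u z = 0"
proof -
  have shift: "u (z + of_nat n * of_real L) = u z" if "z \<in> S" for n z
  proof (induction n)
    case (Suc n)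
    have "z + of_nat n * of_real L \<in> S" using that by (simp add: strip_def)
    from periodic[OF this] Suc show ?case by (simp add: algebra_simps)
  qed simp
  define k where "k = \<lfloor>Re z / L\<rfloor>"
  define z' where "z' = z - of_int k * of_real L"
  have "of_int k \<le> Re z / L" "Re z / L < of_int k + 1" by (simp_all add: k_def)
  then have "of_int k * L \<le> Re z" "Re z < of_int k * L + L" using L by (simp_all add: field_simps)
  then have z': "z' \<in> S" "Re z' \<in> {0..L}" using z by (simp_all add: z'_def strip_def)
  have "u z = u z'"
  proof (cases "0 \<le> k")
    case True
    then have "z = z' + of_nat (nat k) * of_real L" by (simp add: z'_def)
    with shift[OF z'(1), of "nat k"] show ?thesis by simp
  next
    case False
    then have "z' = z + of_nat (nat (- k)) * of_real L" by (simp add: z'_def)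
    with shift[OF z, of "nat (- k)"] show ?thesis by simp
  qed
  then show ?thesis using zero[OF z'] by simp
qed

lemma Poincare_grid:
  fixes u :: "complex \<Rightarrow> real" and m :: nat
  assumes u: "sm u" and L: "0 < L" and m: "0 < m"
    and mean: "\<And>i j. i < m \<Longrightarrow> j < m \<Longrightarrow>
      integral (cell (-T) (2 * T / m) j)
        (\<lambda>y. integral {real i * (L / m)..real (Suc i) * (L / m)} (\<lambda>x. u (Complex x y))) = 0"
  shows "J 0 L (\<lambda>z. (u z)\<^sup>2) \<le> ((L + 2 * T) / m)\<^sup>2 * J 0 L (\<lambda>z. (Dx u z)\<^sup>2 + (Dy u z)\<^sup>2)"
proof -
  let ?U2 = "\<lambda>z. (u z)\<^sup>2" and ?X2 = "\<lambda>z. (Dx u z)\<^sup>2" and ?Y2 = "\<lambda>z. (Dy u z)\<^sup>2" and ?G2 = "\<lambda>z. (Dx u z)\<^sup>2 + (Dy u z)\<^sup>2"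
  have "continuous_on S u" "continuous_on S (Dx u)" "continuous_on S (Dy u)"
    using u by (auto intro!: sm_continuous sm_intros)
  then have cont: "continuous_on S ?U2" "continuous_on S ?X2" "continuous_on S ?Y2"
    by (auto intro!: continuous_intros)
  have \<delta>: "0 < L / m" "0 < 2 * T / m" using L T_pos m by simp_all
  have part: "J 0 L F = (\<Sum>i<m. J (real i * (L / m)) (real (Suc i) * (L / m)) F)" if "continuous_on S F" for F
    using J_partition[OF that, of "L / m" 0 m] \<delta> m by simp
  let ?h = "(L + 2 * T) / m"
  have "J 0 L ?U2 = (\<Sum>i<m. J (real i * (L / m)) (real (Suc i) * (L / m)) ?U2)"
    by (rule part[OF cont(1)])
  also have "\<dots> \<le> (\<Sum>i<m. ?h\<^sup>2 * J (real i * (L / m)) (real (Suc i) * (L / m)) ?G2)"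
  proof (rule sum_mono)
    fix i assume i: "i \<in> {..<m}"
    let ?a = "real i * (L / m)" and ?b = "real (Suc i) * (L / m)"
    have "?b - ?a = L / m" by (simp only: of_nat_Suc) (simp add: algebra_simps add_divide_distrib)
    then have "J ?a ?b ?U2 \<le> (L / m)\<^sup>2 * J ?a ?b ?X2 + (2 * T / m)\<^sup>2 * J ?a ?b ?Y2"
      using Poincare_box[OF u, of ?a ?b "2 * T / m" m] \<delta> m mean i by simp
    also have "\<dots> \<le> ?h\<^sup>2 * J ?a ?b ?X2 + ?h\<^sup>2 * J ?a ?b ?Y2"
      using L T_pos cont by (intro add_mono mult_right_mono power_mono divide_right_mono J_nonneg) auto
    also have "\<dots> = ?h\<^sup>2 * J ?a ?b ?G2"
      using cont by (simp only: J_add distrib_left)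
    finally show "J ?a ?b ?U2 \<le> ?h\<^sup>2 * J ?a ?b ?G2" .
  qed
  also have "\<dots> = ?h\<^sup>2 * J 0 L ?G2"
    using cont by (simp only: part[OF continuous_on_add] sum_distrib_left)
  finally show ?thesis .
qed

lemma J_zero_imp_zero:
  fixes u :: "complex \<Rightarrow> real"
  assumes "continuous_on S u" "0 < L" "J 0 L (\<lambda>z. (u z)\<^sup>2) = 0" "z \<in> S" "Re z \<in> {0..L}"
  shows "u z = 0"
proof -
  have "box (0, -T) (L, T) \<noteq> {}" using assms(2) T_pos by (auto simp: box_ne_empty Basis_prod_def)
  moreover have "continuous_on (cbox (0, -T) (L, T)) (\<lambda>p. (u (Complex (fst p) (snd p)))\<^sup>2)"
    by (intro continuous_intros continuous_on_rectangle assms)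
  ultimately have "\<forall>p\<in>cbox (0, -T) (L, T). (u (Complex (fst p) (snd p)))\<^sup>2 = 0"
    using assms(3) unfolding J_def by (subst (asm) integral_cbox_eq_0_iff) auto
  moreover have "(Re z, Im z) \<in> cbox (0, -T) (L, T)"
    using assms(4,5) by (simp add: cbox_Pair_eq cbox_interval strip_def)
  ultimately have "(u (Complex (fst (Re z, Im z)) (snd (Re z, Im z))))\<^sup>2 = 0" by (rule bspec)
  then show ?thesis by simp
qed

text \<open>The energy estimate and the Poincare inequality on a grid of \<open>m * m\<close> cells
  are opposite bounds: on a fine grid a solution with mean zero on all cells vanishes. Among
  \<open>m * m + 1\<close> solutions some nontrivial combination has all these means equal to
  zero.\<close>

theorem jacobi_fields_dependent:
  fixes u :: "nat \<Rightarrow> complex \<Rightarrow> real" and c b :: "complex \<Rightarrow> real"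
  assumes u: "\<And>n. sm (u n)" and L: "0 < L" and periodic: "\<And>n z. z \<in> S \<Longrightarrow> u n (z + of_real L) = u n z"
    and pde: "\<And>n z. z \<in> S \<Longrightarrow> Dx (Dx (u n)) z + Dy (Dy (u n)) z = - c z * u n z"
    and bc: "\<And>n z. Im z = T \<or> Im z = - T \<Longrightarrow> Dy (u n) z = b z * u n z"
    and cM: "\<And>z. z \<in> S \<Longrightarrow> Re z \<in> {0..L} \<Longrightarrow> c z \<le> M"
    and bM: "\<And>z. z \<in> S \<Longrightarrow> Re z \<in> {0..L} \<Longrightarrow> \<bar>b z\<bar> \<le> M"
    and M: "0 \<le> M"
  obtains N r where "\<exists>n\<le>N. r n \<noteq> 0" "\<And>z. z \<in> S \<Longrightarrow> (\<Sum>n\<le>N. r n * u n z) = 0"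
proof -
  define K where "K = 2 * (M + M / T + 2 * M\<^sup>2)"
  have K: "0 \<le> K" using M T_pos by (simp add: K_def)
  \<comment> \<open>Large enough for the product of the Poincare and the energy constant,
    \<open>((L + 2 * T) / m)\<^sup>2 * K\<close>, to be below 1.\<close>
  obtain m :: nat where m: "(L + 2 * T)\<^sup>2 * K + 1 < real m" using reals_Archimedean2 by blast
  then have m1: "1 < real m" using K by (smt (verit) zero_le_mult_iff zero_le_power2)
  let ?v = "\<lambda>(i, j) n. integral (cell (-T) (2 * T / m) j)
        (\<lambda>y. integral {real i * (L / m)..real (Suc i) * (L / m)} (\<lambda>x. u n (Complex x y)))"
  \<comment> \<open>One function more than there are cells.\<close>
  have "card ({..<m} \<times> {..<m}) < card {..m * m}" by (simp add: card_cartesian_product)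
  from underdetermined_system[OF _ _ this, of ?v]
  obtain r where r: "\<exists>n\<in>{..m * m}. r n \<noteq> 0" "\<forall>p\<in>{..<m} \<times> {..<m}. (\<Sum>n\<le>m * m. r n * ?v p n) = 0"
    by auto
  define U where "U z = (\<Sum>n\<le>m * m. r n * u n z)" for z
  have U: "sm U" unfolding U_def[abs_def] by (intro sm_intros u)
  have per: "U (z + of_real L) = U z" if "z \<in> S" for z using periodic[OF that] by (simp add: U_def)
  have Ux: "Dx U z = (\<Sum>n\<le>m * m. r n * Dx (u n) z)"
    and Uy: "Dy U z = (\<Sum>n\<le>m * m. r n * Dy (u n) z)" if "z \<in> S" for z
    unfolding U_def[abs_def] using that u by (auto intro: dx_within_lincomb_sum dy_within_lincomb_sum)
  have Uxx: "Dx (Dx U) z = (\<Sum>n\<le>m * m. r n * Dx (Dx (u n)) z)" if "z \<in> S" for z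
    by (subst dx_within_cong[OF Ux that]) (auto intro!: dx_within_lincomb_sum sm_intros u that)
  have Uyy: "Dy (Dy U) z = (\<Sum>n\<le>m * m. r n * Dy (Dy (u n)) z)" if "z \<in> S" for z
    by (subst dy_within_cong[OF Uy that]) (auto intro!: dy_within_lincomb_sum sm_intros u that)
  have "J 0 L (\<lambda>z. (Dx U z)\<^sup>2 + (Dy U z)\<^sup>2) \<le> K * J 0 L (\<lambda>z. (U z)\<^sup>2)"
    unfolding K_def
  proof (rule energy_estimate[OF U L per _ _ cM bM M])
    fix z assume z: "z \<in> S"
    have "Dx (Dx U) z + Dy (Dy U) z
        = (\<Sum>n\<le>m * m. r n * (Dx (Dx (u n)) z + Dy (Dy (u n)) z))"
      using Uxx[OF z] Uyy[OF z] by (simp add: sum.distrib distrib_left)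
    also have "\<dots> = - c z * U z"
      unfolding pde[OF z] U_def sum_distrib_left by (intro sum.cong) auto
    finally show "Dx (Dx U) z + Dy (Dy U) z = - c z * U z" .
  next
    fix z assume z: "Im z = T \<or> Im z = - T"
    then have "z \<in> S" using T_pos by (auto simp: strip_def)
    then show "Dy U z = b z * U z"
      using Uy bc[OF z] by (simp add: U_def sum_distrib_left mult.left_commute)
  qed
  moreover have "J 0 L (\<lambda>z. (U z)\<^sup>2) \<le> ((L + 2 * T) / m)\<^sup>2 * J 0 L (\<lambda>z. (Dx U z)\<^sup>2 + (Dy U z)\<^sup>2)"
  proof (rule Poincare_grid[OF U L])
    fix i j assume ij: "i < m" "j < m"
    let ?X = "{real i * (L / m)..real (Suc i) * (L / m)}"
    let ?Y = "(cell (-T) (2 * T / m) j)"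
    have "real (Suc j) * (2 * T / m) \<le> real m * (2 * T / m)" using ij T_pos by (intro mult_right_mono) auto
    moreover have "0 \<le> real j * (2 * T / m)" using T_pos by simp
    ultimately have Y: "?Y \<subseteq> {-T..T}" using m1 by auto
    note cu = sm_continuous[OF u]
    have "integral ?Y (\<lambda>y. integral ?X (\<lambda>x. U (Complex x y))) = integral ?Y (\<lambda>y. \<Sum>n\<le>m * m. r n * integral ?X (\<lambda>x. u n (Complex x y)))"
    proof (rule integral_cong)
      fix y assume "y \<in> ?Y"
      then have y: "y \<in> {-T..T}" using Y by blast
      show "integral ?X (\<lambda>x. U (Complex x y)) = (\<Sum>n\<le>m * m. r n * integral ?X (\<lambda>x. u n (Complex x y)))"
        unfolding U_def
        by (subst integral_sum) (auto intro!: integrable_continuous_real continuous_intros continuous_on_horizontal[OF cu y])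
    qed
    also have "\<dots> = (\<Sum>n\<le>m * m. integral ?Y (\<lambda>y. r n * integral ?X (\<lambda>x. u n (Complex x y))))"
      by (intro integral_sum ballI finite_atMost integrable_continuous_real continuous_on_mult_left
          continuous_on_subset[OF continuous_on_inner_x[OF cu] Y])
    also have "\<dots> = (\<Sum>n\<le>m * m. r n * ?v (i, j) n)" by (simp only: integral_mult_right case_prod_conv)
    also have "\<dots> = 0" using r(2) ij by blast
    finally show "integral ?Y (\<lambda>y. integral ?X (\<lambda>x. U (Complex x y))) = 0" .
  qed (use m1 in simp)
  ultimately have "J 0 L (\<lambda>z. (U z)\<^sup>2) \<le> ((L + 2 * T) / m)\<^sup>2 * (K * J 0 L (\<lambda>z. (U z)\<^sup>2))"
    by (meson mult_left_mono order.trans zero_le_power2)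
  moreover have "((L + 2 * T) / m)\<^sup>2 * K < 1"
  proof -
    have "(L + 2 * T)\<^sup>2 * K < (real m)\<^sup>2" using m m1 by (smt (verit) power2_eq_square mult_less_cancel_right2)
    then show ?thesis using m1 by (simp add: power_divide divide_less_eq)
  qed
  moreover have J0: "0 \<le> J 0 L (\<lambda>z. (U z)\<^sup>2)"
    by (intro J_nonneg continuous_intros sm_continuous U) simp
  ultimately have "J 0 L (\<lambda>z. (U z)\<^sup>2) = 0"
    by (smt (verit) mult.assoc mult_less_cancel_right2)
  note zero = J_zero_imp_zero[OF sm_continuous[OF U] L this]
  have "U z = 0" if "z \<in> S" for z
    by (rule zero_if_zero_on_period[of L U, OF L per zero that])
  then show thesis using that[of "m * m" r] r(1) by (auto simp: U_def)
qed

end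

subsection \<open>Matrices in \<open>sl\<^sub>2\<close>\<close>

definition sl2_matrix :: "complex \<Rightarrow> complex \<Rightarrow> complex \<Rightarrow> complex^2^2" where
  "sl2_matrix a b c = a \<cdot>\<^sub>M sigma_0 + b \<cdot>\<^sub>M sigma_plus + c \<cdot>\<^sub>M sigma_minus"

lemma matrix_smult_nth [simp]: "(a \<cdot>\<^sub>M M) $ i $ j = a * M $ i $ j"
  by (simp add: matrix_smult_def map_matrix_def)

lemma sl2_matrix_nth [simp]:
  "sl2_matrix a b c $ 1 $ 1 = a" "sl2_matrix a b c $ 1 $ 2 = b"
  "sl2_matrix a b c $ 2 $ 1 = c" "sl2_matrix a b c $ 2 $ 2 = - a"
  by (simp_all add: sl2_matrix_def sigma_0_def sigma_plus_def sigma_minus_def)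

lemma matrix_eq_iff_2:
  fixes M N :: "complex^2^2"
  shows "M = N \<longleftrightarrow> M$1$1 = N$1$1 \<and> M$1$2 = N$1$2 \<and> M$2$1 = N$2$1 \<and> M$2$2 = N$2$2"
  by (auto simp: vec_eq_iff forall_2)

lemma matrix_mult_nth_2:
  fixes M N :: "complex^2^2"
  shows "(M ** N) $ i $ j = M$i$1 * N$1$j + M$i$2 * N$2$j"
  by (simp add: matrix_matrix_mult_def sum_2)

lemma sl2_eq_sl2_matrix: "M \<in> sl2 \<Longrightarrow> M = sl2_matrix (M$1$1) (M$1$2) (M$2$1)"
  by (simp add: matrix_eq_iff_2 sl2_def trace_def sum_2 eq_neg_iff_add_eq_0 add.commute)

lemma sl2_matrix_in_sl2: "sl2_matrix a b c \<in> sl2"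
  by (simp add: sl2_def trace_def sum_2)

lemma commutator_sl2_matrix:
  "commutator (sl2_matrix a b c) (sl2_matrix s u v) = sl2_matrix (b * v - u * c) (2 * (a * u - s * b)) (2 * (s * c - a * v))"
  by (simp add: matrix_eq_iff_2 commutator_def matrix_mult_nth_2 algebra_simps)

lemma conj_transpose_nth: "conj_transpose M $ i $ j = cnj (M $ j $ i)"
  by (simp add: conj_transpose_def map_matrix_def transpose_def)

lemma sklyanin_K_nth:
  "sklyanin_K A B l g $ 1 $ 1 = 4 * of_real A * g - 4 * of_real B * l"
  "sklyanin_K A B l g $ 1 $ 2 = l / g - g / l" "sklyanin_K A B l g $ 2 $ 1 = l / g - g / l"
  "sklyanin_K A B l g $ 2 $ 2 = 4 * of_real A / g - 4 * of_real B / l"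
  by (simp_all add: sklyanin_K_def)

lemma bounded_linear_matrix_smult: "bounded_linear (\<lambda>c. c \<cdot>\<^sub>M M)"
  unfolding linear_conv_bounded_linear[symmetric]
  by (rule linearI) (simp_all add: vec_eq_iff algebra_simps)

section \<open>Polynomial fields\<close>

context wide_strip
begin

lemma sm_sl2_matrix:
  assumes "sm a" "sm b" "sm c"
  shows "sm (\<lambda>z. sl2_matrix (a z) (b z) (c z))"
  unfolding sl2_matrix_def
  by (intro sm_add sm_linear[OF bounded_linear_matrix_smult] assms)

lemma polynomial_field_monomial:
  assumes f: "sm f" and M: "M \<in> sl2"
  shows "polynomial_field T (\<lambda>l g z. (f z * (l powi m * g powi n)) \<cdot>\<^sub>M M)"
proof -
  have "sm (\<lambda>z. f z \<cdot>\<^sub>M M)" by (rule sm_linear[OF bounded_linear_matrix_smult f])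
  moreover have "f z \<cdot>\<^sub>M M \<in> sl2" for z
  proof -
    have "f z * (M $ 1 $ 1 + M $ 2 $ 2) = 0" using M by (simp add: sl2_def trace_def sum_2)
    then show ?thesis by (simp add: sl2_def trace_def sum_2 distrib_left)
  qed
  moreover have "(f z * (l powi m * g powi n)) \<cdot>\<^sub>M M = (\<Sum>(m, n)\<in>{(m, n)}. (l powi m * g powi n) \<cdot>\<^sub>M f z \<cdot>\<^sub>M M)" for l g z
    by (simp add: vec_eq_iff)
  ultimately show ?thesis
    unfolding polynomial_field_def
    by (intro exI[of _ "{(m, n)}"] exI[of _ "\<lambda>_ _ z. f z \<cdot>\<^sub>M M"]) simp
qed

lemma polynomial_field_zero: "polynomial_field T (\<lambda>l g z. 0)"
  unfolding polynomial_field_def by (rule exI[of _ "{}"]) auto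

lemma polynomial_fieldE:
  assumes "polynomial_field T \<Phi>"
  obtains F C where "finite F" "\<And>m n. (m, n) \<in> F \<Longrightarrow> sm (C m n) \<and> (\<forall>z\<in>S. C m n z \<in> sl2)"
    "\<And>l g z. l \<noteq> 0 \<Longrightarrow> g \<noteq> 0 \<Longrightarrow> z \<in> S \<Longrightarrow> \<Phi> l g z = (\<Sum>(m, n)\<in>F. (l powi m * g powi n) \<cdot>\<^sub>M C m n z)"
proof -
  obtain F C where FC: "finite F \<and> (\<forall>(m, n)\<in>F. sm (C m n) \<and> (\<forall>z\<in>S. C m n z \<in> sl2)) \<and>
    (\<forall>l g. l \<noteq> 0 \<longrightarrow> g \<noteq> 0 \<longrightarrow> (\<forall>z\<in>S. \<Phi> l g z = (\<Sum>(m, n)\<in>F. (l powi m * g powi n) \<cdot>\<^sub>M C m n z)))"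
    using assms unfolding polynomial_field_def by (elim exE)
  show thesis by (rule that[of F C]) (use FC in auto)
qed

lemma polynomial_field_add:
  assumes "polynomial_field T \<Phi>" "polynomial_field T \<Psi>"
  shows "polynomial_field T (\<lambda>l g z. \<Phi> l g z + \<Psi> l g z)"
proof -
  obtain F C where F: "finite F" "\<And>m n. (m, n) \<in> F \<Longrightarrow> sm (C m n) \<and> (\<forall>z\<in>S. C m n z \<in> sl2)"
    "\<And>l g z. l \<noteq> 0 \<Longrightarrow> g \<noteq> 0 \<Longrightarrow> z \<in> S \<Longrightarrow> \<Phi> l g z = (\<Sum>(m, n)\<in>F. (l powi m * g powi n) \<cdot>\<^sub>M C m n z)"
    by (rule polynomial_fieldE[OF assms(1)], rule that) blast+
  obtain G D where G: "finite G" "\<And>m n. (m, n) \<in> G \<Longrightarrow> sm (D m n) \<and> (\<forall>z\<in>S. D m n z \<in> sl2)"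
    "\<And>l g z. l \<noteq> 0 \<Longrightarrow> g \<noteq> 0 \<Longrightarrow> z \<in> S \<Longrightarrow> \<Psi> l g z = (\<Sum>(m, n)\<in>G. (l powi m * g powi n) \<cdot>\<^sub>M D m n z)"
    by (rule polynomial_fieldE[OF assms(2)], rule that) blast+
  \<comment> \<open>The coefficients outside the own exponent set are arbitrary; they are set to 0
    before the two sets are united.\<close>
  define C' where "C' m n z = (if (m, n) \<in> F then C m n z else 0)" for m n z
  define D' where "D' m n z = (if (m, n) \<in> G then D m n z else 0)" for m n z
  have zero: "c \<cdot>\<^sub>M 0 = 0" "c \<cdot>\<^sub>M (M + N) = c \<cdot>\<^sub>M M + c \<cdot>\<^sub>M N" for c M N
    by (simp_all add: vec_eq_iff algebra_simps)
  have z: "0 \<in> sl2" "M \<in> sl2 \<Longrightarrow> N \<in> sl2 \<Longrightarrow> M + N \<in> sl2" for M N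
    by (simp_all add: sl2_def trace_add trace_def[of 0])
  have C': "sm (C' m n) \<and> (\<forall>z\<in>S. C' m n z \<in> sl2)" for m n
    using F(2)[of m n] z(1) sm_const by (cases "(m, n) \<in> F") (auto simp: C'_def[abs_def])
  have D': "sm (D' m n) \<and> (\<forall>z\<in>S. D' m n z \<in> sl2)" for m n
    using G(2)[of m n] z(1) sm_const by (cases "(m, n) \<in> G") (auto simp: D'_def[abs_def])
  have "\<Phi> l g z + \<Psi> l g z = (\<Sum>(m, n)\<in>F \<union> G. (l powi m * g powi n) \<cdot>\<^sub>M (C' m n z + D' m n z))"
    if "l \<noteq> 0" "g \<noteq> 0" "z \<in> S" for l g z
  proof -
    have "\<Phi> l g z = (\<Sum>(m, n)\<in>F \<union> G. (l powi m * g powi n) \<cdot>\<^sub>M C' m n z)"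
      unfolding F(3)[OF that]
      by (rule sum.mono_neutral_cong_left) (use F(1) G(1) zero in \<open>auto simp: C'_def\<close>)
    moreover have "\<Psi> l g z = (\<Sum>(m, n)\<in>F \<union> G. (l powi m * g powi n) \<cdot>\<^sub>M D' m n z)"
      unfolding G(3)[OF that]
      by (rule sum.mono_neutral_cong_left) (use F(1) G(1) zero in \<open>auto simp: D'_def\<close>)
    ultimately show ?thesis by (simp add: zero sum.distrib case_prod_unfold)
  qed
  then show ?thesis
    unfolding polynomial_field_def using F(1) G(1) C' D' z(2)
    by (intro exI[of _ "F \<union> G"] exI[of _ "\<lambda>m n z. C' m n z + D' m n z"]) (auto intro!: sm_add)
qed

lemma polynomial_field_sum:
  "(\<And>i. i \<in> I \<Longrightarrow> polynomial_field T (\<Phi> i)) \<Longrightarrow> polynomial_field T (\<lambda>l g z. \<Sum>i\<in>I. \<Phi> i l g z)"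
  by (induction I rule: infinite_finite_induct) (auto intro: polynomial_field_zero polynomial_field_add)

lemma polynomial_field_cong:
  assumes "polynomial_field T \<Phi>" "\<And>l g z. l \<noteq> 0 \<Longrightarrow> g \<noteq> 0 \<Longrightarrow> z \<in> S \<Longrightarrow> \<Psi> l g z = \<Phi> l g z"
  shows "polynomial_field T \<Psi>"
  using assms unfolding polynomial_field_def by simp

lemma polynomial_field_powi_sum:
  assumes f: "\<And>i. i \<in> I \<Longrightarrow> sm (f i)" and M: "M \<in> sl2"
  shows "polynomial_field T (\<lambda>l g z. (\<Sum>i\<in>I. f i z * (l powi p i * g powi q i)) \<cdot>\<^sub>M M)"
proof (rule polynomial_field_cong)
  show "polynomial_field T (\<lambda>l g z. \<Sum>i\<in>I. (f i z * (l powi p i * g powi q i)) \<cdot>\<^sub>M M)"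
    by (intro polynomial_field_sum polynomial_field_monomial f M)
  show "(\<Sum>i\<in>I. f i z * (l powi p i * g powi q i)) \<cdot>\<^sub>M M = (\<Sum>i\<in>I. (f i z * (l powi p i * g powi q i)) \<cdot>\<^sub>M M)" for l g z
    by (simp add: vec_eq_iff sum_distrib_right)
qed

lemma laplacian_wirtinger:
  fixes f :: "complex \<Rightarrow> complex"
  assumes "z \<in> S" "sm f"
  shows "Dx (Dx f) z + Dy (Dy f) z = 4 * Dz (Dzb f) z"
proof -
  have d: "sm (Dx f)" "sm (Dy f)" using assms by (auto intro: sm_intros)
  have 1: "Dzb f = (\<lambda>z. (Dx f z + \<i> * Dy f z) / 2)" by (auto simp: dzbar_within_def)
  have 2: "sm (\<lambda>z. Dx f z + \<i> * Dy f z)" by (intro sm_intros d)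
  show ?thesis
    unfolding 1 dz_divide[OF assms(1) 2]
    unfolding dz_within_def dx_within_lincomb[OF assms(1) d] mixed_partials[OF assms(2,1)]
    by (simp add: algebra_simps)
qed

end

section \<open>Killing equations in components\<close>

context sinh_gordon_solution
begin

lemma lax_z_eq: "lax_z T \<omega> l g z = sl2_matrix (Dz w z / 2) (\<i> / (4 * l) * E z) (\<i> * g / 4 * E' z)"
  unfolding lax_z_def sl2_matrix_def w_def[abs_def] E_def E'_def ..

lemma lax_zbar_eq: "lax_zbar T \<omega> l g z = sl2_matrix (- Dzb w z / 2) (\<i> / (4 * g) * E' z) (\<i> * l / 4 * E z)"
  unfolding lax_zbar_def sl2_matrix_def w_def[abs_def] E_def E'_def ..

lemma lax_form_eq: "lax_form T \<omega> l g z v = sl2_matrix (v * (Dz w z / 2) - cnj v * (Dzb w z / 2))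
    (v * (\<i> / (4 * l) * E z) + cnj v * (\<i> / (4 * g) * E' z)) (v * (\<i> * g / 4 * E' z) + cnj v * (\<i> * l / 4 * E z))"
  unfolding lax_form_def lax_z_eq lax_zbar_eq by (simp add: matrix_eq_iff_2)

lemma killing_fieldI:
  assumes sm: "\<And>l g. l \<noteq> 0 \<Longrightarrow> g \<noteq> 0 \<Longrightarrow> sm (a l g) \<and> sm (b l g) \<and> sm (c l g)"
    and eqs: "\<And>l g z. l \<noteq> 0 \<Longrightarrow> g \<noteq> 0 \<Longrightarrow> z \<in> S \<Longrightarrow>
        Dz (a l g) z = b l g z * (\<i> * g / 4 * E' z) - \<i> / (4 * l) * E z * c l g z \<and>
        Dz (b l g) z = 2 * (a l g z * (\<i> / (4 * l) * E z) - Dz w z / 2 * b l g z) \<and>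
        Dz (c l g) z = 2 * (Dz w z / 2 * c l g z - a l g z * (\<i> * g / 4 * E' z)) \<and>
        Dzb (a l g) z = b l g z * (\<i> * l / 4 * E z) - \<i> / (4 * g) * E' z * c l g z \<and>
        Dzb (b l g) z = 2 * (a l g z * (\<i> / (4 * g) * E' z) + Dzb w z / 2 * b l g z) \<and>
        Dzb (c l g) z = 2 * (- (Dzb w z / 2) * c l g z - a l g z * (\<i> * l / 4 * E z))"
  shows "killing_field T \<omega> (\<lambda>l g z. sl2_matrix (a l g z) (b l g z) (c l g z))"
  unfolding killing_field_def
proof (intro allI impI conjI ballI)
  fix l g :: complex
  assume lg: "l \<noteq> 0" "g \<noteq> 0"
  note s = sm[OF lg]
  show "sm (\<lambda>z. sl2_matrix (a l g z) (b l g z) (c l g z))" using s by (auto intro: sm_sl2_matrix)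
  fix z assume z: "z \<in> S"
  show "sl2_matrix (a l g z) (b l g z) (c l g z) \<in> sl2" by (rule sl2_matrix_in_sl2)
  note e = eqs[OF lg z]
  have "((\<lambda>z. sl2_matrix (a l g z) (b l g z) (c l g z)) has_derivative
    (\<lambda>v. sl2_matrix (Dz (a l g) z * v + Dzb (a l g) z * cnj v) (Dz (b l g) z * v + Dzb (b l g) z * cnj v)
      (Dz (c l g) z * v + Dzb (c l g) z * cnj v))) (at z within S)"
    unfolding sl2_matrix_def
    by (intro has_derivative_add bounded_linear.has_derivative[OF bounded_linear_matrix_smult])
      (use s z sm_has_wirtinger in \<open>auto simp: has_wirtinger_def\<close>)
  then show "((\<lambda>z. sl2_matrix (a l g z) (b l g z) (c l g z)) has_derivative
     (\<lambda>v. commutator (sl2_matrix (a l g z) (b l g z) (c l g z)) (lax_form T \<omega> l g z v))) (at z within S)"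
    by (rule has_derivative_eq_rhs)
      (auto simp: lax_form_eq commutator_sl2_matrix matrix_eq_iff_2 e algebra_simps)
qed

text \<open>The potentials \<open>c\<close> and \<open>b\<close> are those of the sinh-Gordon
  equation and of the Durham condition, linearised at \<open>\<omega>\<close>. There is one Jacobi
  field for each order \<open>n\<close>, so finite dimension forces a relation.\<close>

lemma jacobi_relation_exists:
  assumes L: "0 < L" "\<And>z. z \<in> S \<Longrightarrow> \<omega> (z + of_real L) = \<omega> z"
    and top: "durham_on_line T T Ap Bp \<omega>" and bottom: "durham_on_line T (- T) Am Bm \<omega>"
  obtains N r where "r N \<noteq> 0" "\<And>z. z \<in> S \<Longrightarrow> Im (\<Sum>n\<le>N. of_real (r n) * scoeff n z) = 0"
proof -
  interpret top: durham_line T \<omega> T Ap Bp using T_pos top by unfold_locales auto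
  interpret bottom: durham_line T \<omega> "- T" Am Bm using T_pos bottom by unfold_locales auto
  define u where "u n z = Im (scoeff n z)" for n z
  have s: "sm (scoeff n)" for n using sm_coeffs by blast
  have u: "sm (u n)" for n unfolding u_def[abs_def] by (intro sm_intros s)
  have per: "u n (z + of_real L) = u n z" if "z \<in> S" for n z
    using coeffs_periodic[OF L(2)] that by (simp add: u_def)
  define c where "c z = cosh (2 * \<omega> z)" for z
  \<comment> \<open>One function serves both boundary lines; between them only its bound
    matters.\<close>
  define b where "b z = (if Im z = T then Ap * exp (\<omega> z) - Bp * exp (- \<omega> z) else Am * exp (\<omega> z) - Bm * exp (- \<omega> z))" for z
  have ux: "Dx (u n) z = Im (Dx (scoeff n) z)" and uy: "Dy (u n) z = Im (Dy (scoeff n) z)"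
    if "z \<in> S" for n z
    unfolding u_def[abs_def]
    using dx_within_linear[OF bounded_linear_Im s that] dy_within_linear[OF bounded_linear_Im s that] by auto
  have pde: "Dx (Dx (u n)) z + Dy (Dy (u n)) z = - c z * u n z" if z: "z \<in> S" for n z
  proof -
    have "Dx (Dx (u n)) z = Im (Dx (Dx (scoeff n)) z)"
      using dx_within_cong[OF ux z] dx_within_linear[OF bounded_linear_Im sm_dx[OF s] z] by simp
    moreover have "Dy (Dy (u n)) z = Im (Dy (Dy (scoeff n)) z)"
      using dy_within_cong[OF uy z] dy_within_linear[OF bounded_linear_Im sm_dy[OF s] z] by simp
    ultimately have "Dx (Dx (u n)) z + Dy (Dy (u n)) z = Im (4 * Dz (Dzb (scoeff n)) z)"
      unfolding laplacian_wirtinger[OF z s, symmetric] by simp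
    also have "Dz (Dzb (scoeff n)) z = - (1 / 4) * (Ch z * scoeff n z)"
      using arg_cong[OF DZ_DZB_R[OF z], of "\<lambda>F. fps_nth F n"] by (simp add: R_nth[abs_def])
    finally show ?thesis by (simp add: u_def[of n z] c_def Ch_eq)
  qed
  have bc1: "Dy (u n) z = (A * exp (\<omega> z) - B * exp (- \<omega> z)) * u n z"
    if "durham_line T \<omega> h A B" "Im z = h" for h A B n z
  proof -
    interpret durham_line T \<omega> h A B by fact
    note zS = line_in_S[OF that(2)]
    define Y where "Y = Dz (scoeff n) z - Dzb (scoeff n) z"
    have "\<i> * (Y + cnj Y) = of_real (A * exp (\<omega> z) - B * exp (- \<omega> z)) * (scoeff n z - cnj (scoeff n z))"
      using arg_cong[OF boundary_condition_formal[OF that(2)], of "\<lambda>F. fps_nth F n"]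
      by (simp add: R_nth[abs_def] Y_def E_def E'_def)
    then have "2 * Re Y = (A * exp (\<omega> z) - B * exp (- \<omega> z)) * (2 * u n z)"
      by (auto simp: complex_eq_iff u_def)
    moreover have "Dy (u n) z = Re Y"
      unfolding uy[OF zS] dy_eq_dz_dzbar[OF zS] Y_def by simp
    ultimately show ?thesis by simp
  qed
  have bc: "Dy (u n) z = b z * u n z" if "Im z = T \<or> Im z = - T" for n z
    using that T_pos bc1[OF top.durham_line_axioms, of z n] bc1[OF bottom.durham_line_axioms, of z n]
    by (auto simp: b_def)
  obtain W where W: "0 \<le> W" "\<And>z. z \<in> S \<Longrightarrow> Re z \<in> {0..L} \<Longrightarrow> \<bar>\<omega> z\<bar> \<le> W"
  proof -
    have "compact (cbox (Complex 0 (-T)) (Complex L T))" by (rule compact_cbox)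
    moreover have box: "cbox (Complex 0 (-T)) (Complex L T) = {z. z \<in> S \<and> Re z \<in> {0..L}}"
      by (auto simp: cbox_def Basis_complex_def strip_def)
    moreover have "continuous_on (cbox (Complex 0 (-T)) (Complex L T)) \<omega>"
      by (rule continuous_on_subset[OF sm_continuous[OF sm_omega]]) (auto simp: box)
    ultimately have "bounded (\<omega> ` {z. z \<in> S \<and> Re z \<in> {0..L}})"
      by (metis compact_continuous_image compact_imp_bounded)
    then obtain W where W: "\<forall>x\<in>\<omega> ` {z. z \<in> S \<and> Re z \<in> {0..L}}. norm x \<le> W" unfolding bounded_iff by blast
    have "\<bar>\<omega> z\<bar> \<le> max 0 W" if "z \<in> S" "Re z \<in> {0..L}" for z
      using W that by (auto intro: max.coboundedI2)
    then show thesis by (intro that[of "max 0 W"]) auto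
  qed
  define M where "M = exp (2 * W) + (\<bar>Ap\<bar> + \<bar>Bp\<bar> + \<bar>Am\<bar> + \<bar>Bm\<bar>) * exp W"
  have M: "0 \<le> M" unfolding M_def by (intro add_nonneg_nonneg mult_nonneg_nonneg) auto
  have cM: "c z \<le> M" if "z \<in> S" "Re z \<in> {0..L}" for z
  proof -
    have "exp (2 * \<omega> z) \<le> exp (2 * W)" "exp (- (2 * \<omega> z)) \<le> exp (2 * W)" using W(2)[OF that] by auto
    from add_mono[OF this] have "c z \<le> exp (2 * W)"
      unfolding c_def cosh_field_def by simp
    moreover have "0 \<le> (\<bar>Ap\<bar> + \<bar>Bp\<bar> + \<bar>Am\<bar> + \<bar>Bm\<bar>) * exp W" by simp
    ultimately show ?thesis unfolding M_def by linarith
  qed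
  have bM: "\<bar>b z\<bar> \<le> M" if "z \<in> S" "Re z \<in> {0..L}" for z
  proof -
    have e: "exp (\<omega> z) \<le> exp W" "exp (- \<omega> z) \<le> exp W" using W(2)[OF that] by auto
    have "\<bar>A * exp (\<omega> z) - B * exp (- \<omega> z)\<bar> \<le> \<bar>A\<bar> * exp W + \<bar>B\<bar> * exp W" for A B :: real
    proof -
      have "\<bar>A * exp (\<omega> z) - B * exp (- \<omega> z)\<bar> \<le> \<bar>A\<bar> * exp (\<omega> z) + \<bar>B\<bar> * exp (- \<omega> z)"
        using abs_triangle_ineq4[of "A * exp (\<omega> z)" "B * exp (- \<omega> z)"] by (simp add: abs_mult)
      also have "\<dots> \<le> \<bar>A\<bar> * exp W + \<bar>B\<bar> * exp W" using e by (intro add_mono mult_left_mono) auto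
      finally show ?thesis .
    qed
    from this[of Ap Bp] this[of Am Bm] have "\<bar>b z\<bar> \<le> (\<bar>Ap\<bar> + \<bar>Bp\<bar> + \<bar>Am\<bar> + \<bar>Bm\<bar>) * exp W"
      by (auto simp: b_def distrib_right intro: order.trans)
    moreover have "0 \<le> exp (2 * W)" by simp
    ultimately show ?thesis unfolding M_def by linarith
  qed
  obtain N r where Nr: "\<exists>n\<le>N. r n \<noteq> 0" "\<And>z. z \<in> S \<Longrightarrow> (\<Sum>n\<le>N. r n * u n z) = 0"
    using jacobi_fields_dependent[of u L c b M, OF u L(1) per pde bc cM bM M] by metis
  \<comment> \<open>The relation is cut at its last nonzero coefficient, because this leading
    coefficient will show that the Killing field is nonzero.\<close>
  define N' where "N' = Max {n. n \<le> N \<and> r n \<noteq> 0}"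
  have fin: "finite {n. n \<le> N \<and> r n \<noteq> 0}" by simp
  have N': "N' \<le> N" "r N' \<noteq> 0" using Max_in[OF fin] Nr(1) by (auto simp: N'_def)
  have max: "r n = 0" if "n \<le> N" "N' < n" for n
    using Max_ge[OF fin, of n] that unfolding N'_def[symmetric] by auto
  have "Im (\<Sum>n\<le>N'. of_real (r n) * scoeff n z) = 0" if "z \<in> S" for z
  proof -
    have "Im (\<Sum>n\<le>N'. of_real (r n) * scoeff n z) = (\<Sum>n\<le>N'. r n * u n z)" by (simp add: u_def)
    also have "\<dots> = (\<Sum>n\<le>N. r n * u n z)"
      by (rule sum.mono_neutral_left) (use N' max in auto)
    finally show ?thesis using Nr(2)[OF that] by simp
  qed
  then show thesis using that[of r N'] N' by blast
qed

end

subsection \<open>The polynomial Killing field\<close>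

text \<open>
  A real relation among the Jacobi fields \<open>Im s\<^sub>n\<close> makes the coefficient of order \<open>0\<close> of the formal
  upper left entry, multiplied by the Laurent polynomial with coefficients \<open>r\<close>, real. Then the part of
  this product of nonpositive order at \<open>lam = 0\<close> can be glued to its reflection at \<open>lam = \<infinity>\<close>.
\<close>

locale jacobi_relation = sinh_gordon_solution +
  fixes N :: nat and r :: "nat \<Rightarrow> real"
  assumes r_nonzero: "r N \<noteq> 0"
    and relation: "\<And>z. z \<in> strip T \<Longrightarrow> Im (\<Sum>n\<le>N. of_real (r n) * scoeff n z) = 0"
begin

text \<open>\<open>cmb F j\<close> is the coefficient of \<open>lam ^ (- j)\<close> in the product
  of \<open>F\<close> with the polynomial in \<open>1 / lam\<close> that has the coefficients
  \<open>r\<close>; \<open>gen F x\<close> is the part of nonpositive order of this product at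
  \<open>x = 1 / lam\<close>.\<close>

definition cmb :: "complex fps \<Rightarrow> nat \<Rightarrow> complex" where
  "cmb F j = (\<Sum>n\<in>{j..N}. of_real (r n) * fps_nth F (n - j))"

definition gen :: "complex fps \<Rightarrow> complex \<Rightarrow> complex" where
  "gen F x = (\<Sum>j\<le>N. cmb F j * x ^ j)"

lemma cmb_add: "cmb (F + G) j = cmb F j + cmb G j"
  and cmb_diff: "cmb (F - G) j = cmb F j - cmb G j"
  and cmb_cmult: "cmb (fps_const a * F) j = a * cmb F j"
  and cmb_cnj: "cmb (fps_cnj F) j = cnj (cmb F j)"
  by (simp_all add: cmb_def sum.distrib sum_subtractf sum_negf distrib_left right_diff_distrib sum_distrib_left mult.left_commute)

lemma cmb_X: "cmb (fps_X * F) j = cmb F (Suc j)"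
proof -
  have "cmb (fps_X * F) j = (\<Sum>n\<in>{j..N}. of_real (r n) * (if n = j then 0 else fps_nth F (n - Suc j)))"
    unfolding cmb_def by (intro sum.cong) (auto simp: Suc_diff_le)
  also have "\<dots> = cmb F (Suc j)"
    unfolding cmb_def by (rule sum.mono_neutral_cong_right) (auto simp: not_less_eq_eq)
  finally show ?thesis .
qed

lemma gen_add: "gen (F + G) x = gen F x + gen G x"
  and gen_diff: "gen (F - G) x = gen F x - gen G x"
  and gen_cmult: "gen (fps_const a * F) x = a * gen F x"
  and gen_cnj: "gen (fps_cnj F) x = cnj (gen F (cnj x))"
  by (simp_all add: gen_def cmb_add cmb_diff cmb_cmult cmb_cnj sum.distrib sum_subtractf sum_negf
      distrib_right left_diff_distrib sum_distrib_left mult.assoc)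

lemma gen_cmult2: "gen (2 * F) x = 2 * gen F x" "gen (4 * F) x = 4 * gen F x"
  using gen_cmult[of 2 F x] gen_cmult[of 4 F x] by (simp_all add: numeral_fps_const)

text \<open>Multiplication by \<open>lam\<close> moves the term of order 0 out of the truncated
  range. This is the source of all errors of the truncation.\<close>

lemma gen_X: "x * gen (fps_X * F) x = gen F x - cmb F 0"
proof -
  have "x * gen (fps_X * F) x = (\<Sum>j\<le>N. cmb F (Suc j) * x ^ Suc j)"
    by (simp add: gen_def cmb_X sum_distrib_left mult.left_commute)
  also have "\<dots> = (\<Sum>j\<le>Suc N. cmb F j * x ^ j) - cmb F 0"
    by (subst sum.atMost_Suc_shift) simp
  also have "\<dots> = gen F x - cmb F 0" by (simp add: gen_def cmb_def)
  finally show ?thesis .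
qed

lemma sm_cmb [sm_intros]: "smf F \<Longrightarrow> sm (\<lambda>z. cmb (F z) j)"
  unfolding cmb_def[abs_def] by (intro sm_intros smf_nth)

lemma sm_gen [sm_intros]: "smf F \<Longrightarrow> sm (\<lambda>z. gen (F z) x)"
  unfolding gen_def[abs_def] by (intro sm_intros)

lemma
  assumes "z \<in> S" "smf F"
  shows Dz_cmb: "Dz (\<lambda>z. cmb (F z) j) z = cmb (DZ F z) j" and Dzb_cmb: "Dzb (\<lambda>z. cmb (F z) j) z = cmb (DZB F z) j"
  using assms by (simp_all add: cmb_def dz_sum dzbar_sum wirtinger_simps sm_intros smf_nth)

lemma
  assumes "z \<in> S" "smf F"
  shows Dz_gen: "Dz (\<lambda>z. gen (F z) x) z = gen (DZ F z) x" (is ?G1) and Dzb_gen: "Dzb (\<lambda>z. gen (F z) x) z = gen (DZB F z) x" (is ?G2)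
proof -
  have "Dz (\<lambda>z. \<Sum>j\<le>N. x ^ j * cmb (F z) j) z = (\<Sum>j\<le>N. x ^ j * cmb (DZ F z) j)"
    "Dzb (\<lambda>z. \<Sum>j\<le>N. x ^ j * cmb (F z) j) z = (\<Sum>j\<le>N. x ^ j * cmb (DZB F z) j)"
    using assms by (simp_all add: dz_sum dzbar_sum dz_cmult dzbar_cmult sm_intros Dz_cmb Dzb_cmb)
  then show ?G1 ?G2
    by (simp_all add: gen_def[abs_def] mult.commute)
qed

definition \<sigma> :: "complex \<Rightarrow> complex" where "\<sigma> z = cmb (R z) 0"

lemma sm_\<sigma> [sm_intros]: "sm \<sigma>" unfolding \<sigma>_def[abs_def] by (intro sm_intros)

lemma cnj_\<sigma>: "z \<in> S \<Longrightarrow> cnj (\<sigma> z) = \<sigma> z"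
  using relation[of z] by (simp add: complex_eq_iff \<sigma>_def cmb_def R_nth atMost_atLeast0 sum_negf)

lemma cnj_Dz_\<sigma>: "z \<in> S \<Longrightarrow> cnj (Dz \<sigma> z) = Dzb \<sigma> z"
  using dzbar_cnj[OF _ sm_\<sigma>, of z] dzbar_within_cong[of "\<lambda>z. cnj (\<sigma> z)" \<sigma> z] cnj_\<sigma> by simp

text \<open>The equations of \<open>R\<close>, \<open>Bet\<close> and \<open>Kap\<close> survive
  truncation up to terms in \<open>\<sigma>\<close>, which come from those equations that carry a
  factor \<open>fps_X\<close>.\<close>

lemma
  assumes z: "z \<in> S"
  shows Dz_gen_R: "Dz (\<lambda>z. gen (R z) x) z = x * (\<i> / 4) * (gen (Bet z) x - gen (Kap z) x) + Dz \<sigma> z" (is ?G1)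
    and Dzb_gen_R: "Dzb (\<lambda>z. gen (R z) x) z = \<i> / 4 * (E z * E z * gen (Bet z) x - E' z * E' z * gen (Kap z) x)" (is ?G2)
    and Dz_gen_Bet: "Dz (\<lambda>z. gen (Bet z) x) z = \<i> / 2 * gen (R z) x - 2 * Dz w z * gen (Bet z) x" (is ?G3)
    and Dz_gen_Kap: "Dz (\<lambda>z. gen (Kap z) x) z = 2 * Dz w z * gen (Kap z) x - \<i> / 2 * gen (R z) x" (is ?G4)
    and Dzb_gen_Bet: "x * Dzb (\<lambda>z. gen (Bet z) x) z = \<i> / 2 * (E' z * E' z) * (gen (R z) x - \<sigma> z)" (is ?G5)
    and Dzb_gen_Kap: "x * Dzb (\<lambda>z. gen (Kap z) x) z = - (\<i> / 2) * (E z * E z) * (gen (R z) x - \<sigma> z)" (is ?G6)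
proof -
  have "gen (DZ R z) x = x * gen (fps_X * DZ R z) x + cmb (DZ R z) 0" by (simp add: gen_X)
  then show ?G1
    by (simp add: z Dz_gen sm_intros X_DZ_R gen_cmult gen_diff \<sigma>_def[abs_def] Dz_cmb)
  have c: "fps_const a * fps_const b * F = fps_const (a * b) * F" for a b :: complex and F by simp
  have X: "fps_const a * (fps_X * F) = fps_X * (fps_const a * F)" for a :: complex and F by (rule mult.left_commute)
  show ?G2
    by (simp add: z Dzb_gen sm_intros DZB_R' c gen_cmult gen_diff del: fps_const_mult)
  have 2: "2 * cW z * F = fps_const (2 * Dz w z) * F" for F by (simp add: numeral_fps_const)
  show ?G3
    ?G4
    by (simp_all add: z Dz_gen sm_intros DZ_Bet DZ_Kap 2 gen_cmult gen_diff)
  show ?G5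
    by (simp only: z Dzb_gen sm_intros DZB_Bet c X gen_X gen_cmult cmb_cmult \<sigma>_def) (simp add: algebra_simps)
  have m: "- i2 = fps_const (- (\<i> / 2))" by simp
  show ?G6
    by (simp only: z Dzb_gen sm_intros DZB_Kap c X m gen_X gen_cmult cmb_cmult \<sigma>_def) (simp add: algebra_simps)
qed

text \<open>The reflection: truncated parts at \<open>1 / cnj lam\<close>, conjugated. As
  \<open>gen\<close> takes the inverse of the parameter, the argument \<open>x\<close> is
  \<open>lam\<close> itself.\<close>

definition Rm where "Rm x z = cnj (gen (R z) (cnj x))"
definition Bm where "Bm x z = cnj (gen (Bet z) (cnj x))"
definition Km where "Km x z = cnj (gen (Kap z) (cnj x))"

lemma sm_minus_parts [sm_intros]: "sm (Rm x)" "sm (Bm x)" "sm (Km x)"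
  unfolding Rm_def[abs_def] Bm_def[abs_def] Km_def[abs_def] by (intro sm_intros)+

lemma
  assumes z: "z \<in> S"
  shows Dzb_Rm: "Dzb (Rm x) z = - x * (\<i> / 4) * (Bm x z - Km x z) + Dzb \<sigma> z" (is ?G1)
    and Dz_Rm: "Dz (Rm x) z = - (\<i> / 4) * (E z * E z * Bm x z - E' z * E' z * Km x z)" (is ?G2)
    and Dzb_Bm: "Dzb (Bm x) z = - (\<i> / 2) * Rm x z - 2 * Dzb w z * Bm x z" (is ?G3)
    and Dzb_Km: "Dzb (Km x) z = 2 * Dzb w z * Km x z + \<i> / 2 * Rm x z" (is ?G4)
    and Dz_Bm: "x * Dz (Bm x) z = - (\<i> / 2) * (E' z * E' z) * (Rm x z - \<sigma> z)" (is ?G5)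
    and Dz_Km: "x * Dz (Km x) z = \<i> / 2 * (E z * E z) * (Rm x z - \<sigma> z)" (is ?G6)
proof -
  have d: "Dz (\<lambda>z. cnj (gen (F z) (cnj x))) z = cnj (Dzb (\<lambda>z. gen (F z) (cnj x)) z)"
    "Dzb (\<lambda>z. cnj (gen (F z) (cnj x))) z = cnj (Dz (\<lambda>z. gen (F z) (cnj x)) z)" if "smf F" for F
    using z that by (simp_all add: dz_cnj dzbar_cnj sm_intros)
  note c = cnj_Dz_w[OF z] cnj_Dz_\<sigma>[OF z] cnj_\<sigma>[OF z]
  show ?G1
    unfolding Rm_def[abs_def] Bm_def Km_def d(2)[OF smf_PRQ(2)] Dz_gen_R[OF z] by (simp add: c)
  show ?G2
    unfolding Rm_def[abs_def] Bm_def Km_def d(1)[OF smf_PRQ(2)] Dzb_gen_R[OF z] by (simp add: c)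
  show ?G3
    unfolding Rm_def Bm_def[abs_def] d(2)[OF smf_Bet_Kap(1)] Dz_gen_Bet[OF z] by (simp add: c)
  show ?G4
    unfolding Rm_def Km_def[abs_def] d(2)[OF smf_Bet_Kap(2)] Dz_gen_Kap[OF z] by (simp add: c)
  show ?G5
    using arg_cong[OF Dzb_gen_Bet[OF z, of "cnj x"], of cnj]
    unfolding Rm_def Bm_def[abs_def] d(1)[OF smf_Bet_Kap(1)] by (simp add: c)
  show ?G6
    using arg_cong[OF Dzb_gen_Kap[OF z, of "cnj x"], of cnj]
    unfolding Rm_def Km_def[abs_def] d(1)[OF smf_Bet_Kap(2)] by (simp add: c)
qed

text \<open>Both halves of the diagonal entry contain the coefficient of order 0, so it is
  subtracted once. Conjugate transposition of the reflected half puts \<open>Km\<close> into the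
  upper right and \<open>Bm\<close> into the lower left entry.\<close>

definition fa where "fa \<mu> z = gen (R z) (1 / \<mu>) + Rm \<mu> z - \<sigma> z"
definition fb where "fb \<mu> z = 1 / \<mu> * E z * gen (Bet z) (1 / \<mu>) + E' z * Km \<mu> z"
definition fc where "fc \<mu> z = E' z * gen (Kap z) (1 / \<mu>) + \<mu> * E z * Bm \<mu> z"

lemma sm_f [sm_intros]: "sm (fa \<mu>)" "sm (fb \<mu>)" "sm (fc \<mu>)"
  unfolding fa_def[abs_def] fb_def[abs_def] fc_def[abs_def] by (intro sm_intros)+

lemma
  assumes z: "z \<in> S" and \<mu>: "\<mu> \<noteq> 0"
  shows Dz_fa: "Dz (fa \<mu>) z = \<i> / 4 * (E' z * fb \<mu> z - E z / \<mu> * fc \<mu> z)" (is ?G1)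
    and Dz_fb: "Dz (fb \<mu>) z = \<i> / 2 * E z / \<mu> * fa \<mu> z - Dz w z * fb \<mu> z" (is ?G2)
    and Dz_fc: "Dz (fc \<mu>) z = Dz w z * fc \<mu> z - \<i> / 2 * E' z * fa \<mu> z" (is ?G3)
    and Dzb_fa: "Dzb (fa \<mu>) z = \<i> / 4 * (\<mu> * E z * fb \<mu> z - E' z * fc \<mu> z)" (is ?G4)
    and Dzb_fb: "Dzb (fb \<mu>) z = \<i> / 2 * E' z * fa \<mu> z + Dzb w z * fb \<mu> z" (is ?G5)
    and Dzb_fc: "Dzb (fc \<mu>) z = - Dzb w z * fc \<mu> z - \<i> / 2 * \<mu> * E z * fa \<mu> z" (is ?G6)
proof -
  have i: "1 / \<mu> * \<mu> = 1" "E z * E' z = 1" using \<mu> by simp_all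
  have B1: "Dz (Bm \<mu>) z = 1 / \<mu> * (- (\<i> / 2) * (E' z * E' z) * (Rm \<mu> z - \<sigma> z))"
    and K1: "Dz (Km \<mu>) z = 1 / \<mu> * (\<i> / 2 * (E z * E z) * (Rm \<mu> z - \<sigma> z))"
    using Dz_Bm[OF z, of \<mu>] Dz_Km[OF z, of \<mu>] i by algebra+
  have B2: "Dzb (\<lambda>z. gen (Bet z) (1 / \<mu>)) z = \<mu> * (\<i> / 2 * (E' z * E' z) * (gen (R z) (1 / \<mu>) - \<sigma> z))"
    and K2: "Dzb (\<lambda>z. gen (Kap z) (1 / \<mu>)) z = \<mu> * (- (\<i> / 2) * (E z * E z) * (gen (R z) (1 / \<mu>) - \<sigma> z))"
    using Dzb_gen_Bet[OF z, of "1 / \<mu>"] Dzb_gen_Kap[OF z, of "1 / \<mu>"] i by algebra+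
  note e = B1 K1 B2 K2 Dz_gen_R Dzb_gen_R Dz_gen_Bet Dz_gen_Kap Dzb_Rm Dz_Rm Dzb_Bm Dzb_Km Dz_E Dzb_E Dz_E' Dzb_E'
  have div: "x / \<mu> = 1 / \<mu> * x" for x by simp
  show ?G1 ?G2 ?G3 ?G4 ?G5 ?G6
    unfolding div[of "E z"] div[of "\<i> / 2 * E z"] fa_def[abs_def] fb_def[abs_def] fc_def[abs_def]
    by (simp_all only: wirtinger_simps z sm_intros e, insert i, algebra+)
qed

text \<open>Conjugation by a constant diagonal matrix restores the second parameter.\<close>

definition \<Phi> :: field_family where
  "\<Phi> l g z = sl2_matrix (fa (l / g) z) (1 / g * fb (l / g) z) (g * fc (l / g) z)"

lemma killing_field_\<Phi>: "killing_field T \<omega> \<Phi>"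
  unfolding \<Phi>_def[abs_def]
proof (rule killing_fieldI, goal_cases)
  case (1 l g)
  show ?case by (intro conjI sm_intros)
next
  case (2 l g z)
  then have \<mu>: "l / g \<noteq> 0" by simp
  show ?case
    unfolding dz_cmult[OF 2(3) sm_f(2)] dz_cmult[OF 2(3) sm_f(3)] dzbar_cmult[OF 2(3) sm_f(2)] dzbar_cmult[OF 2(3) sm_f(3)]
      Dz_fa[OF 2(3) \<mu>] Dz_fb[OF 2(3) \<mu>] Dz_fc[OF 2(3) \<mu>] Dzb_fa[OF 2(3) \<mu>] Dzb_fb[OF 2(3) \<mu>] Dzb_fc[OF 2(3) \<mu>]
    using 2(1,2) by (simp add: field_simps)
qed

lemma polynomial_field_\<Phi>: "polynomial_field T \<Phi>"
proof (rule polynomial_field_cong)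
  let ?R = "\<lambda>j z. cmb (R z) j" and ?B = "\<lambda>j z. E z * cmb (Bet z) j" and ?K = "\<lambda>j z. E' z * cmb (Kap z) j"
  have s: "sigma_0 \<in> sl2" "sigma_plus \<in> sl2" "sigma_minus \<in> sl2"
    by (simp_all add: sl2_def trace_def sum_2 sigma_0_def sigma_plus_def sigma_minus_def)
  let ?\<Psi> = "\<lambda>l g z. (\<Sum>j\<le>N. ?R j z * (l powi (- int j) * g powi int j)) \<cdot>\<^sub>M sigma_0
    + (\<Sum>j\<le>N. cnj (?R j z) * (l powi int j * g powi (- int j))) \<cdot>\<^sub>M sigma_0
    + (- \<sigma> z * (l powi 0 * g powi 0)) \<cdot>\<^sub>M sigma_0
    + (\<Sum>j\<le>N. ?B j z * (l powi (- int j - 1) * g powi int j)) \<cdot>\<^sub>M sigma_plus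
    + (\<Sum>j\<le>N. cnj (?K j z) * (l powi int j * g powi (- int j - 1))) \<cdot>\<^sub>M sigma_plus
    + (\<Sum>j\<le>N. ?K j z * (l powi (- int j) * g powi (int j + 1))) \<cdot>\<^sub>M sigma_minus
    + (\<Sum>j\<le>N. cnj (?B j z) * (l powi (int j + 1) * g powi (- int j))) \<cdot>\<^sub>M sigma_minus"
  show "polynomial_field T ?\<Psi>"
    by (intro polynomial_field_add polynomial_field_powi_sum polynomial_field_monomial sm_intros s)
  fix l g z :: complex assume lg: "l \<noteq> 0" "g \<noteq> 0"
  have p: "l powi (- int j) = 1 / l ^ j" "g powi (- int j) = 1 / g ^ j" "l powi int j = l ^ j" "g powi int j = g ^ j"
    "l powi (- int j - 1) = 1 / (l * l ^ j)" "g powi (- int j - 1) = 1 / (g * g ^ j)"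
    "l powi (int j + 1) = l * l ^ j" "g powi (int j + 1) = g * g ^ j" for j
    using lg by (simp_all add: power_int_minus power_int_diff power_int_add inverse_eq_divide)
  have x: "(1 / (l / g)) ^ j = g ^ j / l ^ j" "(l / g) ^ j = l ^ j / g ^ j" for j by (simp_all add: power_divide)
  show "\<Phi> l g z = ?\<Psi> l g z"
    unfolding matrix_eq_iff_2 \<Phi>_def fa_def fb_def fc_def Rm_def Bm_def Km_def gen_def p
    using lg by (simp add: sigma_0_def sigma_plus_def sigma_minus_def x sum_distrib_left sum_distrib_right
        sum_divide_distrib add_divide_distrib distrib_left power_divide sum_negf mult_ac)
qed

text \<open>The upper right entry at \<open>\<gamma> = 1\<close>, cleared of its pole at
  \<open>\<mu> = 0\<close>, takes there the value \<open>E z * r N\<close>.\<close>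

lemma nonzero_field_\<Phi>: "nonzero_field T \<Phi>"
proof -
  define z where "z = (0 :: complex)"
  have z: "z \<in> S" using T_pos by (simp add: z_def strip_def)
  define f where "f \<mu> = E z * (\<Sum>j\<le>N. cmb (Bet z) j * \<mu> ^ (N - j)) + E' z * \<mu> ^ Suc N * (\<Sum>j\<le>N. cnj (cmb (Kap z) j) * \<mu> ^ j)" for \<mu>
  have "f 0 = E z * (\<Sum>j\<le>N. if j = N then cmb (Bet z) j else 0)"
  proof -
    have "(\<Sum>j\<le>N. cmb (Bet z) j * 0 ^ (N - j)) = (\<Sum>j\<le>N. if j = N then cmb (Bet z) j else 0)"
      by (intro sum.cong) (auto simp: power_0_left)
    then show ?thesis by (simp only: f_def power_0_Suc mult_zero_right mult_zero_left add_0_right)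
  qed
  also have "\<dots> = E z * of_real (r N)" by (simp add: cmb_def Bet_Kap_0)
  finally have "f 0 \<noteq> 0" using r_nonzero by simp
  moreover have "isCont f 0" unfolding f_def by (intro continuous_intros)
  ultimately have "\<forall>\<^sub>F \<mu> in at 0. f \<mu> \<noteq> 0" by (simp add: isCont_def tendsto_imp_eventually_ne)
  then have "\<forall>\<^sub>F \<mu> in at 0. \<mu> \<noteq> 0 \<and> f \<mu> \<noteq> 0"
    using eventually_neq_at_within[of 0 0 UNIV] by (rule eventually_conj[rotated])
  then have "\<exists>\<mu>. \<mu> \<noteq> 0 \<and> f \<mu> \<noteq> 0" by (rule eventually_happens'[OF at_neq_bot])
  then obtain \<mu> where \<mu>: "\<mu> \<noteq> 0" "f \<mu> \<noteq> 0" by blast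
  have "\<mu> ^ Suc N * fb \<mu> z = f \<mu>"
  proof -
    have "\<mu> ^ Suc N * (1 / \<mu> * E z * gen (Bet z) (1 / \<mu>)) = E z * (\<Sum>j\<le>N. cmb (Bet z) j * (\<mu> ^ N * (1 / \<mu>) ^ j))"
      using \<mu>(1) by (simp add: gen_def sum_distrib_left mult_ac)
    also have "\<dots> = E z * (\<Sum>j\<le>N. cmb (Bet z) j * \<mu> ^ (N - j))"
      using \<mu>(1) by (simp add: power_diff power_one_over)
    finally show ?thesis by (simp add: fb_def f_def Km_def gen_def distrib_left mult_ac)
  qed
  then have "fb \<mu> z \<noteq> 0" using \<mu> by auto
  then have "\<Phi> \<mu> 1 z $ 1 $ 2 \<noteq> 0" by (simp add: \<Phi>_def)
  then have "\<Phi> \<mu> 1 z \<noteq> 0" by auto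
  then have "\<mu> \<noteq> 0 \<and> (1 :: complex) \<noteq> 0 \<and> (\<exists>z\<in>S. \<Phi> \<mu> 1 z \<noteq> 0)" using \<mu>(1) z one_neq_zero by blast
  then show ?thesis unfolding nonzero_field_def by blast
qed

text \<open>Truncation does not commute with the factor \<open>k\<close> of the formal Sklyanin
  relations. For the diagonal ones, \<open>R - R'\<close> is therefore written as \<open>k\<close>
  times a series \<open>G\<close>; after cancelling \<open>k\<close>, all differences are truncated
  multiples of \<open>G\<close>, and the glued fields share the factor \<open>F\<close>.\<close>

lemma sklyanin_\<Phi>:
  assumes h: "h \<in> {-T..T}" and durham: "durham_on_line T h A B \<omega>"
  shows "sklyanin_on_line h A B \<Phi>"
proof -
  interpret line: durham_line T \<omega> h A B using h durham by unfold_locales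
  \<comment> \<open>The glued field is symmetric under the reflection because
    \<open>\<sigma>\<close> is real: conjugate transposition at \<open>cnj \<mu>\<close> is
    evaluation at \<open>1 / \<mu>\<close>. The Sklyanin condition thus relates the values at
    \<open>\<mu>\<close> and \<open>1 / \<mu>\<close>.\<close>
  have star: "cnj (fa (cnj \<mu>) z) = fa (1 / \<mu>) z" "cnj (fb (cnj \<mu>) z) = fc (1 / \<mu>) z" "cnj (fc (cnj \<mu>) z) = fb (1 / \<mu>) z"
    if "z \<in> S" for \<mu> z
    using cnj_\<sigma>[OF that] by (simp_all add: fa_def fb_def fc_def Rm_def Bm_def Km_def)
  have main: "4 * (of_real A - of_real B * \<mu>) * (fa \<mu> z - fa (1 / \<mu>) z) = (\<mu> - 1 / \<mu>) * (fb (1 / \<mu>) z - fc \<mu> z)"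
      (is ?P1)
    and main2: "4 * (of_real A - of_real B / \<mu>) * (fa \<mu> z - fa (1 / \<mu>) z) = (\<mu> - 1 / \<mu>) * (fb \<mu> z - fc (1 / \<mu>) z)"
      (is ?P2)
    and main3: "(\<mu> - 1 / \<mu>) * (fa \<mu> z + fa (1 / \<mu>) z)
      = 4 * (of_real A - of_real B * \<mu>) * fb \<mu> z - 4 * (of_real A - of_real B / \<mu>) * fb (1 / \<mu>) z" (is ?P3)
    if z: "Im z = h" and \<mu>: "\<mu> \<noteq> 0" for \<mu> z
  proof -
    note zS = line.line_in_S[OF z]
    \<comment> \<open>\<open>k\<close> has constant term 1, so this quotient is again a power
      series.\<close>
    define G where "G = (R z - fps_cnj (R z)) * inverse line.k"
    have k0: "fps_nth line.k 0 \<noteq> 0" and k1: "line.k \<noteq> 0" using line.k_0 by auto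
    have kG: "R z - fps_cnj (R z) = line.k * G"
      unfolding G_def using inverse_mult_eq_1'[OF k0] by (simp add: mult.left_commute)
    have "line.k * (line.eK z - fps_cnj (line.eK z)) = line.k * (line.c * fps_X * G)"
      "line.k * (line.eB z - fps_cnj (line.eB z)) = line.k * (- line.d * fps_X * G)"
      unfolding line.sklyanin_formal_11[OF z] line.sklyanin_formal_22[OF z] kG by (simp_all add: mult_ac)
    then have eK: "line.eK z - fps_cnj (line.eK z) = line.c * fps_X * G"
      and eB: "line.eB z - fps_cnj (line.eB z) = - line.d * fps_X * G"
      unfolding mult_left_cancel[OF k1] .
    let ?a = "of_real A :: complex" and ?b = "of_real B :: complex"
    define G1 G2 where "G1 x = gen (fps_X * G) x" and "G2 x = gen (fps_X * (fps_X * G)) x" for x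
    define g0 g1 where "g0 = cmb G 0" and "g1 = cmb (fps_X * G) 0"
    have G: "x * G1 x = gen G x - g0" "x * G2 x = G1 x - g1" for x
      unfolding G1_def G2_def g0_def g1_def by (rule gen_X)+
    have D: "gen (R z) x - Rm x z = gen G x - G2 x" for x
    proof -
      have "gen (R z - fps_cnj (R z)) x = gen (G - fps_X * (fps_X * G)) x"
        unfolding kG line.k_def by (simp add: algebra_simps)
      then show ?thesis by (simp add: gen_diff gen_cnj Rm_def G2_def)
    qed
    have c: "line.c * fps_X * G = 4 * (fps_const ?a * (fps_X * G) - fps_const ?b * (fps_X * (fps_X * G)))"
      and d: "- line.d * fps_X * G = 4 * (fps_const ?b * (fps_X * G) - fps_const ?a * (fps_X * (fps_X * G)))"
      unfolding line.c_def line.d_def by algebra+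
    have K: "E' z * (gen (Kap z) x - Km x z) = 4 * (?a * G1 x - ?b * G2 x)" for x
    proof -
      have "gen (line.eK z - fps_cnj (line.eK z)) x = 4 * (?a * G1 x - ?b * G2 x)"
        unfolding eK c G1_def G2_def by (simp only: gen_cmult2 gen_diff gen_cmult)
      then show ?thesis
        by (simp add: line.eK_def gen_diff gen_cnj gen_cmult fps_cnj_mult fps_cnj_const Km_def right_diff_distrib)
    qed
    have B: "E z * (gen (Bet z) x - Bm x z) = 4 * (?b * G1 x - ?a * G2 x)" for x
    proof -
      have "gen (line.eB z - fps_cnj (line.eB z)) x = 4 * (?b * G1 x - ?a * G2 x)"
        unfolding eB d G1_def G2_def by (simp only: gen_cmult2 gen_diff gen_cmult)
      then show ?thesis
        by (simp add: line.eB_def gen_diff gen_cnj gen_cmult fps_cnj_mult fps_cnj_const Bm_def right_diff_distrib)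
    qed
    define \<nu> where "\<nu> = 1 / \<mu>"
    have \<nu>: "\<nu> * \<mu> = 1" "1 / \<nu> = \<mu>" using \<mu> by (simp_all add: \<nu>_def)
    \<comment> \<open>The terms \<open>g0\<close> cancel in the differences below, and
      \<open>g1\<close> is absorbed here.\<close>
    define F where "F = G1 \<nu> + G1 \<mu> - g1"
    have fa: "fa \<mu> z - fa \<nu> z = (\<nu> - \<mu>) * F"
      unfolding fa_def \<nu>(2) \<nu>_def[symmetric] F_def using D[of \<nu>] D[of \<mu>] G[of \<nu>] G[of \<mu>] \<nu>(1) by algebra
    have fc: "fc \<mu> z - fb \<nu> z = 4 * (?a - ?b * \<mu>) * F"
      unfolding fc_def fb_def \<nu>(2) \<nu>_def[symmetric] F_def using K[of \<nu>] B[of \<mu>] G[of \<nu>] G[of \<mu>] \<nu>(1) by algebra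
    have fb: "fc \<nu> z - fb \<mu> z = 4 * (?a - ?b * \<nu>) * F"
      unfolding fc_def fb_def \<nu>(2) \<nu>_def[symmetric] F_def using K[of \<mu>] B[of \<nu>] G[of \<nu>] G[of \<mu>] \<nu>(1) by algebra
    have div: "?b / \<mu> = ?b * \<nu>" by (simp add: \<nu>_def)
    show ?P1 ?P2 unfolding div \<nu>_def[symmetric] using fa fc fb by algebra+
    define t where "t = R z + fps_cnj (R z)"
    define eB eK' where "eB = line.eB z" and "eK' = fps_cnj (line.eK z)"
    have "t - fps_X * (fps_X * t) = line.d * eK' - line.c * eB"
      using line.sklyanin_formal_12[OF z] unfolding t_def eB_def eK'_def line.k_def by algebra
    also have "\<dots> = 4 * (fps_const ?a * (fps_X * eK') - fps_const ?b * eK' - fps_const ?a * eB + fps_const ?b * (fps_X * eB))"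
      unfolding line.d_def line.c_def by algebra
    finally have "gen (t - fps_X * (fps_X * t)) x
      = gen (4 * (fps_const ?a * (fps_X * eK') - fps_const ?b * eK' - fps_const ?a * eB + fps_const ?b * (fps_X * eB))) x" for x
      by simp
    then have rel: "gen t x - gen (fps_X * (fps_X * t)) x = 4 * (?a * gen (fps_X * eK') x - ?b * gen eK' x
        - ?a * gen eB x + ?b * gen (fps_X * eB) x)" for x
      by (simp only: gen_cmult2 gen_diff gen_add gen_cmult)
    have tv: "gen t x = gen (R z) x + Rm x z" "gen eB x = E z * gen (Bet z) x" "gen eK' x = E' z * Km x z" for x
      by (simp_all add: t_def gen_add gen_cnj Rm_def eB_def line.eB_def gen_cmult eK'_def line.eK_def fps_cnj_mult fps_cnj_const Km_def)
    \<comment> \<open>This is exactly the amount that \<open>fa \<mu> z + fa (1 / \<mu>) z\<close>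
      subtracts.\<close>
    have t0: "cmb t 0 = 2 * \<sigma> z"
      using cnj_\<sigma>[OF zS] by (simp add: t_def cmb_add cmb_cnj \<sigma>_def)
    note X = gen_X[of _ t, unfolded t0] gen_X[of _ "fps_X * t"] gen_X[of _ eB] gen_X[of _ eK']
    show ?P3
      unfolding fa_def fb_def div \<nu>(2) \<nu>_def[symmetric]
      using rel[of \<nu>] rel[of \<mu>] X(1)[of \<nu>] X(1)[of \<mu>] X(2)[of \<nu>] X(2)[of \<mu>] X(3)[of \<nu>] X(3)[of \<mu>] X(4)[of \<nu>] X(4)[of \<mu>]
        \<nu>(1) unfolding tv by algebra
  qed
  show ?thesis
    unfolding sklyanin_on_line_def
  proof (intro allI impI)
    fix z l g :: complex assume z: "Im z = h" and lg: "l \<noteq> 0" "g \<noteq> 0"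
    note zS = line.line_in_S[OF z]
    define \<mu> where "\<mu> = l / g"
    have \<mu>: "\<mu> \<noteq> 0" "l = \<mu> * g" using lg by (simp_all add: \<mu>_def)
    have cm: "cnj l / cnj g = cnj \<mu>" by (simp add: \<mu>_def)
    have main4: "(\<mu> - 1 / \<mu>) * (fa \<mu> z + fa (1 / \<mu>) z)
      = 4 * (of_real A - of_real B * \<mu>) * fc (1 / \<mu>) z - 4 * (of_real A - of_real B / \<mu>) * fc \<mu> z"
    proof -
      have "cnj (fb (1 / cnj \<mu>) z) = fc \<mu> z" "cnj (fa (1 / cnj \<mu>) z) = fa \<mu> z"
        using star(1,2)[OF zS, of "1 / \<mu>"] by simp_all
      then show ?thesis
        using arg_cong[OF main3[OF z, of "cnj \<mu>"], of cnj] \<mu>(1) star[OF zS, of \<mu>] by (simp add: add.commute)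
    qed
    have K: "4 * of_real A * g - 4 * of_real B * l = 4 * (of_real A - of_real B * \<mu>) * g"
      "g / l = 1 / \<mu>" "4 * of_real A / g - 4 * of_real B / l = 4 * (of_real A - of_real B / \<mu>) * (1 / g)"
      using lg by (simp_all add: \<mu>_def field_simps)
    define k1 k2 k3 where "k1 = 4 * (complex_of_real A - of_real B * \<mu>)" and "k2 = \<mu> - 1 / \<mu>"
      and "k3 = 4 * (complex_of_real A - of_real B / \<mu>)"
    note k = k1_def[symmetric] k2_def[symmetric] k3_def[symmetric]
    have g: "1 / g * g = 1" using lg by simp
    note m = main[OF z \<mu>(1)] main2[OF z \<mu>(1)] main3[OF z \<mu>(1)] main4
    show "sklyanin_K A B l g ** \<Phi> l g z = conj_transpose (\<Phi> (cnj l) (cnj g) z) ** sklyanin_K A B l g"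
      unfolding matrix_eq_iff_2 matrix_mult_nth_2 conj_transpose_nth sklyanin_K_nth \<Phi>_def cm \<mu>_def[symmetric] sl2_matrix_nth
        complex_cnj_mult complex_cnj_divide complex_cnj_one complex_cnj_cnj complex_cnj_minus star[OF zS] K k
      using m[unfolded k] g by (intro conjI; algebra)
  qed
qed

end

subsection \<open>From a Killing field to the boundary condition\<close>

text \<open>Gronwall's argument: \<open>exp (- 2 * K * t)\<close> times the squared norm has
  nonpositive derivative, so one application of the mean value theorem suffices.\<close>

lemma linear_ode_zero:
  fixes \<phi> :: "real \<Rightarrow> 'a::real_inner"
  assumes deriv: "\<And>t. t \<in> {0..1} \<Longrightarrow> (\<phi> has_vector_derivative \<phi>' t) (at t within {0..1})"
    and bound: "\<And>t. t \<in> {0..1} \<Longrightarrow> norm (\<phi>' t) \<le> K * norm (\<phi> t)" and zero: "\<phi> 0 = 0"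
  shows "\<phi> 1 = 0"
proof -
  define n where "n t = exp (- 2 * K * t) * (\<phi> t \<bullet> \<phi> t)" for t
  define n' where "n' t = exp (- 2 * K * t) * (2 * (\<phi> t \<bullet> \<phi>' t) - 2 * K * (\<phi> t \<bullet> \<phi> t))" for t
  have "(n has_derivative (\<lambda>s. s * n' t)) (at t within {0..1})" if t: "t \<in> {0..1}" for t
    unfolding n_def n'_def
    using deriv[OF t, unfolded has_vector_derivative_def]
    by (auto intro!: derivative_eq_intros simp: algebra_simps inner_commute)
  then have "\<exists>t\<in>{0<..<1}. n 1 - n 0 = (1 - 0) * n' t"
    by (intro mvt_simple) auto
  then obtain t where t: "t \<in> {0<..<1}" "n 1 - n 0 = n' t" by auto
  have "\<phi> t \<bullet> \<phi>' t \<le> norm (\<phi> t) * norm (\<phi>' t)" by (rule norm_cauchy_schwarz)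
  also have "\<dots> \<le> norm (\<phi> t) * (K * norm (\<phi> t))" using t bound by (intro mult_left_mono) auto
  also have "\<dots> = K * (\<phi> t \<bullet> \<phi> t)" by (simp add: dot_square_norm power2_eq_square)
  finally have "n' t \<le> 0" unfolding n'_def by (intro mult_nonneg_nonpos) auto
  then have "n 1 \<le> 0" using t zero by (simp add: n_def)
  moreover have "0 < exp (- 2 * K * 1)" by simp
  ultimately show ?thesis unfolding n_def by (metis inner_eq_zero_iff inner_ge_zero mult_pos_pos not_less order_le_less)
qed

lemma scaleR_matrix_nth: "(r *\<^sub>R (M :: complex^2^2)) $ i $ j = of_real r * M $ i $ j"
  unfolding vector_scaleR_component by (rule scaleR_conv_of_real)

lemma scaleR_sl2_matrix: "r *\<^sub>R sl2_matrix a b c = sl2_matrix (of_real r * a) (of_real r * b) (of_real r * c)"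
  unfolding matrix_eq_iff_2 scaleR_matrix_nth sl2_matrix_nth by simp

lemma bounded_bilinear_commutator: "bounded_bilinear commutator"
proof -
  have "bilinear commutator"
    unfolding bilinear_def commutator_def
    by (intro conjI allI linearI; simp add: matrix_eq_iff_2 matrix_mult_nth_2 scaleR_matrix_nth algebra_simps)
  then show ?thesis by (simp add: bilinear_conv_bounded_bilinear)
qed

context sinh_gordon_solution
begin

text \<open>The strip is convex, and along the segment from \<open>z0\<close> to \<open>z1\<close>
  the Killing equation is a linear differential equation with bounded coefficients.\<close>

lemma killing_field_zero:
  assumes "killing_field T \<omega> \<Phi>" "l \<noteq> 0" "g \<noteq> 0" and z0: "z0 \<in> S" "\<Phi> l g z0 = 0" and z1: "z1 \<in> S"
  shows "\<Phi> l g z1 = 0"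
proof -
  have deriv: "(\<Phi> l g has_derivative (\<lambda>v. commutator (\<Phi> l g z) (lax_form T \<omega> l g z v))) (at z within S)"
    if "z \<in> S" for z using assms(1-3) that by (auto simp: killing_field_def)
  define \<zeta> where "\<zeta> t = z0 + of_real t * (z1 - z0)" for t
  define M \<phi> where "M t = lax_form T \<omega> l g (\<zeta> t) (z1 - z0)" and "\<phi> t = \<Phi> l g (\<zeta> t)" for t
  have \<zeta>: "\<zeta> t \<in> S" if "t \<in> {0..1}" for t
  proof -
    have "Im (\<zeta> t) = (1 - t) * Im z0 + t * Im z1" by (simp add: \<zeta>_def algebra_simps)
    moreover have "(1 - t) * Im z0 + t * Im z1 \<le> (1 - t) * T + t * T" "(1 - t) * (- T) + t * (- T) \<le> (1 - t) * Im z0 + t * Im z1"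
      using that z0 z1 by (intro add_mono mult_left_mono; auto simp: strip_def)+
    ultimately show ?thesis by (simp add: strip_def algebra_simps)
  qed
  have sm_lax: "sm (\<lambda>z. lax_form T \<omega> l g z (z1 - z0))"
    unfolding lax_form_eq by (intro sm_sl2_matrix sm_intros)
  have "continuous_on {0..1} M"
    unfolding M_def[abs_def]
    by (rule continuous_on_compose2[OF sm_continuous[OF sm_lax]])
      (use \<zeta> in \<open>auto simp: \<zeta>_def[abs_def] intro!: continuous_intros\<close>)
  then have "bounded (M ` {0..1})"
    by (intro compact_imp_bounded compact_continuous_image compact_Icc)
  then obtain C where C: "\<And>t. t \<in> {0..1} \<Longrightarrow> norm (M t) \<le> C"
    unfolding bounded_iff by blast
  obtain K where K: "0 \<le> K" "\<And>X Y. norm (commutator X Y) \<le> norm X * norm Y * K"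
    using bounded_bilinear.nonneg_bounded[OF bounded_bilinear_commutator] by blast
  have "\<phi> 1 = 0"
  proof (rule linear_ode_zero[where \<phi> = \<phi>])
    fix t :: real assume t: "t \<in> {0..1}"
    have "(\<zeta> has_derivative (\<lambda>s. of_real s * (z1 - z0))) (at t within {0..1})"
      unfolding \<zeta>_def[abs_def] by (auto intro!: derivative_eq_intros)
    moreover have "(\<Phi> l g has_derivative (\<lambda>v. commutator (\<Phi> l g (\<zeta> t)) (lax_form T \<omega> l g (\<zeta> t) v))) (at (\<zeta> t) within \<zeta> ` {0..1})"
      by (rule has_derivative_subset[OF deriv[OF \<zeta>[OF t]]]) (use \<zeta> in auto)
    ultimately have 1: "(\<phi> has_derivative (\<lambda>s. commutator (\<Phi> l g (\<zeta> t)) (lax_form T \<omega> l g (\<zeta> t) (of_real s * (z1 - z0))))) (at t within {0..1})"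
      unfolding \<phi>_def[abs_def] by (rule has_derivative_in_compose)
    interpret bounded_bilinear commutator by (rule bounded_bilinear_commutator)
    have 2: "lax_form T \<omega> l g (\<zeta> t) (of_real s * (z1 - z0)) = s *\<^sub>R M t" for s
      unfolding M_def lax_form_eq scaleR_sl2_matrix by (simp add: algebra_simps)
    show "(\<phi> has_vector_derivative commutator (\<phi> t) (M t)) (at t within {0..1})"
      using 1 unfolding has_vector_derivative_def 2 scaleR_right \<phi>_def[of t] .
    have "norm (commutator (\<phi> t) (M t))
        \<le> norm (\<phi> t) * norm (M t) * K" by (rule K)
    also have "\<dots> \<le> norm (\<phi> t) * C * K" using C[OF t] K by (intro mult_right_mono mult_left_mono) auto
    finally show "norm (commutator (\<phi> t) (M t)) \<le> (C * K) * norm (\<phi> t)"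
      by (simp add: mult_ac)
  qed (simp add: \<phi>_def \<zeta>_def z0)
  then show ?thesis by (simp add: \<phi>_def \<zeta>_def)
qed

text \<open>Local form of \<open>dx_within_zero_on_line\<close>, for relations that are known only
  near a point where the Durham condition fails.\<close>

lemma dx_within_zero_near:
  fixes f :: "complex \<Rightarrow> complex"
  assumes f: "sm f" and z0: "Im z0 \<in> {-T..T}" and "0 < \<epsilon>"
    and zero: "\<And>z. Im z = Im z0 \<Longrightarrow> dist z z0 < \<epsilon> \<Longrightarrow> f z = 0"
  shows "Dx f z0 = 0"
proof -
  have "((\<lambda>x. f (Complex x (Im z0))) has_vector_derivative Dx f (Complex (Re z0) (Im z0))) (at (Re z0))"
    by (rule vderiv_x[OF f z0])
  then have "((\<lambda>x. 0) has_vector_derivative Dx f (Complex (Re z0) (Im z0))) (at (Re z0))"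
  proof (rule has_vector_derivative_transform_within_open)
    show "open (ball (Re z0) \<epsilon>)" "Re z0 \<in> ball (Re z0) \<epsilon>" using assms(3) by auto
    fix x assume "x \<in> ball (Re z0) \<epsilon>"
    then have "dist (Complex x (Im z0)) z0 < \<epsilon>"
      by (simp add: dist_complex_def cmod_def dist_real_def dist_commute)
    then show "f (Complex x (Im z0)) = 0" using zero by simp
  qed
  then have "Dx f (Complex (Re z0) (Im z0)) = 0"
    using has_vector_derivative_const vector_derivative_unique_at by blast
  then show ?thesis by simp
qed

text \<open>The polynomial \<open>lam\<^sup>3 (k\<^sub>3\<^sup>2 v + k\<^sub>1 k\<^sub>3 u - 2 k\<^sub>2\<^sup>2 u + 2 k\<^sub>2 k\<^sub>3 s)\<close> does not vanish at \<open>lam = 0\<close>.\<close>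

lemma finite_exceptional:
  fixes A B s g p q :: complex
  assumes g: "g \<noteq> 0" and p: "p \<noteq> 0"
  defines "k1 \<equiv> \<lambda>l. 4 * A * g - 4 * B * l" and "k2 \<equiv> \<lambda>l. l / g - g / l" and "k3 \<equiv> \<lambda>l. 4 * A / g - 4 * B / l"
    and "u \<equiv> \<lambda>l. \<i> / (4 * l) * p + \<i> / (4 * g) * q" and "v \<equiv> \<lambda>l. \<i> * g / 4 * q + \<i> * l / 4 * p"
  shows "finite {l. l \<noteq> 0 \<and> (k3 l)\<^sup>2 * v l + k1 l * k3 l * u l - 2 * (k2 l)\<^sup>2 * u l + 2 * k2 l * k3 l * s = 0}"
proof -
  define K1 K2 K3 where "K1 = [:4 * A * g, - 4 * B:]" and "K2 = [:- g, 0, 1 / g:]" and "K3 = [:- 4 * B, 4 * A / g:]"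
  define Up Vp where "Up = [:\<i> / 4 * p, \<i> / 4 * q / g:]" and "Vp = [:\<i> * g / 4 * q, \<i> / 4 * p:]"
  define P where "P = [:0, 1:] * (K3 * K3 * Vp + K1 * K3 * Up + smult (2 * s) (K2 * K3)) - smult 2 (K2 * K2 * Up)"
  have "poly P 0 = - 2 * (g * g * (\<i> / 4 * p))" by (simp add: P_def K2_def Up_def)
  then have "P \<noteq> 0" using g p by auto
  then have fin: "finite {l. poly P l = 0}" by (rule poly_roots_finite)
  have "poly P l = l ^ 3 * ((k3 l)\<^sup>2 * v l + k1 l * k3 l * u l - 2 * (k2 l)\<^sup>2 * u l + 2 * k2 l * k3 l * s)" if "l \<noteq> 0" for l
  proof -
    have "poly K1 l = k1 l" "poly K2 l = l * k2 l" "poly K3 l = l * k3 l" "poly Up l = l * u l" "poly Vp l = v l"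
      using that g by (simp_all add: K1_def K2_def K3_def Up_def Vp_def k1_def k2_def k3_def u_def v_def field_simps)
    then show ?thesis by (simp add: P_def power2_eq_square power3_eq_cube algebra_simps)
  qed
  then show ?thesis by (intro rev_finite_subset[OF fin]) auto
qed

lemma
  assumes "killing_field T \<omega> \<Phi>" "l \<noteq> 0" "g \<noteq> 0"
  shows sm_killing_nth: "sm (\<lambda>z. \<Phi> l g z $ i $ j)" (is ?G1)
    and dx_killing_nth: "z \<in> S \<Longrightarrow> Dx (\<lambda>z. \<Phi> l g z $ i $ j) z
      = commutator (\<Phi> l g z) (sl2_matrix ((Dz w z - Dzb w z) / 2) (\<i> / (4 * l) * E z + \<i> / (4 * g) * E' z)
          (\<i> * g / 4 * E' z + \<i> * l / 4 * E z)) $ i $ j"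
    and killing_trace: "z \<in> S \<Longrightarrow> \<Phi> l g z = sl2_matrix (\<Phi> l g z $ 1 $ 1) (\<Phi> l g z $ 1 $ 2) (\<Phi> l g z $ 2 $ 1)"
proof -
  have nth: "bounded_linear (\<lambda>M :: complex^2^2. M $ i $ j)"
    using bounded_linear_compose[OF bounded_linear_vec_nth bounded_linear_vec_nth] .
  have sm: "sm (\<Phi> l g)" using assms by (simp add: killing_field_def)
  show ?G1 by (rule sm_linear[OF nth sm])
  {
    assume z: "z \<in> S"
    have "Dx (\<lambda>z. \<Phi> l g z $ i $ j) z = Dx (\<Phi> l g) z $ i $ j" by (rule dx_within_linear[OF nth sm z])
    also have "Dx (\<Phi> l g) z = commutator (\<Phi> l g z) (lax_form T \<omega> l g z 1)"
      by (rule dx_within_eqI[OF z]) (use assms z in \<open>simp add: killing_field_def\<close>)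
    finally show "Dx (\<lambda>z. \<Phi> l g z $ i $ j) z
      = commutator (\<Phi> l g z) (sl2_matrix ((Dz w z - Dzb w z) / 2) (\<i> / (4 * l) * E z + \<i> / (4 * g) * E' z)
          (\<i> * g / 4 * E' z + \<i> * l / 4 * E z)) $ i $ j"
      by (simp add: lax_form_eq diff_divide_distrib)
    show "\<Phi> l g z = sl2_matrix (\<Phi> l g z $ 1 $ 1) (\<Phi> l g z $ 1 $ 2) (\<Phi> l g z $ 2 $ 1)"
      using assms z by (intro sl2_eq_sl2_matrix) (simp add: killing_field_def)
  }
qed

lemma dx_lincomb4:
  fixes f1 f2 f3 f4 :: "complex \<Rightarrow> complex"
  assumes "z \<in> S" "sm f1" "sm f2" "sm f3" "sm f4"
  shows "Dx (\<lambda>z. c1 * f1 z + c2 * f2 z + c3 * f3 z + c4 * f4 z) z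
    = c1 * Dx f1 z + c2 * Dx f2 z + c3 * Dx f3 z + c4 * Dx f4 z"
  by (simp add: assms dx_eq_dz_dzbar wirtinger_simps sm_intros) (simp add: algebra_simps)

lemma durham_if_sklyanin:
  assumes h: "h \<in> {-T..T}" and killing: "killing_field T \<omega> \<Phi>" and poly: "polynomial_field T \<Phi>"
    and nonzero: "nonzero_field T \<Phi>" and sklyanin: "sklyanin_on_line h A B \<Phi>"
  shows "durham_on_line T h A B \<omega>"
proof (rule ccontr)
  define \<delta> where "\<delta> z = \<i> * (Dz w z - Dzb w z) - (of_real A * E z + of_real B * E' z)" for z
  have line: "z \<in> S" if "Im z = h" for z using that h by (auto simp: strip_def)
  have \<delta>_eq: "\<delta> z = of_real (Dy \<omega> z - (A * exp (\<omega> z) + B * exp (- \<omega> z)))" if "z \<in> S" for z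
  proof -
    have "Dy w z = of_real (Dy \<omega> z)"
      unfolding w_def[abs_def] by (rule dy_within_linear[OF bounded_linear_of_real sm_omega that])
    then show ?thesis using dy_eq_dz_dzbar[OF that, of w] by (simp add: \<delta>_def E_def E'_def)
  qed
  assume "\<not> durham_on_line T h A B \<omega>"
  then obtain z0 where z0: "Im z0 = h" "Dy \<omega> z0 - (A * exp (\<omega> z0) + B * exp (- \<omega> z0)) \<noteq> 0"
    by (auto simp: durham_on_line_def)
  then have "\<delta> z0 \<noteq> 0" unfolding \<delta>_eq[OF line[OF z0(1)]] of_real_eq_0_iff by blast
  note z0 = z0(1) this
  have "sm \<delta>" unfolding \<delta>_def[abs_def] by (intro sm_intros)
  then obtain \<epsilon> where \<epsilon>: "0 < \<epsilon>" "\<And>z. z \<in> S \<Longrightarrow> dist z z0 < \<epsilon> \<Longrightarrow> \<delta> z \<noteq> 0"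
    using continuous_on_avoid[OF sm_continuous[of \<delta>] line[OF z0(1)] z0(2)] by (metis dist_commute)
  \<comment> \<open>The factor of the upper left entry \<open>a\<close> that remains when
    \<open>k2 * b = k3 * a\<close> is differentiated along the line, multiplied by
    \<open>k2\<close>, and rid of \<open>b\<close> and \<open>c\<close> by the two relations
    \<open>rel\<close> below.\<close>
  define exceptional where "exceptional g l = (4 * of_real A / g - 4 * of_real B / l)\<^sup>2 * (\<i> * g / 4 * E' z0 + \<i> * l / 4 * E z0)
        + (4 * of_real A * g - 4 * of_real B * l) * (4 * of_real A / g - 4 * of_real B / l) * (\<i> / (4 * l) * E z0 + \<i> / (4 * g) * E' z0)
        - 2 * (l / g - g / l)\<^sup>2 * (\<i> / (4 * l) * E z0 + \<i> / (4 * g) * E' z0)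
        + 2 * (l / g - g / l) * (4 * of_real A / g - 4 * of_real B / l) * ((Dz w z0 - Dzb w z0) / 2)" for g l
  have zero: "\<Phi> l g z0 = 0"
    if l: "l \<noteq> 0" and g: "g \<noteq> 0" and k2_nonzero: "l / g - g / l \<noteq> 0"
      and exc: "exceptional g l \<noteq> 0" for l g
  proof -
    define k1 k2 k3 where "k1 = 4 * complex_of_real A * g - 4 * of_real B * l" and "k2 = l / g - g / l"
      and "k3 = 4 * complex_of_real A / g - 4 * of_real B / l"
    define s u v where "s z = (Dz w z - Dzb w z) / 2" and "u z = \<i> / (4 * l) * E z + \<i> / (4 * g) * E' z"
      and "v z = \<i> * g / 4 * E' z + \<i> * l / 4 * E z" for z
    define a b c where "a z = \<Phi> l g z $ 1 $ 1" and "b z = \<Phi> l g z $ 1 $ 2" and "c z = \<Phi> l g z $ 2 $ 1" for z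
    define a' b' c' where "a' z = cnj (\<Phi> (cnj l) (cnj g) z $ 1 $ 1)" and "b' z = cnj (\<Phi> (cnj l) (cnj g) z $ 1 $ 2)"
      and "c' z = cnj (\<Phi> (cnj l) (cnj g) z $ 2 $ 1)" for z
    have lg': "cnj l \<noteq> 0" "cnj g \<noteq> 0" using l g by simp_all
    have sm: "sm a" "sm b" "sm c" "sm a'" "sm b'" "sm c'"
      unfolding a_def[abs_def] b_def[abs_def] c_def[abs_def] a'_def[abs_def] b'_def[abs_def] c'_def[abs_def]
      by (intro sm_cnj sm_killing_nth[OF killing] l g lg')+
    note tr = killing_trace[OF killing l g] and tr' = killing_trace[OF killing lg']
    have \<Phi>: "\<Phi> l g z = sl2_matrix (a z) (b z) (c z)" if "z \<in> S" for z
      using tr[OF that] by (simp add: a_def b_def c_def)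
    have \<Phi>': "\<Phi> (cnj l) (cnj g) z = sl2_matrix (cnj (a' z)) (cnj (b' z)) (cnj (c' z))" if "z \<in> S" for z
      using tr'[OF that] by (simp add: a'_def b'_def c'_def)
    have dx: "Dx a z = b z * v z - u z * c z" "Dx b z = 2 * (a z * u z - s z * b z)"
      "Dx c z = 2 * (s z * c z - a z * v z)" if "z \<in> S" for z
      unfolding a_def[abs_def] b_def[abs_def] c_def[abs_def] dx_killing_nth[OF killing l g that]
      unfolding \<Phi>[OF that] commutator_sl2_matrix sl2_matrix_nth s_def u_def v_def by simp_all
    have dxc: "Dx (\<lambda>z. cnj (f z)) z = cnj (Dx f z)" if "z \<in> S" "sm f" for f :: "complex \<Rightarrow> complex" and z
      by (rule dx_within_linear[OF bounded_linear_cnj that(2,1)])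
    have dx': "Dx a' z = - (b' z * v z - u z * c' z)" (is ?H1) "Dx b' z = - 2 * (a' z * u z - s z * b' z)" (is ?H2)
      "Dx c' z = - 2 * (s z * c' z - a' z * v z)" (is ?H3) if z: "z \<in> S" for z
    proof -
      have cs: "cnj ((Dz w z - Dzb w z) / 2) = - s z"
        using cnj_Dz_w[OF z] cnj_Dz_w[OF z, symmetric] by (simp add: s_def field_simps)
      have cu: "cnj (\<i> / (4 * cnj l) * E z + \<i> / (4 * cnj g) * E' z) = - u z"
        "cnj (\<i> * cnj g / 4 * E' z + \<i> * cnj l / 4 * E z) = - v z" by (simp_all add: u_def v_def)
      show ?H1 ?H2
        ?H3
        unfolding a'_def[abs_def] b'_def[abs_def] c'_def[abs_def] dxc[OF z sm_killing_nth[OF killing lg']] dx_killing_nth[OF killing lg' z]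
        unfolding \<Phi>'[OF z] commutator_sl2_matrix sl2_matrix_nth complex_cnj_mult complex_cnj_diff complex_cnj_numeral cs cu
          complex_cnj_cnj by simp_all
    qed
    have skl: "k1 * a z + k2 * c z = a' z * k1 + c' z * k2" (is ?H1) "k1 * b z - k2 * a z = a' z * k2 + c' z * k3" (is ?H2)
      "k2 * a z + k3 * c z = b' z * k1 - a' z * k2" (is ?H3) "k2 * b z - k3 * a z = b' z * k2 - a' z * k3" (is ?H4) if z: "Im z = h" for z
    proof -
      have "sklyanin_K A B l g ** \<Phi> l g z = conj_transpose (\<Phi> (cnj l) (cnj g) z) ** sklyanin_K A B l g"
        using sklyanin z l g by (simp add: sklyanin_on_line_def)
      then show ?H1 ?H2
        ?H3 ?H4
        unfolding \<Phi>[OF line[OF z]] \<Phi>'[OF line[OF z]] matrix_eq_iff_2 matrix_mult_nth_2 conj_transpose_nth sklyanin_K_nth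
          sl2_matrix_nth k1_def[symmetric] k2_def[symmetric] k3_def[symmetric] by simp_all
    qed
    \<comment> \<open>The left side is the multiplier \<open>m\<close> in
      \<open>K \<alpha> + \<alpha>\<^sup>* K = m J\<close>; near \<open>z0\<close> it is nonzero as
      soon as \<open>k2\<close> is.\<close>
    have m: "k1 * u z - 2 * k2 * s z - k3 * v z = \<i> * k2 * \<delta> z" for z
      using l g unfolding k1_def k2_def k3_def u_def s_def v_def \<delta>_def by (simp add: field_simps)
    \<comment> \<open>Differentiating the Sklyanin relations along the line yields the multiplier
      times the sum of the field and its entrywise conjugate, so this sum vanishes.\<close>
    have anti: "a' z = - a z" (is ?H1) "b' z = - b z" (is ?H2) "c' z = - c z" (is ?H3) if z: "Im z = h" "dist z z0 < \<epsilon>" for z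
    proof -
      note zS = line[OF z(1)]
      have zero: "Dx (\<lambda>z. c1 * f1 z + c2 * f2 z + c3 * f3 z + c4 * f4 z) z = 0"
        if "\<And>z. Im z = h \<Longrightarrow> c1 * f1 z + c2 * f2 z + c3 * f3 z + c4 * f4 z = 0" "sm f1" "sm f2" "sm f3" "sm f4" for f1 f2 f3 f4 and c1 c2 c3 c4 :: complex
        by (rule dx_within_zero_on_line[OF _ h that(1) z(1)]) (intro sm_intros that)
      have d1: "k1 * Dx a z + k2 * Dx c z + - k1 * Dx a' z + - k2 * Dx c' z = 0"
        unfolding dx_lincomb4[OF zS sm(1,3,4,6), symmetric] by (rule zero) (use skl sm in \<open>auto simp: algebra_simps\<close>)
      have d2: "k1 * Dx b z + - k2 * Dx a z + - k2 * Dx a' z + - k3 * Dx c' z = 0"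
        unfolding dx_lincomb4[OF zS sm(2,1,4,6), symmetric] by (rule zero) (use skl sm in \<open>auto simp: algebra_simps\<close>)
      have d4: "k2 * Dx b z + - k3 * Dx a z + - k2 * Dx b' z + k3 * Dx a' z = 0"
        unfolding dx_lincomb4[OF zS sm(2,1,5,4), symmetric] by (rule zero) (use skl sm in \<open>auto simp: algebra_simps\<close>)
      have "(k1 * u z - 2 * k2 * s z - k3 * v z) * (c z + c' z) = 0" "(k1 * u z - 2 * k2 * s z - k3 * v z) * (a z + a' z) = 0"
        "(k1 * u z - 2 * k2 * s z - k3 * v z) * (b z + b' z) = 0"
        using d1 d2 d4 skl[OF z(1)] unfolding dx[OF zS] dx'[OF zS] by algebra+
      moreover have "k1 * u z - 2 * k2 * s z - k3 * v z \<noteq> 0"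
        unfolding m using \<epsilon>(2)[OF zS z(2)] k2_nonzero by (simp add: k2_def)
      ultimately have "c z + c' z = 0" "a z + a' z = 0" "b z + b' z = 0" by simp_all
      then show ?H1 ?H2 ?H3 by (simp_all add: eq_neg_iff_add_eq_0 add.commute)
    qed
    \<comment> \<open>By the antisymmetry, these Sklyanin relations equate an expression with its
      own negative.\<close>
    have rel: "k1 * a z + k2 * c z = 0" (is ?H1) "k2 * b z - k3 * a z = 0" (is ?H2) if "Im z = h" "dist z z0 < \<epsilon>" for z
    proof -
      have "2 * (k1 * a z + k2 * c z) = 0" "2 * (k2 * b z - k3 * a z) = 0"
        using skl[OF that(1)] anti[OF that] by algebra+
      then show ?H1 ?H2 unfolding mult_eq_0_iff by simp_all
    qed
    note z0S = line[OF z0(1)]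
    have z0_near: "dist z0 z0 < \<epsilon>" using \<epsilon>(1) by simp
    have "Dx (\<lambda>z. k2 * b z + - k3 * a z + 0 * a z + 0 * a z) z0 = 0"
      by (rule dx_within_zero_near[OF _ _ \<epsilon>(1)]) (use sm z0 h rel in \<open>auto intro!: sm_intros\<close>)
    then have d: "k2 * Dx b z0 - k3 * Dx a z0 = 0"
      unfolding dx_lincomb4[OF z0S sm(2,1,1,1)] by simp
    have "a z0 * (k3\<^sup>2 * v z0 + k1 * k3 * u z0 - 2 * k2\<^sup>2 * u z0 + 2 * k2 * k3 * s z0) = 0"
      using d rel[OF z0(1) z0_near] unfolding dx[OF z0S] by algebra
    then have a: "a z0 = 0" using exc by (simp add: exceptional_def k1_def k2_def k3_def u_def v_def s_def)
    then have "c z0 = 0" "b z0 = 0" using rel[OF z0(1) z0_near] k2_nonzero by (simp_all add: k2_def)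
    then show ?thesis unfolding \<Phi>[OF z0S] a by (simp add: matrix_eq_iff_2)
  qed
  obtain l1 g z1 where nz: "l1 \<noteq> 0" "g \<noteq> 0" "z1 \<in> S" "\<Phi> l1 g z1 \<noteq> 0"
    using nonzero by (auto simp: nonzero_field_def)
  then obtain i j where ij: "\<Phi> l1 g z1 $ i $ j \<noteq> 0" by (auto simp: vec_eq_iff)
  obtain F C where FC: "finite F" "\<And>l g z. l \<noteq> 0 \<Longrightarrow> g \<noteq> 0 \<Longrightarrow> z \<in> S \<Longrightarrow> \<Phi> l g z = (\<Sum>(m, n)\<in>F. (l powi m * g powi n) \<cdot>\<^sub>M C m n z)"
    by (rule polynomial_fieldE[OF poly], rule that) blast+
  \<comment> \<open>In \<open>l\<close> this entry is a Laurent polynomial, hence continuous at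
    \<open>l1\<close>: it stays nonzero nearby, where the finitely many exceptional parameters can
    be avoided.\<close>
  define f where "f l = (\<Sum>(m, n)\<in>F. (l powi m * g powi n) * C m n z1 $ i $ j)" for l
  have f: "\<Phi> l g z1 $ i $ j = f l" if "l \<noteq> 0" for l
    unfolding FC(2)[OF that nz(2,3)] f_def by (simp add: case_prod_unfold)
  have "isCont f l1"
    unfolding f_def case_prod_unfold using nz(1) by (intro continuous_intros) auto
  then have "\<forall>\<^sub>F l in at l1. f l \<noteq> 0"
    using ij f[OF nz(1)] by (simp add: isCont_def tendsto_imp_eventually_ne)
  moreover have "\<forall>\<^sub>F l in at l1. l \<notin> X" if "finite X" for X :: "complex set"
  proof -
    have "open (- (X - {l1}))" by (rule open_Compl[OF finite_imp_closed[OF finite_Diff[OF that]]])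
    then show ?thesis unfolding eventually_at_topological by (intro exI[of _ "- (X - {l1})"]) auto
  qed
  note avoid = this
  let ?X = "{l. l \<noteq> 0 \<and> exceptional g l = 0}"
  have "finite ?X" unfolding exceptional_def by (rule finite_exceptional) (use nz in auto)
  \<comment> \<open>Besides 0, the points \<open>g\<close> and \<open>- g\<close> are excluded as
    the zeros of \<open>l / g - g / l\<close>.\<close>
  then have "\<forall>\<^sub>F l in at l1. l \<notin> {0, g, - g} \<union> ?X" by (intro avoid) simp
  ultimately have "\<forall>\<^sub>F l in at l1. f l \<noteq> 0 \<and> l \<notin> {0, g, - g} \<union> ?X" by (rule eventually_conj)
  then obtain l where l: "f l \<noteq> 0" "l \<notin> {0, g, - g} \<union> ?X" using eventually_happens'[OF at_neq_bot] by blast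
  then have "l \<noteq> 0" by simp
  have "l / g - g / l \<noteq> 0"
  proof
    assume "l / g - g / l = 0"
    then have "l * l = g * g" using nz(2) \<open>l \<noteq> 0\<close> by (simp add: field_simps)
    then show False using l(2) by (auto simp: square_eq_iff)
  qed
  then have "\<Phi> l g z0 = 0" using l(2) \<open>l \<noteq> 0\<close> nz(2) by (intro zero) auto
  then have "\<Phi> l g z1 = 0"
    by (rule killing_field_zero[OF killing \<open>l \<noteq> 0\<close> nz(2) line[OF z0(1)] _ nz(3)])
  then show False using l(1) f[OF \<open>l \<noteq> 0\<close>] by simp
qed

end

theorem theorem2:
  fixes T A_plus B_plus A_minus B_minus :: real
    and \<omega> :: "complex \<Rightarrow> real"
  assumes "T > 0"
    and "smooth_within (strip T) \<omega>"
    and "x_periodic T \<omega>"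
    and "sinh_gordon T \<omega>"
  shows "durham_on_line T T A_plus B_plus \<omega> \<and> durham_on_line T (- T) A_minus B_minus \<omega> \<longleftrightarrow>
    (\<exists>\<Phi>. killing_field T \<omega> \<Phi> \<and> polynomial_field T \<Phi> \<and> nonzero_field T \<Phi> \<and>
         sklyanin_on_line T A_plus B_plus \<Phi> \<and> sklyanin_on_line (- T) A_minus B_minus \<Phi>)"
proof -
  interpret sinh_gordon_solution T \<omega> by unfold_locales (use assms in auto)
  have T: "T \<in> {-T..T}" "- T \<in> {-T..T}" using assms(1) by auto
  show ?thesis
  proof
    assume d: "durham_on_line T T A_plus B_plus \<omega> \<and> durham_on_line T (- T) A_minus B_minus \<omega>"
    obtain L where "0 < L" "\<And>z. z \<in> S \<Longrightarrow> \<omega> (z + of_real L) = \<omega> z"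
      using assms(3) by (auto simp: x_periodic_def)
    then obtain N r where Nr: "r N \<noteq> 0" "\<And>z. z \<in> S \<Longrightarrow> Im (\<Sum>n\<le>N. of_real (r n) * scoeff n z) = 0"
      using jacobi_relation_exists[of L A_plus B_plus A_minus B_minus] d by metis
    interpret jacobi_relation T \<omega> N r by unfold_locales (use Nr in auto)
    show "\<exists>\<Phi>. killing_field T \<omega> \<Phi> \<and> polynomial_field T \<Phi> \<and> nonzero_field T \<Phi> \<and>
         sklyanin_on_line T A_plus B_plus \<Phi> \<and> sklyanin_on_line (- T) A_minus B_minus \<Phi>"
      using killing_field_\<Phi> polynomial_field_\<Phi> nonzero_field_\<Phi> sklyanin_\<Phi> d T by blast
  next
    assume "\<exists>\<Phi>. killing_field T \<omega> \<Phi> \<and> polynomial_field T \<Phi> \<and> nonzero_field T \<Phi> \<and>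
         sklyanin_on_line T A_plus B_plus \<Phi> \<and> sklyanin_on_line (- T) A_minus B_minus \<Phi>"
    then show "durham_on_line T T A_plus B_plus \<omega> \<and> durham_on_line T (- T) A_minus B_minus \<omega>"
      using durham_if_sklyanin T by blast
  qed
qed

end
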